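(* There exists $c'\in(0,c]$ such that for every $\beta\in\mathbb{C}$ with $0<|\beta-1|\le c'$, as $N\to\infty$: 1. if $\operatorname{Re}\beta\le1$, then $$Z_{\beta,N}=\frac1{\sqrt{1-\beta}}\left(1+O\left(\frac1N\right)\right);$$ 2. if $\operatorname{Re}\beta\ge1$, then $$Z_{\beta,N}=\frac1{\sqrt{1-\beta}}\left(1+O\left(\frac1N\right)\right)+2\sqrt{\frac{\beta}{\beta-\beta^2+u_\beta^2}}\;e^{-Nh_\beta(u_\beta)}\left(1+O\left(\frac1N\right)\right).$$ Moreover, for any $\delta>0$ the implicit constants in the $O(\cdot)$ terms are uniform in $\beta$ with $\delta\le|\beta-1|\le c'$.
   Context: For an integer $N\ge1$ and $\beta\in\mathbb{C}$, the Curie–Weiss partition function is $$Z_{\beta,N}=\frac1{2^N}\sum_{\sigma\in\{-1,+1\}^N}\exp(-\beta H_N(\sigma)),\qquad H_N(\sigma)=-\frac1{2N}\sum_{i,j=1}^N\sigma_i\sigma_j .$$ For $\beta\ne0$ let $h_\beta(u)=\frac{u^2}{2\beta}-\log\cosh u$, an even function analytic on $\mathbb{C}\setminus\bigl((-i\infty,-i\pi/2]\cup[i\pi/2,+i\infty)\bigr)$, with the branch $\log\cosh 0=0$. Fix a sufficiently small constant $c>0$ such that for every $\beta$ with $0<|\beta-1|\le c$ the function $h_\beta'(u)=\frac u\beta-\tanh u$ has exactly three zeros in $|u|\le10\sqrt c$ (such $c$ exists); they are denoted $0,u_\beta,-u_\beta$. The choice of sign of $u_\beta$ is irrelevant since only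 $u_\beta^2$ and $h_\beta(u_\beta)$ appear. Square roots are principal branches ($\sqrt1=1$); for real $\beta>1$ either value of $\sqrt{1-\beta}$ may be taken. *)

theory Defs
  imports "HOL-Analysis.Analysis" "HOL-Library.Landau_Symbols"
begin

text \<open>A configuration \<open>\<sigma> \<in> {-1,+1}\<^sup>N\<close> is an extensional function on \<open>{1..N}\<close>.\<close>

definition spin_configs :: "nat \<Rightarrow> (nat \<Rightarrow> real) set" where
  "spin_configs N = {1..N} \<rightarrow>\<^sub>E {-1, 1}"

definition hamiltonian :: "nat \<Rightarrow> (nat \<Rightarrow> real) \<Rightarrow> real" where
  "hamiltonian N \<sigma> = - (1 / (2 * real N)) * (\<Sum>i=1..N. \<Sum>j=1..N. \<sigma> i * \<sigma> j)"

definition partition_fun :: "complex \<Rightarrow> nat \<Rightarrow> complex" where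
  "partition_fun \<beta> N =
     1 / 2 ^ N * (\<Sum>\<sigma>\<in>spin_configs N. exp (- \<beta> * of_real (hamiltonian N \<sigma>)))"

definition slit_plane :: "complex set" where
  "slit_plane = - {z. Re z = 0 \<and> pi / 2 \<le> \<bar>Im z\<bar>}"

text \<open>
  The principal logarithm of \<open>cosh u\<close> is discontinuous in \<open>slit_plane\<close>, so the branch is
  characterised as the holomorphic one vanishing at \<open>0\<close>; lemma \<open>log_cosh_eqI\<close> below shows
  that this determines it on \<open>slit_plane\<close>. Values outside \<open>slit_plane\<close> are irrelevant.
\<close>

definition is_log_cosh :: "(complex \<Rightarrow> complex) \<Rightarrow> bool" where
  "is_log_cosh g \<longleftrightarrow>
     g holomorphic_on slit_plane \<and> g 0 = 0 \<and> (\<forall>z\<in>slit_plane. exp (g z) = cosh z)"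

definition log_cosh :: "complex \<Rightarrow> complex" where
  "log_cosh = (SOME g. is_log_cosh g)"

definition h_fun :: "complex \<Rightarrow> complex \<Rightarrow> complex" where
  "h_fun \<beta> z = z ^ 2 / (2 * \<beta>) - log_cosh z"

lemma open_slit_plane: "open slit_plane"
  unfolding slit_plane_def
  by (intro open_Compl closed_Collect_conj closed_Collect_eq closed_Collect_le continuous_intros)

lemma zero_in_slit_plane: "0 \<in> slit_plane"
  by (simp add: slit_plane_def not_le)

lemma starlike_slit_plane: "starlike slit_plane"
  unfolding starlike_def
proof (intro bexI[of _ 0] ballI subsetI)
  fix z w assume z: "z \<in> slit_plane" and w: "w \<in> closed_segment 0 z"
  then obtain t where t: "0 \<le> t" "t \<le> 1" "w = of_real t * z"
    by (auto simp: in_segment scaleR_conv_of_real)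
  have "\<bar>Im w\<bar> \<le> \<bar>Im z\<bar>"
    using t by (simp add: abs_mult mult_left_le_one_le)
  moreover have "Im w = 0" if "t = 0"
    using t that by simp
  moreover have "Re w = 0 \<longleftrightarrow> t = 0 \<or> Re z = 0"
    using t by simp
  ultimately show "w \<in> slit_plane"
    using z by (auto simp: slit_plane_def not_le)
qed (rule zero_in_slit_plane)

lemma cosh_nonzero_slit_plane: "z \<in> slit_plane \<Longrightarrow> cosh z \<noteq> 0"
proof
  assume z: "z \<in> slit_plane" and "cosh z = 0"
  then obtain n :: int where n: "\<i> * z = of_real (n * pi) + of_real pi / 2"
    by (auto simp: cosh_conv_cos cos_eq_0)
  have "Re (\<i> * z) = of_int n * pi + pi / 2" "Im (\<i> * z) = 0"
    unfolding n by simp_all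
  hence *: "Im z = - (of_int n + 1/2) * pi" "Re z = 0"
    by (simp_all add: algebra_simps)
  have "1/2 \<le> \<bar>of_int n + 1/2 :: real\<bar>"
    by (cases "n \<ge> 0") (simp_all add: abs_if, linarith?)
  hence "pi / 2 \<le> \<bar>of_int n + 1/2\<bar> * pi"
    using mult_right_mono[of "1/2" "\<bar>of_int n + 1/2\<bar>" pi] by simp
  hence "pi / 2 \<le> \<bar>Im z\<bar>"
    by (simp only: *(1) abs_mult abs_minus_cancel) simp
  thus False using z * by (simp add: slit_plane_def)
qed

lemma complex_DERIV_cosh: "(cosh has_field_derivative sinh z) (at z)" for z :: complex
  by (auto intro!: derivative_eq_intros)

lemma is_log_cosh_log_cosh: "is_log_cosh log_cosh"
proof -
  have "cosh holomorphic_on slit_plane"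
    by (auto simp: holomorphic_on_open[OF open_slit_plane] intro!: exI complex_DERIV_cosh)
  moreover have "simply_connected slit_plane"
    by (rule starlike_imp_simply_connected[OF starlike_slit_plane])
  moreover have "locally path_connected slit_plane"
    by (simp add: open_imp_locally_path_connected open_slit_plane)
  ultimately obtain g where g: "g holomorphic_on slit_plane"
      "\<And>z. z \<in> slit_plane \<Longrightarrow> cosh z = exp (g z)"
    using simply_connected_imp_holomorphic_log cosh_nonzero_slit_plane by blast
  have "exp (g 0) = 1"
    using g(2)[OF zero_in_slit_plane] by simp
  hence "is_log_cosh (\<lambda>z. g z - g 0)"
    using g by (auto simp: is_log_cosh_def exp_diff intro!: holomorphic_intros)
  thus ?thesis
    unfolding log_cosh_def by (rule someI[of is_log_cosh])
qed

lemma is_log_cosh_has_derivative: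
  assumes "is_log_cosh g" "z \<in> slit_plane"
  shows "(g has_field_derivative tanh z) (at z)"
proof -
  obtain d where d: "(g has_field_derivative d) (at z)"
    using assms open_slit_plane by (auto simp: is_log_cosh_def holomorphic_on_open)
  have "((\<lambda>w. exp (g w)) has_field_derivative exp (g z) * d) (at z)"
    using d by (auto intro!: derivative_eq_intros)
  moreover have "((\<lambda>w. exp (g w)) has_field_derivative sinh z) (at z)"
    by (rule has_field_derivative_transform_within_open[OF complex_DERIV_cosh open_slit_plane])
       (use assms in \<open>auto simp: is_log_cosh_def\<close>)
  ultimately have "cosh z * d = sinh z"
    using assms by (auto simp: is_log_cosh_def dest: DERIV_unique)
  hence "d = tanh z"
    using cosh_nonzero_slit_plane[OF assms(2)] by (auto simp: tanh_def field_simps)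
  with d show ?thesis by simp
qed

lemma log_cosh_eqI:
  assumes g: "is_log_cosh g" and z: "z \<in> slit_plane"
  shows "g z = log_cosh z"
proof -
  have "((\<lambda>w. g w - log_cosh w) has_field_derivative 0) (at w within slit_plane)"
    if "w \<in> slit_plane" for w
    using DERIV_diff[OF is_log_cosh_has_derivative[OF g that]
        is_log_cosh_has_derivative[OF is_log_cosh_log_cosh that]]
    by (auto intro: has_field_derivative_at_within)
  then have "(\<lambda>w. g w - log_cosh w) constant_on slit_plane"
    by (intro has_field_derivative_0_imp_constant_on open_slit_plane
          starlike_imp_connected starlike_slit_plane)
       (simp add: at_within_open[OF _ open_slit_plane])
  then have "g z - log_cosh z = g 0 - log_cosh 0"
    using z zero_in_slit_plane unfolding constant_on_def by metis
  with g is_log_cosh_log_cosh show ?thesis by (simp add: is_log_cosh_def)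
qed

lemma deriv_h_fun:
  assumes "z \<in> slit_plane"
  shows "deriv (h_fun \<beta>) z = z / \<beta> - tanh z"
proof -
  have "((\<lambda>z. z ^ 2 / (2 * \<beta>)) has_field_derivative z / \<beta>) (at z)"
    unfolding divide_inverse by (auto intro!: derivative_eq_intros)
  from DERIV_diff[OF this is_log_cosh_has_derivative[OF is_log_cosh_log_cosh assms]]
  show ?thesis by (intro DERIV_imp_deriv) (simp add: h_fun_def[abs_def])
qed

end

theory Submission
  imports Defs "HOL-Probability.Distributions" "HOL-Complex_Analysis.Complex_Analysis"
begin

text \<open>
  The Hubbard--Stratonovich transformation writes \<open>partition_fun \<beta> N\<close> as a Gaussian integral of
  \<open>cosh z ^ N\<close>, that is, as a constant times the integral of \<open>exp (- N h z)\<close> with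
  \<open>h z = z\<^sup>2 / (2 \<beta>) - log (cosh z)\<close>, along any line through \<open>0\<close> on which the Gaussian factor decays
  (\<open>partition_fun_integral\<close>). The phase \<open>h\<close> has the critical points \<open>0\<close> and \<open>\<plusminus>u\<close> near the origin. The
  saddle at \<open>0\<close> yields \<open>1 / sqrt (1 - \<beta>)\<close>, the saddles at \<open>\<plusminus>u\<close> yield the second term.

  Since \<open>h\<close> is even, everything is expressed through \<open>p = z\<^sup>2\<close>: with \<open>L p = log (cosh (sqrt p))\<close>, which
  is holomorphic near \<open>0\<close> and equals \<open>p / 2 - p\<^sup>2 / 12\<close> up to higher order, the critical point is
  determined by \<open>P = u\<^sup>2\<close> with \<open>1 / (2 \<beta>) = L' P\<close>, and \<open>h z - h u\<close> is \<open>(p - P)\<^sup>2 / 12\<close> up to a small relative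
  error. So \<open>P\<close>, which is about \<open>3 (\<beta> - 1)\<close>, is used as the parameter instead of \<open>\<beta>\<close>. After rescaling
  by \<open>P\<close> the phase is a perturbation of a fixed quartic polynomial, the large parameter is
  \<open>\<Lambda> = N \<bar>P\<bar>\<^sup>2\<close>, and all estimates are uniform in \<open>P\<close>; this gives the uniformity for \<open>\<delta> \<le> \<bar>\<beta> - 1\<bar>\<close>.

  Only the direction of \<open>P\<close> matters for the choice of the path.
  \<^item> Where \<open>Re (P\<^sup>2)\<close> is clearly negative, or \<open>Re P \<le> 0\<close>, the real axis rotated by nearly \<open>pi / 8\<close>,
    towards the side of \<open>Im P\<close>, descends from the saddle at \<open>0\<close> and avoids the saddles at \<open>\<plusminus>u\<close>
    (\<open>partition_fun_origin_saddle\<close>). When \<open>Re \<beta> \<ge> 1\<close>, the second term is then negligible.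
  \<^item> Where \<open>Re (P\<^sup>2)\<close> is clearly positive and \<open>Re P > 0\<close>, the line through \<open>-u\<close>, \<open>0\<close> and \<open>u\<close> descends
    from \<open>\<plusminus>u\<close>, and the first term is exponentially small against the second one
    (\<open>partition_fun_outer_saddles\<close>).
  \<^item> Near the rays on which \<open>P\<^sup>2\<close> is imaginary, a broken line through all three saddles is
    needed (\<open>partition_fun_all_saddles\<close>).

  In each case Laplace's method, in the uniform form \<open>laplace_asymptotics\<close>, evaluates the
  integrals. Away from the origin the integrand is controlled by the inequality
  \<open>\<bar>cosh z\<bar> \<le> exp (Re (z\<^sup>2) / 2)\<close>, valid for \<open>5 \<bar>Im z\<bar> \<le> 2 \<bar>Re z\<bar>\<close>, and its sharpening
  \<open>norm_cosh_le\<close>. For \<open>Re \<beta> \<le> 1\<close> the error is at most \<open>K / \<Lambda>\<close> times the first term. For \<open>Re \<beta> \<ge> 1\<close> it is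
  at most \<open>K / \<Lambda>\<close> times the larger of the two terms (\<open>partition_fun_estimate\<close>), and it is then
  attributed entirely to the larger term.
\<close>

section \<open>Gaussian integrals with complex parameters\<close>

lemma integrable_gaussian_moment:
  fixes m :: real
  assumes "m > 0"
  shows "integrable lborel (\<lambda>s. s ^ (2 * k) * exp (- m * s\<^sup>2))"
proof -
  define \<sigma> where "\<sigma> = 1 / sqrt (2 * m)"
  have \<sigma>: "\<sigma> > 0" "2 * \<sigma>\<^sup>2 = 1 / m"
    using assms by (simp_all add: \<sigma>_def power_divide)
  have "integrable lborel (\<lambda>s. sqrt (2 * pi * \<sigma>\<^sup>2) * (normal_density 0 \<sigma> s * (s - 0) ^ (2 * k)))"
    by (intro integrable_mult_right) (use normal_moment_even[OF \<sigma>(1), of 0 k] in \<open>simp add: has_bochner_integral_iff\<close>)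
  also have "(\<lambda>s. sqrt (2 * pi * \<sigma>\<^sup>2) * (normal_density 0 \<sigma> s * (s - 0) ^ (2 * k)))
           = (\<lambda>s. s ^ (2 * k) * exp (- m * s\<^sup>2))"
  proof
    fix s :: real
    have "sqrt (2 * pi * \<sigma>\<^sup>2) > 0" using \<sigma>(1) by simp
    moreover have "- (s - 0)\<^sup>2 / (2 * \<sigma>\<^sup>2) = - m * s\<^sup>2"
      unfolding \<sigma>(2) by simp
    moreover have c_cancel: "c > 0 \<Longrightarrow> c * (1 / c * e * p) = p * e" for c e p :: real
      by simp
    ultimately show "sqrt (2 * pi * \<sigma>\<^sup>2) * (normal_density 0 \<sigma> s * (s - 0) ^ (2 * k)) = s ^ (2 * k) * exp (- m * s\<^sup>2)"
      unfolding normal_density_def by (simp only:) (metis c_cancel diff_zero)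
  qed
  finally show ?thesis .
qed

lemma entire_primitive:
  fixes f :: "complex \<Rightarrow> complex"
  assumes "f holomorphic_on UNIV"
  shows "\<exists>F. \<forall>z. (F has_field_derivative f z) (at z)"
  using holomorphic_convex_primitive'[OF convex_UNIV open_UNIV assms] by (metis UNIV_I)

text \<open>The odd primitive of the Gaussian has the same limit along all rays with a direction in the
  sector \<open>\<bar>arg z\<bar> < pi / 4\<close>. This replaces the rotation and translation of lines of integration.\<close>

lemma gaussian_primitive:
  obtains F :: "complex \<Rightarrow> complex" where
    "\<And>z. (F has_field_derivative exp (- z\<^sup>2)) (at z)"
    "\<And>z. F (- z) = - F z"
    "\<And>\<kappa> c. \<bar>Im \<kappa>\<bar> < Re \<kappa> \<Longrightarrow>
       ((\<lambda>s. F (\<kappa> * of_real s + c)) \<longlongrightarrow> of_real (sqrt pi / 2)) at_top"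
proof -
  have "(\<lambda>z::complex. exp (- z\<^sup>2)) holomorphic_on UNIV"
    by (intro holomorphic_intros)
  from entire_primitive[OF this]
  obtain F0 where F0: "\<And>z::complex. (F0 has_field_derivative exp (- z\<^sup>2)) (at z)" by blast
  define F where "F z = F0 z - F0 0" for z
  have F: "(F has_field_derivative exp (- z\<^sup>2)) (at z)" for z
    unfolding F_def by (auto intro!: derivative_eq_intros F0)
  have odd: "F (- z) = - F z" for z
  proof -
    have "((\<lambda>w. F w + F (- w)) has_field_derivative 0) (at w)" for w
      by (auto intro!: derivative_eq_intros DERIV_chain2[OF F])
    hence "(\<lambda>w. F w + F (- w)) constant_on UNIV"
      by (intro has_field_derivative_0_imp_constant_on) auto
    hence "F z + F (- z) = F 0 + F (- 0)" unfolding constant_on_def by (metis UNIV_I)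
    thus ?thesis by (simp add: F_def algebra_simps eq_neg_iff_add_eq_0)
  qed
  have real_lim: "((\<lambda>x. F (of_real x)) \<longlongrightarrow> of_real (sqrt pi / 2)) at_top"
  proof -
    let ?g = "\<lambda>x::real. of_real (exp (- x\<^sup>2)) :: complex"
    have g: "has_bochner_integral lborel (\<lambda>x. of_real (indicator {0..} x *\<^sub>R exp (- x\<^sup>2)) :: complex)
        (of_real (sqrt pi / 2))"
      by (rule has_bochner_integral_of_real) (rule gaussian_moment_0)
    have gi: "set_integrable lborel {0..} ?g" "(LINT x:{0..}|lborel. ?g x) = of_real (sqrt pi / 2)"
      using g unfolding has_bochner_integral_iff set_integrable_def set_lebesgue_integral_def
      by (simp_all add: scaleR_conv_of_real)
    have "((\<lambda>y. LINT x:{0..y}|lborel. ?g x) \<longlongrightarrow> (LINT x:{0..}|lborel. ?g x)) at_top"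
      by (rule tendsto_set_lebesgue_integral_at_top) (use gi in auto)
    moreover have "\<forall>\<^sub>F y in at_top. (LINT x:{0..y}|lborel. ?g x) = F (of_real y)"
    proof (rule eventually_mono[OF eventually_ge_at_top[of 0]])
      fix y :: real assume y: "0 \<le> y"
      have "(\<integral>x. indicator {0..y} x *\<^sub>R ?g x \<partial>lborel) = F (of_real y) - F (of_real 0)"
      proof (rule integral_FTC_Icc[OF y])
        fix x :: real
        have "((\<lambda>x. F (of_real x)) has_vector_derivative 1 * exp (- (of_real x)\<^sup>2)) (at x)"
          using field_vector_diff_chain_at[of of_real 1 x F "exp (- (of_real x)\<^sup>2)"]
            F[of "of_real x"] by (simp add: o_def has_vector_derivative_real_field)
        moreover have "exp (- (of_real x)\<^sup>2) = ?g x"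
          by (simp add: exp_of_real[symmetric])
        ultimately show "((\<lambda>x. F (of_real x)) has_vector_derivative ?g x) (at x within {0..y})"
          by (simp only: mult_1 has_vector_derivative_at_within)
      qed (auto intro!: continuous_intros)
      thus "(LINT x:{0..y}|lborel. ?g x) = F (of_real y)"
        by (simp add: set_lebesgue_integral_def F_def)
    qed
    ultimately show ?thesis
      unfolding gi(2) by (rule Lim_transform_eventually)
  qed
  have lim: "((\<lambda>s. F (\<kappa> * of_real s + c)) \<longlongrightarrow> of_real (sqrt pi / 2)) at_top"
    if \<kappa>: "\<bar>Im \<kappa>\<bar> < Re \<kappa>" for \<kappa> c
  proof -
    define X where "X s = Re \<kappa> * s + Re c" for s :: real
    define Y where "Y s = Im \<kappa> * s + Im c" for s :: real
    have z: "\<kappa> * of_real s + c = Complex (X s) (Y s)" for s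
      by (simp add: complex_eq_iff X_def Y_def)
    have pos: "Re \<kappa> > 0" using \<kappa> by linarith
    have XT: "filterlim X at_top at_top"
      unfolding X_def using pos by real_asymp
    have diff: "norm (F (Complex x y) - F (of_real x)) \<le> exp (y\<^sup>2 - x\<^sup>2) * \<bar>y\<bar>" for x y
    proof -
      have "norm (F (Complex x y) - F (of_real x)) \<le> exp (y\<^sup>2 - x\<^sup>2) * norm (Complex x y - of_real x)"
      proof (rule field_differentiable_bound[of "closed_segment (of_real x) (Complex x y)" F "\<lambda>z. exp (- z\<^sup>2)"])
        fix z assume z: "z \<in> closed_segment (of_real x) (Complex x y)"
        show "(F has_field_derivative exp (- z\<^sup>2)) (at z within closed_segment (complex_of_real x) (Complex x y))"
          by (rule has_field_derivative_at_within) (rule F)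
        from z obtain t where t: "0 \<le> t" "t \<le> 1"
            and zt: "z = (1 - t) *\<^sub>R of_real x + t *\<^sub>R Complex x y"
          by (auto simp: in_segment)
        have zt: "Re z = x" "Im z = t * y"
          unfolding zt by (simp_all add: algebra_simps)
        have "(t * y)\<^sup>2 \<le> y\<^sup>2"
          using t by (auto simp: power_mult_distrib intro!: mult_left_le_one_le power_le_one)
        thus "norm (exp (- z\<^sup>2)) \<le> exp (y\<^sup>2 - x\<^sup>2)"
          using zt by (simp add: Re_power2)
      qed auto
      also have "norm (Complex x y - of_real x) = \<bar>y\<bar>"
        by (simp add: cmod_def complex_eq_iff)
      finally show ?thesis .
    qed
    have lim0: "((\<lambda>s. exp ((Y s)\<^sup>2 - (X s)\<^sup>2) * \<bar>Y s\<bar>) \<longlongrightarrow> 0) at_top"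
    proof -
      define k where "k = (Re \<kappa>)\<^sup>2 - (Im \<kappa>)\<^sup>2"
      have k: "k > 0"
        using power_strict_mono[OF \<kappa>, of 2] unfolding k_def by simp
      have eq: "(Y s)\<^sup>2 - (X s)\<^sup>2 = - k * s\<^sup>2 + 2 * (Im \<kappa> * Im c - Re \<kappa> * Re c) * s + ((Im c)\<^sup>2 - (Re c)\<^sup>2)" for s
        by (simp add: X_def Y_def k_def power2_eq_square algebra_simps)
      define d e f where "d = 2 * (Im \<kappa> * Im c - Re \<kappa> * Re c)" and "e = (Im c)\<^sup>2 - (Re c)\<^sup>2" and "f = \<bar>Im c\<bar>"
      have "((\<lambda>s. exp (- k * s\<^sup>2 + d * s + e) * (\<bar>Im \<kappa>\<bar> * s + f)) \<longlongrightarrow> 0) at_top"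
      proof -
        have "((\<lambda>s. exp (- k * s\<^sup>2 + d * s + e) * s) \<longlongrightarrow> 0) at_top"
             "((\<lambda>s. exp (- k * s\<^sup>2 + d * s + e)) \<longlongrightarrow> 0) at_top"
          using k by real_asymp+
        from tendsto_add[OF tendsto_mult_right_zero[OF this(1), of "\<bar>Im \<kappa>\<bar>"]
             tendsto_mult_right_zero[OF this(2), of f]]
        show ?thesis by (simp add: algebra_simps)
      qed
      moreover have "\<forall>\<^sub>F s in at_top. norm (exp ((Y s)\<^sup>2 - (X s)\<^sup>2) * \<bar>Y s\<bar>)
          \<le> exp (- k * s\<^sup>2 + d * s + e) * (\<bar>Im \<kappa>\<bar> * s + f)"
      proof (rule eventually_mono[OF eventually_ge_at_top[of 0]])
        fix s :: real assume s: "0 \<le> s"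
        have "\<bar>Y s\<bar> \<le> \<bar>Im \<kappa> * s\<bar> + \<bar>Im c\<bar>"
          unfolding Y_def by (rule abs_triangle_ineq)
        also have "\<dots> = \<bar>Im \<kappa>\<bar> * s + f"
          using s by (simp add: f_def abs_mult)
        finally have "exp ((Y s)\<^sup>2 - (X s)\<^sup>2) * \<bar>Y s\<bar> \<le> exp ((Y s)\<^sup>2 - (X s)\<^sup>2) * (\<bar>Im \<kappa>\<bar> * s + f)"
          by (rule mult_left_mono) simp
        thus "norm (exp ((Y s)\<^sup>2 - (X s)\<^sup>2) * \<bar>Y s\<bar>) \<le> exp (- k * s\<^sup>2 + d * s + e) * (\<bar>Im \<kappa>\<bar> * s + f)"
          by (simp only: eq d_def e_def real_norm_def abs_mult abs_exp_cancel abs_idempotent)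
      qed
      ultimately show ?thesis by (rule Lim_null_comparison[rotated])
    qed
    have "((\<lambda>s. F (Complex (X s) (Y s)) - F (of_real (X s))) \<longlongrightarrow> 0) at_top"
      by (rule Lim_null_comparison[OF _ lim0]) (auto intro!: always_eventually diff)
    moreover have "((\<lambda>s. F (of_real (X s))) \<longlongrightarrow> of_real (sqrt pi / 2)) at_top"
      using filterlim_compose[OF real_lim XT] by simp
    ultimately have "((\<lambda>s. F (Complex (X s) (Y s)) - F (of_real (X s)) + F (of_real (X s))) \<longlongrightarrow> 0 + of_real (sqrt pi / 2)) at_top"
      by (rule tendsto_add)
    thus ?thesis by (simp add: z)
  qed
  show ?thesis by (rule that[OF F odd lim])
qed

lemma csqrt_Re_pos:
  assumes "Re a > 0"
  shows "\<bar>Im (csqrt a)\<bar> < Re (csqrt a)"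
proof -
  have "Re a = (Re (csqrt a))\<^sup>2 - (Im (csqrt a))\<^sup>2"
    using arg_cong[OF power2_csqrt[of a], of Re] by (simp only: Re_power2)
  with assms have "\<bar>Im (csqrt a)\<bar>\<^sup>2 < (Re (csqrt a))\<^sup>2"
    unfolding power2_abs by linarith
  moreover have "Re (csqrt a) \<ge> 0" by (rule Re_csqrt)
  ultimately show ?thesis by (rule power2_less_imp_less)
qed

lemma integrable_exp_quadratic:
  assumes "Re a > 0"
  shows "integrable lborel (\<lambda>s::real. exp (- a * of_real (s\<^sup>2) + b * of_real s) :: complex)"
proof (rule Bochner_Integration.integrable_bound)
  define m where "m = Re a / 2"
  have m: "m > 0" using assms by (simp add: m_def)
  show "integrable lborel (\<lambda>s. exp ((Re b)\<^sup>2 / (4 * m)) * (s ^ (2 * 0) * exp (- m * s\<^sup>2)))"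
    by (intro integrable_mult_right integrable_gaussian_moment m)
  show "(\<lambda>s::real. exp (- a * of_real (s\<^sup>2) + b * of_real s) :: complex) \<in> borel_measurable lborel"
    unfolding measurable_lborel2
    by (intro borel_measurable_continuous_onI continuous_intros)
  show "AE s in lborel. norm (exp (- a * of_real (s\<^sup>2) + b * of_real s) :: complex)
      \<le> norm (exp ((Re b)\<^sup>2 / (4 * m)) * (s ^ (2 * 0) * exp (- m * s\<^sup>2)))"
  proof (rule AE_I2)
    fix s :: real
    have "(Re b - 2 * m * s)\<^sup>2 / (4 * m) \<ge> 0" using m by simp
    hence "Re b * s \<le> (Re b)\<^sup>2 / (4 * m) + m * s\<^sup>2"
      using m by (simp add: power2_eq_square field_simps)
    hence "- Re a * s\<^sup>2 + Re b * s \<le> (Re b)\<^sup>2 / (4 * m) + (- m * s\<^sup>2)"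
      by (simp add: m_def algebra_simps)
    thus "norm (exp (- a * of_real (s\<^sup>2) + b * of_real s) :: complex)
      \<le> norm (exp ((Re b)\<^sup>2 / (4 * m)) * (s ^ (2 * 0) * exp (- m * s\<^sup>2)))"
      by (simp add: mult_exp_exp)
  qed
qed

lemma integral_exp_quadratic:
  assumes "Re a > 0"
  shows "(\<integral>s. exp (- a * of_real (s\<^sup>2) + b * of_real s) \<partial>lborel)
       = exp (b\<^sup>2 / (4 * a)) * of_real (sqrt pi) / csqrt a"
proof -
  obtain F where F: "\<And>z. (F has_field_derivative exp (- z\<^sup>2)) (at z)"
    "\<And>z. F (- z) = - F z"
    "\<And>\<kappa> c. \<bar>Im \<kappa>\<bar> < Re \<kappa> \<Longrightarrow>
       ((\<lambda>s. F (\<kappa> * of_real s + c)) \<longlongrightarrow> of_real (sqrt pi / 2)) at_top"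
    using gaussian_primitive by blast
  define \<kappa> where "\<kappa> = csqrt a"
  have \<kappa>2: "\<kappa>\<^sup>2 = a" and \<kappa>: "\<bar>Im \<kappa>\<bar> < Re \<kappa>"
    using csqrt_Re_pos[OF assms] by (simp_all add: \<kappa>_def)
  have "\<kappa> \<noteq> 0" using \<kappa> by auto
  define c where "c = - b / (2 * \<kappa>)"
  let ?G = "\<lambda>s. exp (b\<^sup>2 / (4 * a)) / \<kappa> * F (\<kappa> * of_real s + c)"
  let ?f = "\<lambda>s. exp (- a * of_real (s\<^sup>2) + b * of_real s)"
  have feq: "exp (b\<^sup>2 / (4 * a)) * exp (- (\<kappa> * of_real s + c)\<^sup>2) = ?f s" for s
  proof -
    have "b\<^sup>2 / (4 * \<kappa>\<^sup>2) + - (\<kappa> * of_real s + c)\<^sup>2 = - \<kappa>\<^sup>2 * of_real (s\<^sup>2) + b * of_real s"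
      using \<open>\<kappa> \<noteq> 0\<close> unfolding c_def
      by (simp add: power2_eq_square divide_simps) (simp add: algebra_simps)
    thus ?thesis by (simp only: mult_exp_exp \<kappa>2)
  qed
  have top: "(?G \<longlongrightarrow> exp (b\<^sup>2 / (4 * a)) / \<kappa> * of_real (sqrt pi / 2)) at_top"
    by (intro tendsto_intros F(3) \<kappa>)
  have bot: "(?G \<longlongrightarrow> exp (b\<^sup>2 / (4 * a)) / \<kappa> * (- of_real (sqrt pi / 2))) at_bot"
  proof (intro tendsto_intros)
    have "((\<lambda>s. - F (\<kappa> * of_real s + (- c))) \<longlongrightarrow> - of_real (sqrt pi / 2)) at_top"
      by (intro tendsto_intros F(3) \<kappa>)
    from filterlim_compose[OF this filterlim_uminus_at_top_at_bot]
    show "((\<lambda>s. F (\<kappa> * of_real s + c)) \<longlongrightarrow> - of_real (sqrt pi / 2)) at_bot"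
      by (simp add: add.commute flip: F(2))
  qed
  have "(LBINT s=-\<infinity>..\<infinity>. ?f s) = exp (b\<^sup>2 / (4 * a)) / \<kappa> * of_real (sqrt pi / 2)
      - exp (b\<^sup>2 / (4 * a)) / \<kappa> * (- of_real (sqrt pi / 2))"
  proof (rule interval_integral_FTC_integrable[where F = ?G])
    fix s :: real
    have "((\<lambda>w. exp (b\<^sup>2 / (4 * a)) / \<kappa> * F (\<kappa> * w + c)) has_field_derivative
        exp (b\<^sup>2 / (4 * a)) / \<kappa> * (exp (- (\<kappa> * of_real s + c)\<^sup>2) * \<kappa>)) (at (of_real s))"
      by (auto intro!: derivative_eq_intros DERIV_chain2[OF F(1)])
    also have "exp (b\<^sup>2 / (4 * a)) / \<kappa> * (exp (- (\<kappa> * of_real s + c)\<^sup>2) * \<kappa>) = ?f s"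
      using feq[of s] \<open>\<kappa> \<noteq> 0\<close> by simp
    finally show "(?G has_vector_derivative ?f s) (at s)"
      by (rule has_vector_derivative_real_field)
  next
    show "set_integrable lborel (einterval (-\<infinity>) \<infinity>) ?f"
      using integrable_exp_quadratic[OF assms, of b] by (simp add: set_integrable_def)
  next
    show "((?G \<circ> real_of_ereal) \<longlongrightarrow> exp (b\<^sup>2 / (4 * a)) / \<kappa> * (- of_real (sqrt pi / 2))) (at_right (- \<infinity>))"
      using bot by (simp add: at_right_MInf filterlim_filtermap o_def)
    show "((?G \<circ> real_of_ereal) \<longlongrightarrow> exp (b\<^sup>2 / (4 * a)) / \<kappa> * of_real (sqrt pi / 2)) (at_left \<infinity>)"
      using top by (simp add: at_left_PInf filterlim_filtermap o_def)
  next
    fix s :: real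
    show "isCont ?f s" by (intro continuous_intros)
  qed simp
  moreover have "(LBINT s=-\<infinity>..\<infinity>. ?f s) = (\<integral>s. ?f s \<partial>lborel)"
    by (simp add: interval_lebesgue_integral_def set_lebesgue_integral_def)
  moreover have "E / \<kappa> * (p / 2) - E / \<kappa> * (- (p / 2)) = E * p / \<kappa>" for E p
    by (simp add: field_simps)
  ultimately show ?thesis by (simp add: \<kappa>_def mult.commute)
qed

section \<open>Laplace's method with uniform error bounds\<close>

(* The components of csqrt z contain norm z and Re z, so rewriting with an equation for
  Re z in terms of csqrt z would not terminate. *)
declare csqrt.simps [simp del]

lemma norm_exp_minus_linear:
  fixes x :: complex
  shows "norm (exp x - 1 - x) \<le> max 1 (exp (Re x)) * (norm x)\<^sup>2"
proof -
  have "norm (exp x - (\<Sum>i\<le>1. exp 0 * (x - 0) ^ i / fact i))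
      \<le> max 1 (exp (Re x)) * norm (x - 0) ^ Suc 1 / fact 1"
  proof (rule complex_Taylor[of "closed_segment 0 x" 1 "\<lambda>_. exp"])
    fix z assume "z \<in> closed_segment 0 x"
    then obtain t where t: "0 \<le> t" "t \<le> 1" "z = of_real t * x"
      by (auto simp: in_segment scaleR_conv_of_real)
    have "t * Re x \<le> max 0 (Re x)"
      using t by (cases "Re x \<ge> 0") (auto intro: mult_left_le_one_le simp: mult_nonneg_nonpos max_def)
    hence "exp (t * Re x) \<le> exp (max 0 (Re x))" by simp
    also have "\<dots> \<le> max 1 (exp (Re x))" by (auto simp: max_def)
    finally show "norm (exp z) \<le> max 1 (exp (Re x))" using t by simp
  qed (auto intro: DERIV_exp has_field_derivative_at_within)
  thus ?thesis by (simp add: power2_eq_square diff_diff_eq)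
qed

text \<open>The estimate of Laplace's method: for a phase with quadratic part \<open>a t\<^sup>2\<close> and arbitrary cubic part
  \<open>e t\<^sup>3\<close>, the integral times \<open>sqrt \<Lambda>\<close> is the Gaussian value up to an error \<open>K / \<Lambda>\<close>. The constant \<open>K\<close> depends only on
  the lower bound \<open>m\<close> for the decay, on the bound \<open>M\<close> for the Taylor coefficients and on the size \<open>b\<close>
  of the interval on which the expansion holds.\<close>

definition laplace_bound :: "real \<Rightarrow> real \<Rightarrow> real \<Rightarrow> real \<Rightarrow> bool" where
  "laplace_bound m M b K \<longleftrightarrow> (\<forall>\<Lambda> a e g \<Phi> J. \<Lambda> > 0 \<longrightarrow> closed J \<longrightarrow> {-b..b} \<subseteq> J \<longrightarrow> continuous_on J \<Phi> \<longrightarrow>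
     (\<forall>t\<in>J. norm (\<Phi> t) \<le> exp (- (\<Lambda> * m * t\<^sup>2))) \<longrightarrow> m \<le> Re a \<longrightarrow> norm e \<le> M \<longrightarrow>
     (\<forall>t. \<bar>t\<bar> \<le> b \<longrightarrow> \<Phi> t = exp (- (of_real \<Lambda> * g t))) \<longrightarrow>
     (\<forall>t. \<bar>t\<bar> \<le> b \<longrightarrow> norm (g t - a * of_real t ^ 2 - e * of_real t ^ 3) \<le> M * t ^ 4) \<longrightarrow>
     norm (of_real (sqrt \<Lambda>) * (LINT t:J|lborel. \<Phi> t) - of_real (sqrt pi) / csqrt a) \<le> K / \<Lambda>)"

lemma laplace_boundD:
  assumes "laplace_bound m M b K" "\<Lambda> > 0" "closed J" "{-b..b} \<subseteq> J" "continuous_on J \<Phi>"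
    "\<And>t. t \<in> J \<Longrightarrow> norm (\<Phi> t) \<le> exp (- (\<Lambda> * m * t\<^sup>2))" "m \<le> Re a" "norm e \<le> M"
    "\<And>t. \<bar>t\<bar> \<le> b \<Longrightarrow> \<Phi> t = exp (- (of_real \<Lambda> * g t))"
    "\<And>t. \<bar>t\<bar> \<le> b \<Longrightarrow> norm (g t - a * of_real t ^ 2 - e * of_real t ^ 3) \<le> M * t ^ 4"
  shows "norm (of_real (sqrt \<Lambda>) * (LINT t:J|lborel. \<Phi> t) - of_real (sqrt pi) / csqrt a) \<le> K / \<Lambda>"
  using assms unfolding laplace_bound_def by blast

text \<open>After rescaling \<open>t\<close> by \<open>sqrt \<Lambda>\<close> the integrand differs from \<open>exp (- a s\<^sup>2) (1 - e s\<^sup>3 / sqrt \<Lambda>)\<close> by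
  \<open>O(1 / \<Lambda>)\<close> times a fixed integrable function, and the cubic term integrates to \<open>0\<close>.\<close>

lemma laplace_asymptotics:
  fixes m M b :: real
  assumes m: "m > 0" and M: "M \<ge> 0" and b: "b > 0"
  shows "\<exists>K\<ge>0. laplace_bound m M b K"
proof -
  define W where "W s = (s ^ 2 + s ^ 4 + s ^ 6) * exp (- m * s\<^sup>2)" for s :: real
  have W: "integrable lborel W"
  proof -
    have "integrable lborel (\<lambda>s. s ^ (2 * 1) * exp (- m * s\<^sup>2) + s ^ (2 * 2) * exp (- m * s\<^sup>2)
        + s ^ (2 * 3) * exp (- m * s\<^sup>2))"
      by (intro Bochner_Integration.integrable_add integrable_gaussian_moment m)
    thus ?thesis unfolding W_def by (simp add: distrib_right)
  qed
  have W0: "W s \<ge> 0" for s by (simp add: W_def)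
  define K1 where "K1 = 2 / b\<^sup>2 + M / b + M + M\<^sup>2 * (1 + b)\<^sup>2"
  have K1: "K1 \<ge> 0" using M b by (simp add: K1_def)
  define K where "K = K1 * (\<integral>s. W s \<partial>lborel)"
  have "K \<ge> 0" unfolding K_def using K1 W0 by (intro mult_nonneg_nonneg integral_nonneg) auto
  moreover have "norm (of_real (sqrt \<Lambda>) * (LINT t:J|lborel. \<Phi> t) - of_real (sqrt pi) / csqrt a) \<le> K / \<Lambda>"
    if \<Lambda>: "\<Lambda> > 0" and J: "closed J" "{-b..b} \<subseteq> J" and cont: "continuous_on J \<Phi>"
      and bd: "\<And>t. t \<in> J \<Longrightarrow> norm (\<Phi> t) \<le> exp (- (\<Lambda> * m * t\<^sup>2))"
      and a: "m \<le> Re a" and e: "norm e \<le> M"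
      and \<Phi>: "\<And>t. \<bar>t\<bar> \<le> b \<Longrightarrow> \<Phi> t = exp (- (of_real \<Lambda> * g t))"
      and g: "\<And>t. \<bar>t\<bar> \<le> b \<Longrightarrow> norm (g t - a * of_real t ^ 2 - e * of_real t ^ 3) \<le> M * t ^ 4"
    for \<Lambda> :: real and a e :: complex and g \<Phi> J
  proof -
    define \<Psi> where "\<Psi> t = indicator J t *\<^sub>R \<Phi> t" for t
    define q where "q = sqrt \<Lambda>"
    have q: "q > 0" "q\<^sup>2 = \<Lambda>" using \<Lambda> by (simp_all add: q_def)
    have Re_a: "Re a > 0" using a m by simp
    have \<Psi>m: "\<Psi> \<in> borel_measurable borel"
      unfolding \<Psi>_def using J(1) cont by (intro borel_measurable_continuous_on_indicator) auto
    have \<Psi>b: "norm (\<Psi> t) \<le> exp (- (\<Lambda> * m * t\<^sup>2))" for t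
      using bd[of t] by (auto simp: \<Psi>_def indicator_def)
    have \<Psi>i: "integrable lborel \<Psi>"
      by (rule Bochner_Integration.integrable_bound[OF integrable_gaussian_moment[of "\<Lambda> * m" 0]])
         (use \<Lambda> m \<Psi>m \<Psi>b in auto)
    have scaled: "of_real q * (\<integral>t. \<Psi> t \<partial>lborel) = (\<integral>s. \<Psi> (s / q) \<partial>lborel)"
      using q lborel_integral_real_affine[of "1 / q" \<Psi> 0] by (simp add: scaleR_conv_of_real)
    have \<Psi>si: "integrable lborel (\<lambda>s. \<Psi> (s / q))"
      using lborel_integrable_real_affine[OF \<Psi>i, of "1 / q" 0] q by simp
    define G where "G s = exp (- a * of_real (s\<^sup>2) + 0 * of_real s)
        - e / of_real q * (exp (- a * of_real (s\<^sup>2)) * of_real (s ^ 3))" for s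
    let ?o = "\<lambda>s::real. exp (- a * of_real (s\<^sup>2)) * of_real (s ^ 3) :: complex"
    have oi: "integrable lborel ?o"
    proof (rule Bochner_Integration.integrable_bound[OF W])
      show "?o \<in> borel_measurable lborel"
        unfolding measurable_lborel2 by (intro borel_measurable_continuous_onI continuous_intros)
      show "AE s in lborel. norm (?o s) \<le> norm (W s)"
      proof (rule AE_I2)
        fix s :: real
        have "exp (- Re a * s\<^sup>2) \<le> exp (- m * s\<^sup>2)" using a by (simp add: mult_right_mono)
        moreover have "\<bar>s\<bar> ^ 3 \<le> s ^ 2 + s ^ 4 + s ^ 6"
        proof -
          have "2 * (\<bar>s\<bar> * \<bar>s\<bar>\<^sup>2) \<le> \<bar>s\<bar>\<^sup>2 + (\<bar>s\<bar>\<^sup>2)\<^sup>2"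
            using zero_le_power2[of "\<bar>s\<bar> - \<bar>s\<bar>\<^sup>2"] by (simp add: power2_diff mult_ac power_mult_distrib)
          moreover have "\<bar>s\<bar> ^ 3 \<ge> 0" "s ^ 6 \<ge> 0" "(\<bar>s\<bar>\<^sup>2)\<^sup>2 = s ^ 4" "\<bar>s\<bar> * \<bar>s\<bar>\<^sup>2 = \<bar>s\<bar> ^ 3" "\<bar>s\<bar>\<^sup>2 = s ^ 2"
            by (simp_all add: power_mult[symmetric] power3_eq_cube power2_eq_square[of "\<bar>s\<bar>"] del: power2_abs)
              (simp_all add: eval_nat_numeral)
          ultimately show ?thesis by linarith
        qed
        ultimately have "exp (- Re a * s\<^sup>2) * \<bar>s\<bar> ^ 3 \<le> exp (- m * s\<^sup>2) * (s ^ 2 + s ^ 4 + s ^ 6)"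
          by (intro mult_mono) auto
        thus "norm (?o s) \<le> norm (W s)"
          by (simp add: norm_mult W_def norm_power power_abs mult.commute)
      qed
    qed
    have o0: "(\<integral>s. ?o s \<partial>lborel) = 0"
    proof -
      have "(\<integral>s. ?o s \<partial>lborel) = (\<integral>s. ?o (0 + (-1) * s) \<partial>lborel)"
        using lborel_integral_real_affine[of "-1" ?o 0] by simp
      also have "\<dots> = (\<integral>s. - ?o s \<partial>lborel)"
        by (rule Bochner_Integration.integral_cong) auto
      also have "\<dots> = - (\<integral>s. ?o s \<partial>lborel)" by simp
      finally show ?thesis by (simp add: eq_neg_iff_add_eq_0)
    qed
    have Gi: "integrable lborel G" and GI: "(\<integral>s. G s \<partial>lborel) = of_real (sqrt pi) / csqrt a"
      unfolding G_def using oi o0 integrable_exp_quadratic[OF Re_a, of 0] integral_exp_quadratic[OF Re_a, of 0]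
      by (auto simp: Bochner_Integration.integral_diff)
    have main: "norm (\<Psi> (s / q) - G s) \<le> K1 / \<Lambda> * W s" for s
    proof -
      define t where "t = s / q"
      have ts: "s = q * t" using q by (simp add: t_def)
      have s2: "s\<^sup>2 = \<Lambda> * t\<^sup>2" by (simp add: ts power_mult_distrib q)
      define E where "E = exp (- m * s\<^sup>2)"
      have E: "E \<ge> 0" by (simp add: E_def)
      define y where "y = - a * of_real (s\<^sup>2)"
      have Ey: "norm (exp y) \<le> E"
        using a by (simp add: y_def E_def mult_right_mono)
      have \<Psi>E: "norm (\<Psi> t) \<le> E"
        using \<Psi>b[of t] by (simp add: E_def s2 mult_ac)
      have Gy: "G s = exp y * (1 - e / of_real q * of_real (s ^ 3))"
        by (simp add: G_def y_def algebra_simps)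
      have "norm (\<Psi> t - G s) \<le> E * (K1 / \<Lambda> * (s ^ 2 + s ^ 4 + s ^ 6))"
      proof (cases "\<bar>t\<bar> \<le> b")
        case True
        hence "t \<in> {-b..b}" by (simp add: abs_le_iff minus_le_iff)
        hence tJ: "t \<in> J" using J(2) by blast
        have \<Psi>t: "\<Psi> t = exp (- (of_real \<Lambda> * g t))" using tJ \<Phi>[OF True] by (simp add: \<Psi>_def)
        define r where "r = g t - a * of_real t ^ 2 - e * of_real t ^ 3"
        have r: "norm r \<le> M * t ^ 4" unfolding r_def by (rule g[OF True])
        define x where "x = - (of_real \<Lambda> * g t) - y"
        have ys: "y = - a * of_real \<Lambda> * of_real t ^ 2" by (simp add: y_def s2)
        have xr: "x = - (of_real \<Lambda> * r) - of_real \<Lambda> * (e * of_real t ^ 3)"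
          unfolding x_def r_def ys by (simp add: algebra_simps)
        have cub: "e / of_real q * of_real (s ^ 3) = of_real \<Lambda> * (e * of_real t ^ 3)"
        proof -
          have "s ^ 3 / q = \<Lambda> * t ^ 3"
            using q by (simp add: ts power_mult_distrib power3_eq_cube power2_eq_square flip: q(2))
          hence *: "complex_of_real (s ^ 3) / of_real q = of_real \<Lambda> * of_real t ^ 3"
            by (simp flip: of_real_divide of_real_power of_real_mult)
          have "e / of_real q * of_real (s ^ 3) = e * (of_real (s ^ 3) / of_real q)" by simp
          also have "\<dots> = of_real \<Lambda> * (e * of_real t ^ 3)" unfolding * by (rule mult.left_commute)
          finally show ?thesis .
        qed
        have r': "norm (of_real \<Lambda> * r) \<le> M * s ^ 4 / \<Lambda>"
        proof -
          have "norm (of_real \<Lambda> * r) \<le> \<Lambda> * (M * t ^ 4)"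
            using r \<Lambda> by (simp add: norm_mult)
          also have "s ^ 4 = (s\<^sup>2)\<^sup>2" by (simp add: power_mult[symmetric])
          hence "s ^ 4 = \<Lambda>\<^sup>2 * t ^ 4" by (simp add: s2 power_mult_distrib power_mult[symmetric])
          hence "\<Lambda> * (M * t ^ 4) = M * s ^ 4 / \<Lambda>" using \<Lambda> by (simp add: power2_eq_square)
          finally show ?thesis .
        qed
        have "norm x \<le> norm (of_real \<Lambda> * r) + norm (of_real \<Lambda> * (e * of_real t ^ 3))"
          unfolding xr by (metis norm_minus_cancel norm_triangle_ineq4)
        also have "\<dots> \<le> \<Lambda> * (M * t ^ 4) + \<Lambda> * (M * \<bar>t\<bar> ^ 3)"
          using r e \<Lambda> M by (intro add_mono) (auto simp: norm_mult norm_power intro!: mult_mono)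
        also have "t ^ 4 = \<bar>t\<bar> * \<bar>t\<bar> ^ 3"
          by (simp add: power_Suc[symmetric] power_even_abs_numeral)
        also have "\<Lambda> * (M * (\<bar>t\<bar> * \<bar>t\<bar> ^ 3)) + \<Lambda> * (M * \<bar>t\<bar> ^ 3) = \<Lambda> * M * \<bar>t\<bar> ^ 3 * (1 + \<bar>t\<bar>)"
          by (simp add: algebra_simps)
        also have "\<dots> \<le> \<Lambda> * M * \<bar>t\<bar> ^ 3 * (1 + b)"
          using True M \<Lambda> by (intro mult_left_mono) auto
        finally have "(norm x)\<^sup>2 \<le> (\<Lambda> * M * \<bar>t\<bar> ^ 3 * (1 + b))\<^sup>2"
          by (intro power_mono) auto
        also have "\<dots> = M\<^sup>2 * (1 + b)\<^sup>2 * s ^ 6 / \<Lambda>"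
        proof -
          have "s ^ 6 = (s\<^sup>2) ^ 3" by (simp add: power_mult[symmetric])
          hence "s ^ 6 = \<Lambda> ^ 3 * t ^ 6" by (simp add: s2 power_mult_distrib power_mult[symmetric])
          moreover have "(\<bar>t\<bar> ^ 3)\<^sup>2 = t ^ 6" by (simp add: power_mult[symmetric] power_even_abs_numeral)
          ultimately show ?thesis using \<Lambda>
            by (simp add: power_mult_distrib power2_eq_square power3_eq_cube)
        qed
        finally have x2: "(norm x)\<^sup>2 \<le> M\<^sup>2 * (1 + b)\<^sup>2 * s ^ 6 / \<Lambda>" .
        have "norm (exp y * (exp x - 1 - x)) \<le> norm (exp y) * (max 1 (exp (Re x)) * (norm x)\<^sup>2)"
          unfolding norm_mult by (intro mult_left_mono norm_exp_minus_linear) auto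
        also have "\<dots> = max (norm (exp y)) (norm (exp (y + x))) * (norm x)\<^sup>2"
          by (simp add: max_def exp_add norm_mult)
        also have "\<dots> \<le> E * (M\<^sup>2 * (1 + b)\<^sup>2 * s ^ 6 / \<Lambda>)"
        proof -
          have "y + x = - (of_real \<Lambda> * g t)" by (simp add: x_def)
          hence "norm (exp (y + x)) \<le> E" using \<Psi>E \<Psi>t by simp
          thus ?thesis using Ey x2 E by (intro mult_mono) auto
        qed
        finally have 1: "norm (exp y * (exp x - 1 - x)) \<le> E * (M\<^sup>2 * (1 + b)\<^sup>2 * s ^ 6 / \<Lambda>)" .
        have 2: "norm (exp y * (- (of_real \<Lambda> * r))) \<le> E * (M * s ^ 4 / \<Lambda>)"
          unfolding norm_mult norm_minus_cancel
          using Ey r' E by (intro mult_mono) (auto simp: norm_mult)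
        have "\<Psi> t = exp y * exp x" by (simp add: \<Psi>t x_def flip: exp_add)
        hence "\<Psi> t - G s = exp y * (exp x - 1 - x) + exp y * (- (of_real \<Lambda> * r))"
          unfolding Gy cub by (simp add: xr algebra_simps)
        hence "norm (\<Psi> t - G s) \<le> E * (M\<^sup>2 * (1 + b)\<^sup>2 * s ^ 6 / \<Lambda>) + E * (M * s ^ 4 / \<Lambda>)"
          using norm_triangle_mono[OF 1 2] by simp
        also have "\<dots> = E * ((M\<^sup>2 * (1 + b)\<^sup>2 * s ^ 6 + M * s ^ 4) / \<Lambda>)"
          by (simp add: algebra_simps add_divide_distrib)
        also have "\<dots> \<le> E * (K1 * (s ^ 2 + s ^ 4 + s ^ 6) / \<Lambda>)"
        proof (intro mult_left_mono divide_right_mono)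
          have "M\<^sup>2 * (1 + b)\<^sup>2 * s ^ 6 \<le> K1 * s ^ 6" "M * s ^ 4 \<le> K1 * s ^ 4"
            using M b by (intro mult_right_mono; simp add: K1_def)+
          moreover have "0 \<le> K1 * s ^ 2" using K1 by simp
          ultimately show "M\<^sup>2 * (1 + b)\<^sup>2 * s ^ 6 + M * s ^ 4 \<le> K1 * (s ^ 2 + s ^ 4 + s ^ 6)"
            by (simp add: algebra_simps)
        qed (use E \<Lambda> in auto)
        finally show ?thesis by simp
      next
        case False
        have sb: "1 \<le> \<bar>s\<bar> / (b * q)"
          using False q b by (simp add: ts abs_mult field_simps)
        have one: "1 \<le> s\<^sup>2 / (b\<^sup>2 * \<Lambda>)"
          using power_mono[OF sb, of 2] by (simp add: power_divide power_mult_distrib q)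
        have "norm (\<Psi> t - G s) \<le> E + E * (1 + M / q * \<bar>s\<bar> ^ 3)"
        proof (rule norm_triangle_le_diff[OF add_mono[OF \<Psi>E]])
          have "norm (1 - e / of_real q * of_real (s ^ 3)) \<le> 1 + M / q * \<bar>s\<bar> ^ 3"
            using e q by (intro norm_triangle_le_diff)
              (auto simp: norm_mult norm_divide norm_power power_abs intro!: mult_right_mono divide_right_mono)
          thus "norm (G s) \<le> E * (1 + M / q * \<bar>s\<bar> ^ 3)"
            unfolding Gy norm_mult using Ey E by (intro mult_mono) auto
        qed
        also have "\<dots> = E * (2 + M / q * \<bar>s\<bar> ^ 3)" by (simp add: algebra_simps)
        also have "\<dots> \<le> E * (2 / b\<^sup>2 * s\<^sup>2 / \<Lambda> + M / b * s ^ 4 / \<Lambda>)"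
        proof (intro mult_left_mono add_mono E)
          show "2 \<le> 2 / b\<^sup>2 * s\<^sup>2 / \<Lambda>" using one by simp
          have "M / q * \<bar>s\<bar> ^ 3 * 1 \<le> M / q * \<bar>s\<bar> ^ 3 * (\<bar>s\<bar> / (b * q))"
            using M q by (intro mult_left_mono sb) auto
          also have "\<dots> = M / b * (\<bar>s\<bar> ^ 3 * \<bar>s\<bar>) / q\<^sup>2" by (simp add: power2_eq_square mult_ac)
          also have "\<bar>s\<bar> ^ 3 * \<bar>s\<bar> = s ^ 4" by (simp add: power_Suc2[symmetric] power_even_abs_numeral)
          finally show "M / q * \<bar>s\<bar> ^ 3 \<le> M / b * s ^ 4 / \<Lambda>" by (simp add: q)
        qed
        also have "\<dots> \<le> E * (K1 * (s ^ 2 + s ^ 4 + s ^ 6) / \<Lambda>)"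
        proof (intro mult_left_mono E)
          have "2 / b\<^sup>2 * s\<^sup>2 \<le> K1 * s\<^sup>2" "M / b * s ^ 4 \<le> K1 * s ^ 4"
            using M b by (intro mult_right_mono; simp add: K1_def)+
          moreover have "0 \<le> K1 * s ^ 6" using K1 by simp
          ultimately have "2 / b\<^sup>2 * s\<^sup>2 + M / b * s ^ 4 \<le> K1 * (s ^ 2 + s ^ 4 + s ^ 6)"
            by (simp add: algebra_simps)
          thus "2 / b\<^sup>2 * s\<^sup>2 / \<Lambda> + M / b * s ^ 4 / \<Lambda> \<le> K1 * (s ^ 2 + s ^ 4 + s ^ 6) / \<Lambda>"
            unfolding add_divide_distrib[symmetric] using \<Lambda> by (intro divide_right_mono) auto
        qed
        finally show ?thesis by simp
      qed
      thus ?thesis by (simp add: W_def E_def t_def mult_ac)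
    qed
    have "norm ((\<integral>s. \<Psi> (s / q) \<partial>lborel) - (\<integral>s. G s \<partial>lborel)) = norm (\<integral>s. \<Psi> (s / q) - G s \<partial>lborel)"
      by (simp add: Bochner_Integration.integral_diff[OF \<Psi>si Gi])
    also have "\<dots> \<le> (\<integral>s. K1 / \<Lambda> * W s \<partial>lborel)"
      by (rule Bochner_Integration.integral_norm_bound_integral) (use W \<Psi>si Gi main in auto)
    also have "\<dots> = K / \<Lambda>" by (simp add: K_def)
    finally show ?thesis
      unfolding scaled[symmetric] GI by (simp add: q_def \<Psi>_def[abs_def] set_lebesgue_integral_def)
  qed
  ultimately show ?thesis unfolding laplace_bound_def by (intro exI[of _ K]) blast
qed

section \<open>The partition function as a Gaussian integral\<close>

lemma exp_hamiltonian:
  "exp (- \<beta> * complex_of_real (hamiltonian N \<sigma>)) = exp (\<beta> * of_real ((\<Sum>i=1..N. \<sigma> i)\<^sup>2) / of_nat (2 * N))"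
proof -
  have "hamiltonian N \<sigma> = - ((\<Sum>i=1..N. \<sigma> i)\<^sup>2 / real (2 * N))"
    by (simp add: hamiltonian_def sum_product[symmetric] power2_eq_square)
  hence "complex_of_real (hamiltonian N \<sigma>) = - (of_real ((\<Sum>i=1..N. \<sigma> i)\<^sup>2) / of_nat (2 * N))"
    by (simp only: of_real_minus of_real_divide of_real_of_nat_eq)
  thus ?thesis by (simp only: minus_mult_minus times_divide_eq_right)
qed

lemma cosh_power_spin_sum:
  fixes z :: complex
  shows "cosh z ^ N = (\<Sum>\<sigma>\<in>spin_configs N. exp (z * of_real (\<Sum>i=1..N. \<sigma> i))) / 2 ^ N"
proof -
  have "(2 * cosh z) ^ N = (\<Prod>i\<in>{1..N}. \<Sum>y\<in>{-1, 1}. exp (z * complex_of_real y))"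
  proof -
    have "2 * cosh z = exp z + exp (- z)" by (simp add: cosh_field_def)
    thus ?thesis by (simp add: add.commute)
  qed
  also have "\<dots> = (\<Sum>\<sigma>\<in>spin_configs N. \<Prod>i\<in>{1..N}. exp (z * of_real (\<sigma> i)))"
    unfolding spin_configs_def by (rule prod_sum_PiE) auto
  also have "\<dots> = (\<Sum>\<sigma>\<in>spin_configs N. exp (z * of_real (\<Sum>i=1..N. \<sigma> i)))"
    by (simp only: of_real_sum sum_distrib_left exp_sum finite_atLeastAtMost)
  finally show ?thesis by (simp add: power_mult_distrib field_simps)
qed

text \<open>The Hubbard--Stratonovich transformation. The integration line may have any direction \<open>D\<close>
  along which the Gaussian weight decays.\<close>

lemma partition_fun_integral:
  fixes c D :: complex
  assumes N: "N \<ge> 1" and D: "Re (c * D\<^sup>2) > 0"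
  defines "f \<equiv> \<lambda>s::real. exp (- (of_nat N * c * (D * of_real s)\<^sup>2)) * cosh (D * of_real s) ^ N"
  shows "integrable lborel f"
    and "partition_fun (1 / (2 * c)) N = csqrt (of_nat N * (c * D\<^sup>2)) / of_real (sqrt pi) * (\<integral>s. f s \<partial>lborel)"
proof -
  define a where "a = of_nat N * (c * D\<^sup>2)"
  have a: "Re a > 0" using N D by (simp add: a_def)
  have nz: "c \<noteq> 0" "D \<noteq> 0" "a \<noteq> 0" using D a by auto
  define S where "S \<sigma> = (\<Sum>i=1..N. \<sigma> i)" for \<sigma> :: "nat \<Rightarrow> real"
  let ?g = "\<lambda>\<sigma> s. exp (- a * of_real (s\<^sup>2) + (D * of_real (S \<sigma>)) * of_real s)"
  have f: "f = (\<lambda>s. (\<Sum>\<sigma>\<in>spin_configs N. ?g \<sigma> s) / 2 ^ N)"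
  proof
    fix s :: real
    have "- (of_nat N * c * (D * of_real s)\<^sup>2) = - a * of_real (s\<^sup>2)"
      by (simp add: a_def power_mult_distrib)
    thus "f s = (\<Sum>\<sigma>\<in>spin_configs N. ?g \<sigma> s) / 2 ^ N"
      unfolding f_def cosh_power_spin_sum
      by (simp only: times_divide_eq_right sum_distrib_left S_def exp_add mult_ac)
  qed
  have gi: "integrable lborel (?g \<sigma>)" for \<sigma>
    by (rule integrable_exp_quadratic[OF a])
  show "integrable lborel f"
    unfolding f by (intro integrable_divide Bochner_Integration.integrable_sum gi)
  have "(\<integral>s. f s \<partial>lborel) = (\<Sum>\<sigma>\<in>spin_configs N. \<integral>s. ?g \<sigma> s \<partial>lborel) / 2 ^ N"
    unfolding f integral_divide_zero by (simp only: Bochner_Integration.integral_sum[OF gi])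
  also have "(\<Sum>\<sigma>\<in>spin_configs N. \<integral>s. ?g \<sigma> s \<partial>lborel)
      = (\<Sum>\<sigma>\<in>spin_configs N. exp (- (1 / (2 * c)) * of_real (hamiltonian N \<sigma>)) * (of_real (sqrt pi) / csqrt a))"
  proof (rule sum.cong[OF refl])
    fix \<sigma>
    have "(D * of_real (S \<sigma>))\<^sup>2 / (4 * a) = (1 / (2 * c)) * of_real ((S \<sigma>)\<^sup>2) / of_nat (2 * N)"
      using nz N by (simp add: a_def power_mult_distrib)
    thus "(\<integral>s. ?g \<sigma> s \<partial>lborel) = exp (- (1 / (2 * c)) * of_real (hamiltonian N \<sigma>)) * (of_real (sqrt pi) / csqrt a)"
      unfolding integral_exp_quadratic[OF a] exp_hamiltonian S_def by simp
  qed
  also have "\<dots> / 2 ^ N = partition_fun (1 / (2 * c)) N * (of_real (sqrt pi) / csqrt a)"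
    unfolding sum_distrib_right[symmetric] partition_fun_def by simp
  finally show "partition_fun (1 / (2 * c)) N = csqrt (of_nat N * (c * D\<^sup>2)) / of_real (sqrt pi) * (\<integral>s. f s \<partial>lborel)"
    using nz(3) by (simp add: a_def[symmetric])
qed

section \<open>Principal square roots\<close>
lemma csqrt_of_real_mult:
  assumes "r \<ge> 0"
  shows "csqrt (of_real r * z) = of_real (sqrt r) * csqrt z"
proof (cases "r = 0")
  case False
  have "(of_real (sqrt r) * csqrt z)\<^sup>2 = of_real r * z"
    using assms by (simp add: power_mult_distrib flip: of_real_power)
  moreover have "0 < Re (of_real (sqrt r) * csqrt z) \<or> Re (of_real (sqrt r) * csqrt z) = 0 \<and> 0 \<le> Im (of_real (sqrt r) * csqrt z)"
    using csqrt_principal[of z] assms False by auto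
  ultimately show ?thesis by (rule csqrt_unique)
qed simp

lemma norm_csqrt: "norm (csqrt z) = sqrt (norm z)"
  by (metis norm_power power2_csqrt real_sqrt_abs abs_norm_cancel)

lemma csqrt_divide_Re_pos:
  assumes "Re x > 0" "Re y > 0"
  shows "csqrt (x / y) = csqrt x / csqrt y"
proof (rule csqrt_unique)
  show "(csqrt x / csqrt y)\<^sup>2 = x / y" by (simp add: power_divide)
  have X: "\<bar>Im (csqrt x)\<bar> < Re (csqrt x)" and Y: "\<bar>Im (csqrt y)\<bar> < Re (csqrt y)"
    using assms by (auto intro: csqrt_Re_pos)
  have "\<bar>Im (csqrt x) * Im (csqrt y)\<bar> \<le> \<bar>Im (csqrt x)\<bar> * Re (csqrt y)"
    unfolding abs_mult using Y by (intro mult_left_mono) auto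
  also have "\<dots> < Re (csqrt x) * Re (csqrt y)"
    using X Y by (intro mult_strict_right_mono) auto
  finally have "Re (csqrt x) * Re (csqrt y) + Im (csqrt x) * Im (csqrt y) > 0" by linarith
  moreover have "(Re (csqrt y))\<^sup>2 + (Im (csqrt y))\<^sup>2 > 0"
    using Y by (intro add_pos_nonneg) auto
  ultimately show "0 < Re (csqrt x / csqrt y) \<or> Re (csqrt x / csqrt y) = 0 \<and> 0 \<le> Im (csqrt x / csqrt y)"
    by (simp add: Re_divide)
qed

text \<open>Taking square roots halves the opening of a narrow sector around the positive reals.\<close>

lemma csqrt_sector:
  assumes "Re z > 0" "\<bar>Im z\<bar> \<le> k * Re z"
  shows "0 < Re (csqrt z)" "\<bar>Im (csqrt z)\<bar> \<le> k / 2 * Re (csqrt z)"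
proof -
  define x y where "x = Re (csqrt z)" and "y = Im (csqrt z)"
  have x: "x > 0" using csqrt_Re_pos[OF assms(1)] by (simp add: x_def)
  have "z = (Complex x y)\<^sup>2" by (simp add: x_def y_def)
  hence z: "Re z = x\<^sup>2 - y\<^sup>2" "Im z = 2 * x * y"
    by (metis Re_power2 complex.sel, metis Im_power2 complex.sel)
  have k: "k \<ge> 0" using assms by (smt (verit) abs_ge_zero mult_neg_pos)
  have "2 * x * \<bar>y\<bar> \<le> k * (x\<^sup>2 - y\<^sup>2)" using assms(2) x by (simp add: z abs_mult)
  also have "\<dots> \<le> k * x\<^sup>2" using k by (intro mult_left_mono) auto
  finally have "x * (2 * \<bar>y\<bar>) \<le> x * (k * x)" by (simp add: power2_eq_square mult_ac)
  hence "2 * \<bar>y\<bar> \<le> k * x" using x by simp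
  thus "\<bar>Im (csqrt z)\<bar> \<le> k / 2 * Re (csqrt z)" by (simp add: x_def y_def)
  show "0 < Re (csqrt z)" using x by (simp add: x_def)
qed

lemma csqrt_quotient_sector:
  assumes "Re x > 0" "\<bar>Im x\<bar> \<le> 1/4 * Re x" "Re y > 0" "\<bar>Im y\<bar> \<le> 1/4 * Re y"
  defines "q \<equiv> csqrt x / csqrt y"
  shows "0 < Re q" "3 * \<bar>Im q\<bar> < Re q"
proof -
  define a b c d where "a = Re (csqrt x)" and "b = Im (csqrt x)" and "c = Re (csqrt y)" and "d = Im (csqrt y)"
  have ab: "a > 0" "\<bar>b\<bar> \<le> 1/8 * a" and cd: "c > 0" "\<bar>d\<bar> \<le> 1/8 * c"
    using csqrt_sector[OF assms(1,2)] csqrt_sector[OF assms(3,4)] by (auto simp: a_def b_def c_def d_def)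
  define n where "n = c\<^sup>2 + d\<^sup>2"
  have n: "n > 0" using cd by (simp add: n_def add_pos_nonneg)
  have ac: "a * c > 0" using ab cd by simp
  have 1: "\<bar>b * d\<bar> \<le> 1/64 * (a * c)"
    using mult_mono[OF ab(2) cd(2)] ab cd by (simp add: abs_mult)
  have 2: "\<bar>b * c\<bar> \<le> 1/8 * (a * c)" using ab cd by (simp add: abs_mult)
  have 3: "\<bar>a * d\<bar> \<le> 1/8 * (a * c)" using ab cd by (simp add: abs_mult)
  have Re: "Re q = (a * c + b * d) / n" and Im: "Im q = (b * c - a * d) / n"
    by (simp_all add: q_def Re_divide Im_divide a_def b_def c_def d_def n_def)
  have "a * c + b * d > 3 * \<bar>b * c - a * d\<bar>"
  proof -
    have "3 * \<bar>v - w\<bar> < p + u" if "\<bar>u\<bar> \<le> 1/64 * p" "\<bar>v\<bar> \<le> 1/8 * p" "\<bar>w\<bar> \<le> 1/8 * p" "p > 0" for p u v w :: real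
      using that by (auto simp: abs_if field_simps split: if_splits)
    from this[OF 1 2 3 ac] show ?thesis .
  qed
  thus "3 * \<bar>Im q\<bar> < Re q"
    using n by (simp add: Re Im field_simps)
  thus "0 < Re q" by linarith
qed

section \<open>Bounds for the hyperbolic cosine\<close>

lemma cosh_paired:
  fixes z :: complex
  shows "(\<lambda>k. (z\<^sup>2) ^ k / fact (2 * k)) sums cosh z"
proof -
  have "(\<lambda>n. \<Sum>k = n * 2..<n * 2 + 2. if even k then z ^ k /\<^sub>R fact k else 0) sums cosh z"
    using sums_group[OF cosh_converges[of z], of 2] by simp
  moreover have "(\<Sum>k = n * 2..<n * 2 + 2. if even k then z ^ k /\<^sub>R fact k else 0) = (z\<^sup>2) ^ n / fact (2 * n)" for n
  proof -
    have "{n * 2..<n * 2 + 2} = {2 * n, Suc (2 * n)}" by auto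
    moreover have "z ^ (2 * n) = (z\<^sup>2) ^ n" by (rule power_mult)
    ultimately show ?thesis by (simp add: scaleR_conv_of_real field_simps)
  qed
  ultimately show ?thesis by simp
qed

lemma cosh_of_real: "cosh (complex_of_real x) = of_real (cosh x)"
  by (simp add: cosh_field_def exp_of_real flip: of_real_minus)

lemma cosh_ii_of_real: "cosh (\<i> * complex_of_real x) = of_real (cos x)"
proof -
  have "cosh (\<i> * complex_of_real x) = cos (of_real (- x))"
    by (simp add: cosh_conv_cos mult.assoc[symmetric])
  thus ?thesis by (simp only: cos_of_real cos_minus)
qed

lemma norm_cosh_squared: "(norm (cosh z))\<^sup>2 = (cosh (2 * Re z) + cos (2 * Im z)) / 2"
proof -
  have "complex_of_real ((norm (cosh z))\<^sup>2) = cosh z * cosh (cnj z)"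
    by (simp only: complex_norm_square) (simp add: cosh_field_def exp_cnj)
  also have "\<dots> = (cosh (z + cnj z) + cosh (z - cnj z)) / 2"
    by (simp add: cosh_add cosh_diff)
  also have "z + cnj z = of_real (2 * Re z)" by (simp add: complex_add_cnj)
  also have "z - cnj z = \<i> * of_real (2 * Im z)" by (simp add: complex_diff_cnj)
  also have "cosh (complex_of_real (2 * Re z)) = of_real (cosh (2 * Re z))"
    by (rule cosh_of_real)
  also have "cosh (\<i> * complex_of_real (2 * Im z)) = of_real (cos (2 * Im z))"
    by (rule cosh_ii_of_real)
  finally have "complex_of_real ((norm (cosh z))\<^sup>2) = of_real ((cosh (2 * Re z) + cos (2 * Im z)) / 2)"
    by simp
  thus ?thesis by (simp only: of_real_eq_iff)
qed

text \<open>With \<open>X = x\<^sup>2\<close> and \<open>Y = y\<^sup>2\<close>, both sides are power series in \<open>X\<close> and \<open>Y\<close>, and all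
  coefficients from the quadratic ones on are in the right order when \<open>Y\<close> is small against \<open>X\<close>.
  The surplus of the quadratic term pays for replacing \<open>1\<close> by \<open>\<mu>\<close> in the linear term.\<close>

lemma cosh_cos_le_exp:
  fixes X Y \<mu> :: real
  assumes Y: "0 \<le> Y" "25 * Y \<le> 4 * X" and \<mu>: "99/100 \<le> \<mu>" "\<mu> \<le> 1" "300 * (1 - \<mu>) \<le> X"
  shows "(cosh (2 * sqrt X) + cos (2 * sqrt Y)) / 2 \<le> exp (\<mu> * (X - Y))"
proof -
  have X: "X \<ge> 0" using Y by simp
  define c where "c k = 4 ^ k * (X ^ k + (-1) ^ k * Y ^ k) / fact (2 * k)" for k
  define d where "d k = 2 * (\<mu> * (X - Y)) ^ k / fact k" for k
  have "(\<lambda>k. Re ((complex_of_real (2 * sqrt X))\<^sup>2 ^ k / fact (2 * k)) + Re ((\<i> * complex_of_real (2 * sqrt Y))\<^sup>2 ^ k / fact (2 * k)))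
      sums (Re (cosh (complex_of_real (2 * sqrt X))) + Re (cosh (\<i> * complex_of_real (2 * sqrt Y))))"
    by (intro sums_add sums_Re cosh_paired)
  also have "Re (cosh (complex_of_real (2 * sqrt X))) = cosh (2 * sqrt X)"
    by (simp only: cosh_of_real complex.sel Re_complex_of_real)
  also have "Re (cosh (\<i> * complex_of_real (2 * sqrt Y))) = cos (2 * sqrt Y)"
    by (simp only: cosh_ii_of_real Re_complex_of_real)
  also have "(\<lambda>k. Re ((complex_of_real (2 * sqrt X))\<^sup>2 ^ k / fact (2 * k)) + Re ((\<i> * complex_of_real (2 * sqrt Y))\<^sup>2 ^ k / fact (2 * k))) = c"
  proof
    fix k
    have 1: "(complex_of_real (2 * sqrt X))\<^sup>2 ^ k / fact (2 * k) = of_real ((4 * X) ^ k / fact (2 * k))"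
    proof -
      have "(2 * sqrt X)\<^sup>2 = 4 * X" using X by (simp add: power_mult_distrib)
      hence "(complex_of_real (2 * sqrt X))\<^sup>2 = of_real (4 * X)"
        by (simp only: of_real_power[symmetric])
      thus ?thesis by (simp only: of_real_power of_real_divide of_real_fact)
    qed
    have 2: "(\<i> * complex_of_real (2 * sqrt Y))\<^sup>2 ^ k / fact (2 * k) = of_real ((- (4 * Y)) ^ k / fact (2 * k))"
    proof -
      have "(2 * sqrt Y)\<^sup>2 = 4 * Y" using Y by (simp add: power_mult_distrib)
      hence "(complex_of_real (2 * sqrt Y))\<^sup>2 = of_real (4 * Y)"
        by (simp only: of_real_power[symmetric])
      hence "(\<i> * complex_of_real (2 * sqrt Y))\<^sup>2 = of_real (- (4 * Y))"
        by (simp only: power_mult_distrib power2_i) simp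
      thus ?thesis by (simp only: of_real_power of_real_divide of_real_fact)
    qed
    show "Re ((complex_of_real (2 * sqrt X))\<^sup>2 ^ k / fact (2 * k)) + Re ((\<i> * complex_of_real (2 * sqrt Y))\<^sup>2 ^ k / fact (2 * k)) = c k"
      unfolding 1 2 Re_complex_of_real power_minus[of "4 * Y"]
      by (simp add: c_def power_mult_distrib add_divide_distrib ring_distribs mult_ac)
  qed
  finally have c: "c sums (cosh (2 * sqrt X) + cos (2 * sqrt Y))" .
  have d: "d sums (2 * exp (\<mu> * (X - Y)))"
    unfolding d_def using sums_mult[OF exp_converges[of "\<mu> * (X - Y)"], of 2]
    by (simp add: scaleR_conv_of_real field_simps)
  have low: "sum c {..<3} \<le> sum d {..<3}"
  proof -
    have "c 0 = d 0" by (simp add: c_def d_def)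
    moreover have "c 1 + c 2 \<le> d 1 + d 2"
    proof -
      have XY: "X - Y \<ge> 21/25 * X" using Y by simp
      define X2 Y2 D2 m where "X2 = X\<^sup>2" and "Y2 = Y\<^sup>2" and "D2 = (X - Y)\<^sup>2" and "m = (1 - \<mu>) * (X - Y)"
      have "(21/25 * X)\<^sup>2 \<le> (X - Y)\<^sup>2" using XY X by (intro power_mono) auto
      hence 1: "441/625 * X2 \<le> D2" by (simp add: X2_def D2_def power_mult_distrib power_divide)
      have "Y\<^sup>2 \<le> (4/25 * X)\<^sup>2" using Y by (intro power_mono) auto
      hence 2: "Y2 \<le> 16/625 * X2" by (simp add: X2_def Y2_def power_mult_distrib power_divide)
      have "(99/100)\<^sup>2 \<le> \<mu>\<^sup>2" using \<mu> by (intro power_mono) auto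
      hence "(99/100)\<^sup>2 * D2 \<le> \<mu>\<^sup>2 * D2" by (rule mult_right_mono) (simp add: D2_def)
      hence 3: "9801/10000 * D2 \<le> \<mu>\<^sup>2 * D2" by (simp add: power_divide)
      have "m \<le> X / 300 * X"
        unfolding m_def using \<mu> Y X by (intro mult_mono) auto
      hence 4: "m \<le> X2 / 300" by (simp add: X2_def power2_eq_square)
      have 5: "c 1 = d 1 + 2 * m" by (simp add: c_def d_def m_def field_simps)
      have 6: "c 2 = 2/3 * (X2 + Y2)" "d 2 = \<mu>\<^sup>2 * D2"
        by (simp_all add: c_def d_def fact_numeral power_mult_distrib X2_def Y2_def D2_def)
      have "0 \<le> X2" by (simp add: X2_def)
      moreover from 3 have "9801/10000 * D2 \<le> d 2" unfolding 6 .
      ultimately show ?thesis using 1 2 4 6(1) unfolding 5 by (simp add: field_simps)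
    qed
    ultimately show ?thesis by (simp add: eval_nat_numeral)
  qed
  have high: "c (k + 3) \<le> d (k + 3)" for k
  proof -
    have coef: "2 * 4 ^ (k + 3) / fact (2 * (k + 3)) \<le> 2 * (83/100) ^ (k + 3) / (fact (k + 3) :: real)"
    proof (induction k)
      case 0
      show ?case by (simp add: fact_numeral power_divide)
    next
      case (Suc k)
      define n where "n = k + 3"
      have n: "n \<ge> 3" by (simp add: n_def)
      have IH: "2 * 4 ^ n / fact (2 * n) \<le> 2 * (83/100) ^ n / (fact n :: real)"
        using Suc by (simp add: n_def)
      have "2 * 4 ^ Suc n / (fact (2 * Suc n) :: real)
          = 2 * 4 ^ n / fact (2 * n) * (4 / ((2 * real n + 2) * (2 * real n + 1)))"
        by (simp add: field_simps)
      also have "\<dots> \<le> 2 * (83/100) ^ n / fact n * ((83/100) / (real n + 1))"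
      proof (rule mult_mono[OF IH])
        show "4 / ((2 * real n + 2) * (2 * real n + 1)) \<le> (83/100) / (real n + 1)"
        proof -
          have "234 + 0 \<le> real n * 98 + real n * (real n * 332)"
            by (rule add_mono) (use n in auto)
          thus ?thesis by (simp add: divide_simps) (simp add: algebra_simps)
        qed
      qed auto
      also have "\<dots> = 2 * (83/100) ^ Suc n / fact (Suc n)"
      proof -
        have "2 * x / F * (a / (N + 1)) = 2 * (a * x) / ((N + 1) * F)" for a x F N :: real
          by (simp add: mult_ac)
        thus ?thesis by (simp only: power_Suc fact_Suc of_nat_Suc add.commute[of 1])
      qed
      finally show ?case by (simp add: n_def)
    qed
    define n where "n = k + 3"
    have "c n \<le> 4 ^ n * (X ^ n + X ^ n) / fact (2 * n)"
    proof -
      have "(-1) ^ n * Y ^ n \<le> X ^ n"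
      proof -
        have "(-1) ^ n * Y ^ n \<le> \<bar>(-1) ^ n * Y ^ n\<bar>" by simp
        also have "\<dots> = Y ^ n" using Y by (simp add: abs_mult power_abs)
        also have "\<dots> \<le> X ^ n" using Y by (intro power_mono) auto
        finally show ?thesis .
      qed
      thus ?thesis unfolding c_def by (intro divide_right_mono mult_left_mono add_left_mono) auto
    qed
    also have "\<dots> = 2 * 4 ^ n / fact (2 * n) * X ^ n" by simp
    also have "\<dots> \<le> 2 * (83/100) ^ n / fact n * X ^ n"
      using coef X by (intro mult_right_mono) (auto simp: n_def)
    also have "\<dots> = 2 * (83/100 * X) ^ n / fact n"
      unfolding power_mult_distrib[of "83/100" X] by simp
    also have "\<dots> \<le> d n"
    proof -
      have "83/100 * X \<le> 99/100 * (21/25 * X)" using X by simp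
      also have "\<dots> \<le> \<mu> * (X - Y)" using \<mu> Y X by (intro mult_mono) auto
      finally show ?thesis unfolding d_def
        using X by (intro divide_right_mono mult_left_mono power_mono) auto
    qed
    finally show ?thesis by (simp add: n_def)
  qed
  have "(\<Sum>k. c (k + 3)) \<le> (\<Sum>k. d (k + 3))"
    by (intro suminf_le high) (use c d in \<open>auto simp: sums_iff summable_iff_shift\<close>)
  moreover have "suminf c = (\<Sum>k. c (k + 3)) + sum c {..<3}" "suminf d = (\<Sum>k. d (k + 3)) + sum d {..<3}"
    by (rule suminf_split_initial_segment[OF sums_summable[OF c]], rule suminf_split_initial_segment[OF sums_summable[OF d]])
  ultimately have "suminf c \<le> suminf d" using low by linarith
  thus ?thesis using c d by (simp add: sums_iff)
qed

lemma norm_cosh_le: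
  assumes "25 * (Im z)\<^sup>2 \<le> 4 * (Re z)\<^sup>2" "99/100 \<le> \<mu>" "\<mu> \<le> 1" "300 * (1 - \<mu>) \<le> (Re z)\<^sup>2"
  shows "norm (cosh z) \<le> exp (\<mu> * Re (z\<^sup>2) / 2)"
proof -
  have abs: "cosh (2 * \<bar>x\<bar>) = cosh (2 * x)" "cos (2 * \<bar>x\<bar>) = cos (2 * x)" for x :: real
    by (auto simp: abs_if)
  have "(norm (cosh z))\<^sup>2 \<le> exp (\<mu> * Re (z\<^sup>2))"
    using cosh_cos_le_exp[of "(Im z)\<^sup>2" "(Re z)\<^sup>2" \<mu>] assms
    by (simp add: norm_cosh_squared Re_power2 abs)
  also have "\<dots> = (exp (\<mu> * Re (z\<^sup>2) / 2))\<^sup>2"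
    by (simp add: exp_double[symmetric])
  finally show ?thesis by (rule power2_le_imp_le) simp
qed

section \<open>The function log cosh near the origin\<close>

text \<open>The entire function \<open>p \<mapsto> cosh (sqrt p)\<close>, given by its power series.\<close>

definition cosh_sqrt :: "complex \<Rightarrow> complex" where
  "cosh_sqrt p = (\<Sum>k. 1 / fact (2 * k) * p ^ k)"

text \<open>The branch of \<open>log (cosh (sqrt p))\<close> near \<open>p = 0\<close> that vanishes at \<open>0\<close>.\<close>

definition log_cosh_sqrt :: "complex \<Rightarrow> complex" where
  "log_cosh_sqrt p = Ln (cosh_sqrt p)"

lemma cosh_sqrt_power2: "cosh_sqrt (z\<^sup>2) = cosh z"
  using cosh_paired[of z] by (simp add: cosh_sqrt_def sums_iff)

lemma cosh_sqrt_0 [simp]: "cosh_sqrt 0 = 1"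
  using cosh_sqrt_power2[of 0] by simp

lemma cosh_sqrt_derivatives:
  obtains C1 C2 where
    "\<And>p. (cosh_sqrt has_field_derivative C1 p) (at p)" "\<And>p. (C1 has_field_derivative C2 p) (at p)"
    "C1 0 = 1 / 2" "C2 0 = 1 / 12"
proof -
  define c where "c k = 1 / (fact (2 * k) :: complex)" for k
  have sum0: "summable (\<lambda>k. c k * p ^ k)" for p
    using sums_summable[OF cosh_paired[of "csqrt p"]] by (simp add: c_def)
  have sum1: "summable (\<lambda>k. diffs c k * p ^ k)" for p
    by (rule termdiff_converges_all) (rule sum0)
  show ?thesis
  proof (rule that[of "\<lambda>p. \<Sum>k. diffs c k * p ^ k" "\<lambda>p. \<Sum>k. diffs (diffs c) k * p ^ k"])
    fix p
    show "(cosh_sqrt has_field_derivative (\<Sum>k. diffs c k * p ^ k)) (at p)"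
      unfolding cosh_sqrt_def[abs_def] c_def[symmetric]
      by (rule termdiffs_strong_converges_everywhere) (rule sum0)
    show "((\<lambda>p. \<Sum>k. diffs c k * p ^ k) has_field_derivative (\<Sum>k. diffs (diffs c) k * p ^ k)) (at p)"
      by (rule termdiffs_strong_converges_everywhere) (rule sum1)
  next
    show "(\<Sum>k. diffs c k * 0 ^ k) = 1 / 2" "(\<Sum>k. diffs (diffs c) k * 0 ^ k) = 1 / 12"
      unfolding powser_zero by (simp_all add: diffs_def c_def eval_nat_numeral)
  qed
qed

lemma log_cosh_sqrt_expansion:
  fixes \<eta> :: real
  assumes "\<eta> > 0"
  obtains \<rho> M where "0 < \<rho>" "\<rho> \<le> 1" "0 \<le> M" "log_cosh_sqrt holomorphic_on ball 0 \<rho>"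
    "\<And>p. p \<in> ball 0 \<rho> \<Longrightarrow> exp (log_cosh_sqrt p) = cosh_sqrt p"
    "log_cosh_sqrt 0 = 0" "deriv log_cosh_sqrt 0 = 1 / 2"
    "\<And>p. p \<in> ball 0 \<rho> \<Longrightarrow> norm ((deriv ^^ 2) log_cosh_sqrt p + 1 / 6) \<le> \<eta>"
    "\<And>p. p \<in> ball 0 \<rho> \<Longrightarrow> norm ((deriv ^^ 3) log_cosh_sqrt p) \<le> M"
    "\<And>p. p \<in> ball 0 \<rho> \<Longrightarrow> norm ((deriv ^^ 4) log_cosh_sqrt p) \<le> M"
proof -
  obtain C1 C2 where C: "\<And>p. (cosh_sqrt has_field_derivative C1 p) (at p)"
      "\<And>p. (C1 has_field_derivative C2 p) (at p)" "C1 0 = 1 / 2" "C2 0 = 1 / 12"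
    using cosh_sqrt_derivatives by blast
  have "isCont cosh_sqrt 0" using C(1) by (rule DERIV_isCont)
  then obtain r where r: "r > 0" "\<And>p. dist p 0 < r \<Longrightarrow> dist (cosh_sqrt p) 1 < 1"
    unfolding continuous_at_eps_delta by (metis cosh_sqrt_0 zero_less_one)
  have pos: "Re (cosh_sqrt p) > 0" if "p \<in> ball 0 r" for p
  proof -
    have "\<bar>Re (cosh_sqrt p - 1)\<bar> < 1"
      using r(2)[of p] that abs_Re_le_cmod[of "cosh_sqrt p - 1"] by (simp add: dist_norm)
    thus ?thesis by simp
  qed
  have d1: "(log_cosh_sqrt has_field_derivative C1 p / cosh_sqrt p) (at p)" if "p \<in> ball 0 r" for p
  proof -
    have "cosh_sqrt p \<notin> \<real>\<^sub>\<le>\<^sub>0" using pos[OF that] by (auto simp: complex_nonpos_Reals_iff)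
    from DERIV_chain2[OF has_field_derivative_Ln[OF this] C(1)] show ?thesis
      by (simp add: log_cosh_sqrt_def[abs_def] divide_inverse mult.commute)
  qed
  have hol: "log_cosh_sqrt holomorphic_on ball 0 r"
    unfolding holomorphic_on_open[OF open_ball] using d1 by blast
  have hol_n: "(deriv ^^ n) log_cosh_sqrt holomorphic_on ball 0 r" for n
    by (rule holomorphic_higher_deriv[OF hol]) auto
  have deriv1: "deriv log_cosh_sqrt p = C1 p / cosh_sqrt p" if "p \<in> ball 0 r" for p
    using d1[OF that] by (rule DERIV_imp_deriv)
  have "((\<lambda>p. C1 p / cosh_sqrt p) has_field_derivative - 1 / 6) (at 0)"
    by (rule derivative_eq_intros C refl | simp add: C(3,4))+
  hence "(deriv log_cosh_sqrt has_field_derivative - 1 / 6) (at 0)"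
    by (rule has_field_derivative_transform_within_open[where S = "ball 0 r"]) (use r deriv1 in auto)
  hence d2: "(deriv ^^ 2) log_cosh_sqrt 0 = - 1 / 6"
    by (simp add: numeral_2_eq_2 DERIV_imp_deriv)
  have "isCont ((deriv ^^ 2) log_cosh_sqrt) 0"
    using hol_n[of 2] r(1) by (meson centre_in_ball continuous_on_interior holomorphic_on_imp_continuous_on interior_open open_ball continuous_on_eq_continuous_at)
  then obtain s where s: "s > 0" "\<And>p. dist p 0 < s \<Longrightarrow> dist ((deriv ^^ 2) log_cosh_sqrt p) (- 1 / 6) < \<eta>"
    unfolding continuous_at_eps_delta d2 using assms by metis
  define \<rho> where "\<rho> = Min {r / 2, s, 1}"
  have \<rho>: "0 < \<rho>" "\<rho> \<le> 1" "\<rho> \<le> s" "\<rho> \<le> r / 2" using r(1) s(1) by (auto simp: \<rho>_def)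
  have sub: "ball 0 \<rho> \<subseteq> cball 0 (r / 2)" "cball 0 (r / 2) \<subseteq> ball 0 r"
    using \<rho> r(1) by (auto simp: subset_eq)
  have "\<exists>B. \<forall>p\<in>ball 0 \<rho>. norm ((deriv ^^ n) log_cosh_sqrt p) \<le> B" for n
  proof -
    have "continuous_on (cball 0 (r / 2)) ((deriv ^^ n) log_cosh_sqrt)"
      using hol_n[of n] sub(2) holomorphic_on_imp_continuous_on continuous_on_subset by blast
    hence "bounded ((deriv ^^ n) log_cosh_sqrt ` cball 0 (r / 2))"
      by (intro compact_imp_bounded compact_continuous_image) auto
    thus ?thesis using sub(1) unfolding bounded_iff by blast
  qed
  then obtain B where B: "\<And>n p. p \<in> ball 0 \<rho> \<Longrightarrow> norm ((deriv ^^ n) log_cosh_sqrt p) \<le> B n"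
    by metis
  define M where "M = Max {0, B 3, B 4}"
  have "0 \<le> M" "B 3 \<le> M" "B 4 \<le> M" by (auto simp: M_def)
  moreover have "0 \<in> ball 0 r" using r(1) by simp
  ultimately show ?thesis
  proof (intro that[of \<rho> M])
    fix p :: complex assume p: "p \<in> ball 0 \<rho>"
    hence pr: "p \<in> ball 0 r" using sub by blast
    show "exp (log_cosh_sqrt p) = cosh_sqrt p"
      unfolding log_cosh_sqrt_def using pos[OF pr] by (intro exp_Ln) auto
    show "norm ((deriv ^^ 2) log_cosh_sqrt p + 1 / 6) \<le> \<eta>"
      using s(2)[of p] p \<rho> by (simp add: dist_norm)
    show "norm ((deriv ^^ 3) log_cosh_sqrt p) \<le> M" "norm ((deriv ^^ 4) log_cosh_sqrt p) \<le> M"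
      using B[OF p] \<open>B 3 \<le> M\<close> \<open>B 4 \<le> M\<close> order.trans by blast+
  next
    show "log_cosh_sqrt holomorphic_on ball 0 \<rho>"
      using hol sub holomorphic_on_subset by blast
    show "log_cosh_sqrt 0 = 0" by (simp add: log_cosh_sqrt_def)
    show "deriv log_cosh_sqrt 0 = 1 / 2" using deriv1[of 0] r(1) C(3) by simp
  qed (use \<rho> in auto)
qed

text \<open>A disc on which \<open>log_cosh_sqrt\<close> is close, in the \<open>C\<^sup>2\<close> sense, to its second order Taylor
  polynomial \<open>p / 2 - p\<^sup>2 / 12\<close>. The constant \<open>1 / 1000\<close> is small enough for all sign conditions on
  the phase below.\<close>

locale log_cosh_disc =
  fixes \<rho> M :: real
  assumes \<rho>: "0 < \<rho>" "\<rho> \<le> 1" and M: "0 \<le> M"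
    and hol: "log_cosh_sqrt holomorphic_on ball 0 \<rho>"
    and exp_log_cosh_sqrt: "\<And>p. p \<in> ball 0 \<rho> \<Longrightarrow> exp (log_cosh_sqrt p) = cosh_sqrt p"
    and at_0: "log_cosh_sqrt 0 = 0" "deriv log_cosh_sqrt 0 = 1 / 2"
    and d2: "\<And>p. p \<in> ball 0 \<rho> \<Longrightarrow> norm ((deriv ^^ 2) log_cosh_sqrt p + 1 / 6) \<le> 1 / 1000"
    and d3: "\<And>p. p \<in> ball 0 \<rho> \<Longrightarrow> norm ((deriv ^^ 3) log_cosh_sqrt p) \<le> M"
    and d4: "\<And>p. p \<in> ball 0 \<rho> \<Longrightarrow> norm ((deriv ^^ 4) log_cosh_sqrt p) \<le> M"
begin

abbreviation "L \<equiv> log_cosh_sqrt"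
abbreviation "L1 \<equiv> deriv log_cosh_sqrt"
abbreviation "L2 \<equiv> (deriv ^^ 2) log_cosh_sqrt"
abbreviation "L3 \<equiv> (deriv ^^ 3) log_cosh_sqrt"

lemma zero_in_disc [simp]: "0 \<in> ball 0 \<rho>" using \<rho> by simp

lemma higher_deriv:
  assumes "p \<in> ball 0 \<rho>"
  shows "((deriv ^^ n) L has_field_derivative (deriv ^^ Suc n) L p) (at p)"
  using holomorphic_derivI[OF holomorphic_higher_deriv[OF hol open_ball, of n] open_ball assms] by simp

lemma L1_approx:
  assumes P: "P \<in> ball 0 \<rho>"
  shows "norm (L1 P - 1 / 2 + P / 6) \<le> norm P / 1000"
proof -
  have "norm ((L1 P + P / 6) - (L1 0 + 0 / 6)) \<le> 1 / 1000 * norm (P - 0)"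
  proof (rule field_differentiable_bound[of "ball 0 \<rho>"])
    fix z :: complex assume z: "z \<in> ball 0 \<rho>"
    have "(L1 has_field_derivative L2 z) (at z)"
      using higher_deriv[OF z, of 1] by (simp add: numeral_2_eq_2)
    hence "((\<lambda>z. L1 z + z / 6) has_field_derivative L2 z + 1 / 6) (at z)"
      by (auto intro!: derivative_eq_intros)
    thus "((\<lambda>z. L1 z + z / 6) has_field_derivative L2 z + 1 / 6) (at z within ball 0 \<rho>)"
      by (rule has_field_derivative_at_within)
  qed (use P d2 \<rho> in auto)
  thus ?thesis by (simp add: at_0 algebra_simps)
qed

lemma L_approx:
  assumes p: "p \<in> ball 0 \<rho>" and P: "P \<in> ball 0 \<rho>"
  shows "norm (L p - L P - L1 P * (p - P) + (p - P)\<^sup>2 / 12) \<le> (norm (p - P))\<^sup>2 / 1000"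
proof -
  define f where "f i z = (deriv ^^ i) L z + (if i = 0 then z\<^sup>2 / 12 else if i = 1 then z / 6 else 1 / 6)" for i :: nat and z
  have "norm (f 0 p - (\<Sum>i\<le>1. f i P * (p - P) ^ i / fact i)) \<le> 1 / 1000 * norm (p - P) ^ Suc 1 / fact 1"
  proof (rule complex_Taylor[of "ball 0 \<rho>"])
    fix i :: nat and z :: complex assume z: "z \<in> ball 0 \<rho>" and "i \<le> 1"
    hence "i = 0 \<or> i = 1" by auto
    hence "(f i has_field_derivative f (Suc i) z) (at z)"
      unfolding f_def using higher_deriv[OF z, of i]
      by (auto intro!: derivative_eq_intros)
    thus "(f i has_field_derivative f (Suc i) z) (at z within ball 0 \<rho>)"
      by (rule has_field_derivative_at_within)
  qed (use p P d2 in \<open>auto simp: f_def numeral_2_eq_2\<close>)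
  also have "f 0 p - (\<Sum>i\<le>1. f i P * (p - P) ^ i / fact i) = L p - L P - L1 P * (p - P) + (p - P)\<^sup>2 / 12"
    by (simp add: f_def) (simp add: field_simps power2_eq_square)
  finally show ?thesis by (simp add: power2_eq_square)
qed

lemma L_approx_0: "p \<in> ball 0 \<rho> \<Longrightarrow> norm (L p - p / 2 + p\<^sup>2 / 12) \<le> (norm p)\<^sup>2 / 1000"
  using L_approx[OF _ zero_in_disc, of p] by (simp add: at_0)

lemma L_cubic_Taylor:
  assumes p: "p \<in> ball 0 \<rho>" and P: "P \<in> ball 0 \<rho>"
  shows "norm (L p - L P - L1 P * (p - P) - L2 P * (p - P)\<^sup>2 / 2 - L3 P * (p - P) ^ 3 / 6)
    \<le> M * norm (p - P) ^ 4"
proof -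
  have "norm ((deriv ^^ 0) L p - (\<Sum>i\<le>3. (deriv ^^ i) L P * (p - P) ^ i / fact i)) \<le> M * norm (p - P) ^ Suc 3 / fact 3"
  proof (rule complex_Taylor[of "ball 0 \<rho>" 3 "\<lambda>i. (deriv ^^ i) L"])
    fix i :: nat and z :: complex assume z: "z \<in> ball 0 \<rho>"
    show "((deriv ^^ i) L has_field_derivative (deriv ^^ Suc i) L z) (at z within ball 0 \<rho>)"
      using higher_deriv[OF z] by (rule has_field_derivative_at_within)
  qed (use p P d4 in \<open>auto simp: eval_nat_numeral\<close>)
  also have "(\<Sum>i\<le>3. (deriv ^^ i) L P * (p - P) ^ i / fact i)
      = L P + L1 P * (p - P) + L2 P * (p - P)\<^sup>2 / 2 + L3 P * (p - P) ^ 3 / 6"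
    by (simp add: eval_nat_numeral)
  also have "M * norm (p - P) ^ Suc 3 / fact 3 \<le> M * norm (p - P) ^ 4"
    using mult_nonneg_nonneg[OF M, of "norm (p - P) ^ 4"] by (simp add: fact_numeral)
  finally show ?thesis by (simp add: diff_diff_eq)
qed

lemma cosh_eq_exp: "z\<^sup>2 \<in> ball 0 \<rho> \<Longrightarrow> cosh z = exp (L (z\<^sup>2))"
  by (simp add: exp_log_cosh_sqrt cosh_sqrt_power2)

text \<open>The critical points of the phase solve \<open>tanh z = z / \<beta>\<close>; this lemma turns that equation into
  \<open>2 \<beta> L1 (z\<^sup>2) = 1\<close>. Its derivative, the lemma after it, gives the second derivative at a saddle.\<close>

lemma tanh_eq:
  assumes z: "z\<^sup>2 \<in> ball 0 \<rho>"
  shows "tanh z = 2 * z * L1 (z\<^sup>2)"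
proof -
  have op: "open ((\<lambda>z::complex. z\<^sup>2) -` ball 0 \<rho>)"
    by (intro open_vimage continuous_intros) auto
  have "((\<lambda>z. exp (L (z\<^sup>2))) has_field_derivative exp (L (z\<^sup>2)) * (L1 (z\<^sup>2) * (2 * z))) (at z)"
    using higher_deriv[OF z, of 0]
    by (auto intro!: derivative_eq_intros DERIV_chain2[of L])
  hence "(cosh has_field_derivative exp (L (z\<^sup>2)) * (L1 (z\<^sup>2) * (2 * z))) (at z)"
    by (rule has_field_derivative_transform_within_open[OF _ op]) (use z in \<open>auto simp: cosh_eq_exp\<close>)
  hence "exp (L (z\<^sup>2)) * (L1 (z\<^sup>2) * (2 * z)) = sinh z"
    using complex_DERIV_cosh[of z] by (rule DERIV_unique)
  thus ?thesis by (simp add: tanh_def cosh_eq_exp[OF z] flip: \<open>_ = sinh z\<close>)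
qed

lemma tanh_square_eq:
  assumes z: "z\<^sup>2 \<in> ball 0 \<rho>"
  shows "1 - (tanh z)\<^sup>2 = 2 * L1 (z\<^sup>2) + 4 * z\<^sup>2 * L2 (z\<^sup>2)"
proof -
  have op: "open ((\<lambda>z::complex. z\<^sup>2) -` ball 0 \<rho>)"
    by (intro open_vimage continuous_intros) auto
  have "(L1 has_field_derivative L2 (z\<^sup>2)) (at (z\<^sup>2))"
    using higher_deriv[OF z, of 1] by (simp add: numeral_2_eq_2)
  hence "((\<lambda>z. 2 * z * L1 (z\<^sup>2)) has_field_derivative 2 * L1 (z\<^sup>2) + 2 * z * (L2 (z\<^sup>2) * (2 * z))) (at z)"
    by (auto intro!: derivative_eq_intros DERIV_chain2[of L1])
  hence "(tanh has_field_derivative 2 * L1 (z\<^sup>2) + 2 * z * (L2 (z\<^sup>2) * (2 * z))) (at z)"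
    by (rule has_field_derivative_transform_within_open[OF _ op]) (use z in \<open>auto simp: tanh_eq\<close>)
  moreover have "(tanh has_field_derivative 1 - (tanh z)\<^sup>2) (at z)"
    using cosh_eq_exp[OF z] by (auto intro!: derivative_eq_intros)
  ultimately have "2 * L1 (z\<^sup>2) + 2 * z * (L2 (z\<^sup>2) * (2 * z)) = 1 - (tanh z)\<^sup>2"
    by (rule DERIV_unique)
  thus ?thesis by (simp add: power2_eq_square algebra_simps)
qed

end

section \<open>The phase and the integrand\<close>

lemma Re_ge_of_norm: "norm (x - y) \<le> e \<Longrightarrow> Re x \<ge> Re y - e"
  using abs_Re_le_cmod[of "x - y"] by simp

lemma power2_outside_sector:
  assumes "25 * (Im u)\<^sup>2 > 4 * (Re u)\<^sup>2" "0 < Re (u\<^sup>2)"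
  shows "9 * Re (u\<^sup>2) < 10 * \<bar>Im (u\<^sup>2)\<bar>"
proof -
  define a b where "a = \<bar>Re u\<bar>" and "b = \<bar>Im u\<bar>"
  have nn: "a \<ge> 0" "b \<ge> 0" by (simp_all add: a_def b_def)
  have sq: "a\<^sup>2 = (Re u)\<^sup>2" "b\<^sup>2 = (Im u)\<^sup>2" by (simp_all add: a_def b_def)
  have "(2 * a)\<^sup>2 < (5 * b)\<^sup>2" using assms(1) by (simp add: power_mult_distrib sq)
  hence ab: "2 * a < 5 * b" by (rule power2_less_imp_less) (use nn in simp)
  have "b\<^sup>2 < a\<^sup>2" using assms(2) by (simp add: sq Re_power2)
  hence "b < a" by (rule power2_less_imp_less) (use nn in simp)
  hence a: "a > 0" using nn by simp
  have 1: "4 * a\<^sup>2 < 25 * b\<^sup>2" using assms(1) by (simp add: sq)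
  have 2: "2 * (a * a) < 5 * (a * b)" using mult_strict_left_mono[OF ab a] by simp
  have 3: "\<bar>Im (u\<^sup>2)\<bar> = 2 * (a * b)" by (simp add: Im_power2 a_def b_def abs_mult)
  have 4: "Re (u\<^sup>2) = a\<^sup>2 - b\<^sup>2" by (simp add: Re_power2 sq)
  have "9 * (A - B) < 10 * (2 * C)" if "4 * A < 25 * B" "2 * A < 5 * C" "0 \<le> B" for A B C :: real
    using that by (simp add: field_simps)
  from this[of "a\<^sup>2" "b\<^sup>2" "a * b"] show ?thesis
    unfolding 3 4 using 1 2 by (simp only: power2_eq_square zero_le_square)
qed

context log_cosh_disc
begin

text \<open>The phase as a function of \<open>p = z\<^sup>2\<close>. The parameter \<open>\<beta>\<close> enters through the square \<open>P\<close> of the outer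
  critical points, \<open>\<beta> = 1 / (2 L1 P)\<close>.\<close>

definition H :: "complex \<Rightarrow> complex \<Rightarrow> complex" where
  "H P p = L1 P * p - L p"

text \<open>The integrand \<open>exp (- N h z)\<close>, written without logarithm so that it is entire in \<open>z\<close>.\<close>

definition weight :: "complex \<Rightarrow> nat \<Rightarrow> complex \<Rightarrow> complex" where
  "weight P N z = exp (- (of_nat N * L1 P * z\<^sup>2)) * cosh z ^ N"

lemma H_approx:
  assumes "p \<in> ball 0 \<rho>" "P \<in> ball 0 \<rho>"
  shows "norm (H P p - (p\<^sup>2 / 12 - P * p / 6)) \<le> (norm P * norm p + (norm p)\<^sup>2) / 1000"
proof -
  have "H P p - (p\<^sup>2 / 12 - P * p / 6) = (L1 P - 1 / 2 + P / 6) * p - (L p - p / 2 + p\<^sup>2 / 12)"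
    by (simp add: H_def algebra_simps)
  also have "norm \<dots> \<le> norm P / 1000 * norm p + (norm p)\<^sup>2 / 1000"
    by (intro norm_triangle_le_diff add_mono L_approx_0 assms)
       (simp add: norm_mult mult_right_mono[OF L1_approx[OF assms(2)], simplified])
  finally show ?thesis by (simp add: add_divide_distrib)
qed

lemma H_diff_approx:
  assumes "p \<in> ball 0 \<rho>" "P \<in> ball 0 \<rho>"
  shows "norm (H P p - H P P - (p - P)\<^sup>2 / 12) \<le> (norm (p - P))\<^sup>2 / 1000"
proof -
  have "H P p - H P P - (p - P)\<^sup>2 / 12 = - (L p - L P - L1 P * (p - P) + (p - P)\<^sup>2 / 12)"
    by (simp add: H_def algebra_simps)
  thus ?thesis using L_approx[OF assms] by (simp only: norm_minus_cancel)
qed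

lemma H_0 [simp]: "H P 0 = 0" by (simp add: H_def at_0)

lemma Re_H_saddle: "P \<in> ball 0 \<rho> \<Longrightarrow> Re (H P P) \<le> - Re (P\<^sup>2) / 12 + (norm P)\<^sup>2 / 1000"
  "P \<in> ball 0 \<rho> \<Longrightarrow> Re (H P P) \<ge> - Re (P\<^sup>2) / 12 - (norm P)\<^sup>2 / 1000"
  using abs_Re_le_cmod[of "H P 0 - H P P - (0 - P)\<^sup>2 / 12"] H_diff_approx[OF zero_in_disc, of P] by auto

lemma weight_eq_exp:
  assumes "z\<^sup>2 \<in> ball 0 \<rho>"
  shows "weight P N z = exp (- (of_nat N * H P (z\<^sup>2)))"
  unfolding weight_def cosh_eq_exp[OF assms] H_def
  by (simp add: exp_of_nat_mult[symmetric] exp_add[symmetric] algebra_simps)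

lemma weight_eq_power: "weight P N z = (exp (- (L1 P * z\<^sup>2)) * cosh z) ^ N"
  by (simp add: weight_def power_mult_distrib exp_of_nat_mult[symmetric] mult.assoc)

lemma L1_near_half:
  assumes "P \<in> ball 0 \<rho>"
  shows "norm (L1 P - 1 / 2) \<le> norm P / 5" "norm P * (4 / 25) \<le> norm (L1 P - 1 / 2)"
proof -
  have "L1 P - 1 / 2 = (L1 P - 1 / 2 + P / 6) - P / 6" by simp
  hence "norm (L1 P - 1 / 2) \<le> norm P / 1000 + norm P / 6"
    using norm_triangle_le_diff[OF add_mono[OF L1_approx[OF assms], of "norm (P / 6)" "norm P / 6"]]
    by simp
  thus "norm (L1 P - 1 / 2) \<le> norm P / 5" using norm_ge_zero[of P] by linarith
  have "norm (P / 6) \<le> norm (L1 P - 1 / 2 + P / 6) + norm (L1 P - 1 / 2)"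
    by (metis add_diff_cancel_left' norm_triangle_ineq4)
  thus "norm P * (4 / 25) \<le> norm (L1 P - 1 / 2)"
    using L1_approx[OF assms] norm_ge_zero[of P] norm_divide[of P 6]
    unfolding norm_numeral by argo
qed

text \<open>Away from the origin, \<open>norm_cosh_le\<close> holds with a fixed factor \<open>\<mu> < 1\<close>, which outweighs the
  deviation of \<open>L1 P\<close> from \<open>1 / 2\<close> when \<open>P\<close> is small.\<close>

lemma norm_weight_far:
  assumes P: "norm P \<le> \<rho> / 10000" and z: "25 * (Im z)\<^sup>2 \<le> 4 * (Re z)\<^sup>2" "\<rho> \<le> norm (z\<^sup>2)"
  shows "norm (weight P N z) \<le> exp (- (real N * (\<rho> / 1600 * norm (z\<^sup>2))))"
proof -
  have PB: "P \<in> ball 0 \<rho>" using P \<rho> by simp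
  define X Y where "X = (Re z)\<^sup>2" and "Y = (Im z)\<^sup>2"
  define n where "n = norm (z\<^sup>2)"
  have n: "n = X + Y" by (simp add: n_def norm_power cmod_power2 X_def Y_def)
  have Re: "Re (z\<^sup>2) = X - Y" by (simp add: Re_power2 X_def Y_def)
  have XY: "25 * Y \<le> 4 * X" "0 \<le> Y" "\<rho> \<le> X + Y" using z by (simp_all add: X_def Y_def n[unfolded n_def])
  define \<kappa> where "\<kappa> = \<rho> / 400"
  have "norm (cosh z) \<le> exp ((1 - \<kappa>) * Re (z\<^sup>2) / 2)"
    using XY \<rho> by (intro norm_cosh_le z) (auto simp: \<kappa>_def X_def[symmetric])
  hence "norm (exp (- (L1 P * z\<^sup>2)) * cosh z) \<le> exp (- Re (L1 P * z\<^sup>2)) * exp ((1 - \<kappa>) * Re (z\<^sup>2) / 2)"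
    unfolding norm_mult by (intro mult_mono) auto
  also have "\<dots> \<le> exp (- (\<rho> / 1600 * n))"
  proof -
    have "norm (L1 P * z\<^sup>2 - z\<^sup>2 / 2) \<le> norm P / 5 * n"
      using mult_right_mono[OF L1_near_half(1)[OF PB], of n]
      by (simp add: n_def algebra_simps flip: norm_mult)
    also have "\<dots> \<le> \<rho> / 50000 * n" using P by (intro mult_right_mono) (auto simp: n_def)
    finally have "Re (L1 P * z\<^sup>2) \<ge> Re (z\<^sup>2 / 2) - \<rho> / 50000 * n"
      by (rule Re_ge_of_norm)
    hence 1: "Re (L1 P * z\<^sup>2) \<ge> (X - Y) / 2 - \<rho> / 50000 * n" by (simp add: Re)
    have "\<kappa> * (7/10 * n) \<le> \<kappa> * (X - Y)"
      using XY \<rho> by (intro mult_left_mono) (auto simp: n \<kappa>_def)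
    hence 2: "\<rho> / 400 * (7/10 * n) \<le> \<kappa> * (X - Y)" by (simp add: \<kappa>_def)
    have "\<rho> * n \<ge> 0" using \<rho> by (simp add: n_def)
    hence "- Re (L1 P * z\<^sup>2) + (1 - \<kappa>) * Re (z\<^sup>2) / 2 \<le> - (\<rho> / 1600 * n)"
      using 1 2 by (simp add: Re field_simps)
    thus ?thesis by (simp add: mult_exp_exp)
  qed
  finally have "norm (exp (- (L1 P * z\<^sup>2)) * cosh z) ^ N \<le> exp (- (\<rho> / 1600 * n)) ^ N"
    by (rule power_mono) simp
  thus ?thesis unfolding weight_eq_power norm_power n_def by (simp add: exp_of_nat_mult[symmetric])
qed

lemma norm_weight_near:
  assumes "z\<^sup>2 \<in> ball 0 \<rho>" "Re (H P (z\<^sup>2)) \<ge> r"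
  shows "norm (weight P N z) \<le> exp (- (real N * r))"
  unfolding weight_eq_exp[OF assms(1)] using assms(2) by (simp add: mult_left_mono)

lemma continuous_weight: "continuous_on S (\<lambda>s. weight P N (f s))" if "continuous_on S f"
  unfolding weight_def using that
  by (intro continuous_intros continuous_on_compose2[OF _ that, of UNIV cosh]) (auto intro!: continuous_on_cosh)

lemma partition_fun_weight:
  assumes "N \<ge> 1" "Re (L1 P * D\<^sup>2) > 0"
  shows "integrable lborel (\<lambda>s. weight P N (D * of_real s))"
    "partition_fun (1 / (2 * L1 P)) N = csqrt (of_nat N * (L1 P * D\<^sup>2)) / of_real (sqrt pi)
      * (\<integral>s. weight P N (D * of_real s) \<partial>lborel)"
  using partition_fun_integral[OF assms] by (simp_all add: weight_def)

end

section \<open>Parameters for which the saddle at the origin dominates\<close>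

context log_cosh_disc
begin

lemma L_quadratic: "p \<in> ball 0 \<rho> \<Longrightarrow> norm (L p - p / 2) \<le> (norm p)\<^sup>2 / 10"
proof -
  assume "p \<in> ball 0 \<rho>"
  have "L p - p / 2 = (L p - p / 2 + p\<^sup>2 / 12) - p\<^sup>2 / 12" by simp
  also have "norm \<dots> \<le> (norm p)\<^sup>2 / 1000 + (norm p)\<^sup>2 / 12"
    by (intro norm_triangle_le_diff add_mono L_approx_0 \<open>p \<in> ball 0 \<rho>\<close>) (simp add: norm_divide norm_power)
  also have "\<dots> \<le> (norm p)\<^sup>2 / 10" using zero_le_power2[of "norm p"] by argo
  finally show ?thesis .
qed

text \<open>The last premise says that the real part of \<open>P D\<^sup>2\<close> is clearly negative for the direction
  \<open>D = 5 \<plusminus> 2 \<i>\<close>, with the sign of \<open>Im P\<close>. As the phase is about \<open>- P z\<^sup>2 / 6\<close> at the origin, the line with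
  direction \<open>D\<close> is then a path of descent from the saddle at \<open>0\<close>.\<close>

lemma partition_fun_origin_saddle:
  obtains K where "K \<ge> 0"
    "\<And>P N. \<lbrakk>P \<noteq> 0; norm P \<le> \<rho> / 10000; N \<ge> 1; norm P \<le> 20 * \<bar>Im P\<bar> - 21 * Re P\<rbrakk> \<Longrightarrow>
      norm (csqrt (1 - 1 / (2 * L1 P)) * partition_fun (1 / (2 * L1 P)) N - 1) \<le> K / (real N * (norm P)\<^sup>2)"
proof -
  obtain K where K: "K \<ge> 0" "laplace_bound (1/200) 89 (1/2) K"
    using laplace_asymptotics[of "1/200" 89 "1/2"] by auto
  have "norm (csqrt (1 - 1 / (2 * L1 P)) * partition_fun (1 / (2 * L1 P)) N - 1) \<le> 3 * K / (real N * (norm P)\<^sup>2)"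
    if P: "P \<noteq> 0" "norm P \<le> \<rho> / 10000" and N: "N \<ge> 1" and reg: "norm P \<le> 20 * \<bar>Im P\<bar> - 21 * Re P" for P N
  proof -
    define n c \<Lambda> where "n = norm P" and "c = L1 P" and "\<Lambda> = real N * n\<^sup>2"
    have n: "n > 0" "n \<le> \<rho> / 10000" using P by (simp_all add: n_def)
    have \<Lambda>: "\<Lambda> > 0" using n N by (simp add: \<Lambda>_def)
    have PB: "P \<in> ball 0 \<rho>" using P \<rho> by simp
    define \<sigma> :: real where "\<sigma> = (if Im P \<ge> 0 then 1 else -1)"
    have \<sigma>: "\<sigma> * Im P = \<bar>Im P\<bar>" "\<sigma>\<^sup>2 = 1" by (auto simp: \<sigma>_def)
    \<comment> \<open>The slope \<open>2 / 5\<close> is the largest one for which \<open>norm_cosh_le\<close> applies.\<close>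
    define D0 where "D0 = Complex 5 (2 * \<sigma>)"
    have D02: "D0\<^sup>2 = Complex 21 (20 * \<sigma>)"
      using \<sigma>(2) by (simp add: D0_def complex_eq_iff Re_power2 Im_power2 power_mult_distrib)
    have nD0: "norm (D0\<^sup>2) = 29"
      using \<sigma>(2) unfolding D02 by (simp add: cmod_def power_mult_distrib)
    define D where "D = D0 * of_real (sqrt n)"
    have D2: "D\<^sup>2 = of_real n * D0\<^sup>2" using n by (simp add: D_def power_mult_distrib flip: of_real_power)
    define A0 where "A0 = (c - 1 / 2) * D0\<^sup>2"
    have Re_A0: "Re A0 \<ge> n / 10"
    proof -
      have "norm (A0 - (- P * D0\<^sup>2 / 6)) = norm ((c - 1 / 2 + P / 6) * D0\<^sup>2)"
        by (simp add: A0_def algebra_simps)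
      also have "\<dots> \<le> n / 1000 * 29"
        using L1_approx[OF PB] unfolding norm_mult nD0 n_def c_def by (intro mult_right_mono) auto
      finally have "Re A0 \<ge> Re (- P * D0\<^sup>2 / 6) - n / 1000 * 29" by (rule Re_ge_of_norm)
      moreover have "Re (- P * D0\<^sup>2 / 6) = (20 * \<bar>Im P\<bar> - 21 * Re P) / 6"
        unfolding D02 \<sigma>(1)[symmetric] by (simp add: field_simps)
      ultimately have "Re A0 \<ge> (20 * \<bar>Im P\<bar> - 21 * Re P) / 6 - n / 1000 * 29" by (simp only:)
      moreover have "(20 * \<bar>Im P\<bar> - 21 * Re P) / 6 \<ge> n / 6" using reg by (simp add: n_def)
      ultimately show ?thesis using n(1) by argo
    qed
    have Re_cD0: "Re (c * D0\<^sup>2) > 0"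
    proof -
      have "c * D0\<^sup>2 = A0 + D0\<^sup>2 / 2" by (simp add: A0_def algebra_simps)
      hence "Re (c * D0\<^sup>2) = Re A0 + 21 / 2" by (simp add: D02)
      thus ?thesis using Re_A0 n by simp
    qed
    have z2: "(D * of_real t)\<^sup>2 = D0\<^sup>2 * of_real (n * t\<^sup>2)" for t
      by (simp add: power_mult_distrib D2 mult_ac)
    have nt: "norm (complex_of_real (n * t\<^sup>2)) = n * t\<^sup>2" for t
      by (subst norm_of_real) (use n in simp)
    have wt: "norm (weight P N (D * of_real t)) \<le> exp (- (\<Lambda> * (1/200) * t\<^sup>2))" for t
    proof -
      let ?z = "D * of_real t"
      have "norm (cosh ?z) \<le> exp (1 * Re (?z\<^sup>2) / 2)"
        using \<sigma>(2) by (intro norm_cosh_le) (auto simp: D_def D0_def power_mult_distrib)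
      hence "norm (exp (- (c * ?z\<^sup>2)) * cosh ?z) \<le> exp (- Re (c * ?z\<^sup>2)) * exp (Re (?z\<^sup>2) / 2)"
        unfolding norm_mult by (intro mult_mono) auto
      also have "\<dots> = exp (- Re (A0 * of_real (n * t\<^sup>2)))"
      proof -
        have e: "c * ?z\<^sup>2 = A0 * of_real (n * t\<^sup>2) + ?z\<^sup>2 / 2"
          unfolding z2 by (simp add: A0_def algebra_simps)
        have "exp (- Re (x + y / 2)) * exp (Re y / 2) = exp (- Re x)" for x y :: complex
          by (simp add: mult_exp_exp)
        thus ?thesis unfolding e .
      qed
      also have "\<dots> = exp (- (n * t\<^sup>2 * Re A0))" by (simp add: mult_ac)
      also have "\<dots> \<le> exp (- (n * t\<^sup>2 * (n / 200)))"
        using Re_A0 n by (simp add: mult_left_mono)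
      finally have "norm (exp (- (c * ?z\<^sup>2)) * cosh ?z) ^ N \<le> exp (- (n * t\<^sup>2 * (n / 200))) ^ N"
        by (rule power_mono) simp
      thus ?thesis unfolding weight_eq_power norm_power c_def
        by (simp add: exp_of_nat_mult[symmetric] \<Lambda>_def power2_eq_square mult_ac)
    qed
    define a where "a = A0 / of_real n"
    have Re_a: "Re a \<ge> 1 / 10" using Re_A0 n by (simp add: a_def field_simps)
    define g where "g t = H P ((D * of_real t)\<^sup>2) / of_real (n\<^sup>2)" for t :: real
    have zB: "(D * of_real t)\<^sup>2 \<in> ball 0 \<rho>" if "\<bar>t\<bar> \<le> 1/2" for t
    proof -
      have "t\<^sup>2 \<le> (1/2)\<^sup>2" using power_mono[OF that, of 2] by simp
      hence "n * t\<^sup>2 \<le> n * 1" using n by (intro mult_left_mono) (auto simp: power_divide)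
      hence "29 * (n * t\<^sup>2) < \<rho>" using n \<rho> by argo
      thus ?thesis unfolding z2 mem_ball_0 norm_mult nD0 nt .
    qed
    have main: "norm (of_real (sqrt \<Lambda>) * (LINT t:UNIV|lborel. weight P N (D * of_real t)) - of_real (sqrt pi) / csqrt a) \<le> K / \<Lambda>"
    proof (rule laplace_boundD[OF K(2), where e = 0 and g = g])
      fix t :: real assume t: "\<bar>t\<bar> \<le> 1/2"
      show "weight P N (D * of_real t) = exp (- (of_real \<Lambda> * g t))"
        unfolding weight_eq_exp[OF zB[OF t]] g_def using n by (simp add: \<Lambda>_def)
      let ?p = "(D * of_real t)\<^sup>2"
      have "g t - a * of_real t ^ 2 - 0 * of_real t ^ 3 = - (L ?p - ?p / 2) / of_real (n\<^sup>2)"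
      proof -
        have "a * of_real t ^ 2 = (c - 1 / 2) * ?p / of_real (n\<^sup>2)"
          using n unfolding z2 by (simp add: a_def A0_def power2_eq_square field_simps)
        thus ?thesis by (simp add: g_def H_def c_def algebra_simps diff_divide_distrib add_divide_distrib)
      qed
      also have "norm \<dots> \<le> ((norm ?p)\<^sup>2 / 10) / n\<^sup>2"
      proof -
        have "norm (- X / of_real (n\<^sup>2)) \<le> y / n\<^sup>2" if "norm X \<le> y" for X :: complex and y
          using that by (simp add: norm_divide norm_power divide_right_mono del: of_real_power)
        thus ?thesis using L_quadratic[OF zB[OF t]] by blast
      qed
      also have "\<dots> \<le> 89 * t ^ 4"
        unfolding z2 norm_mult nD0 nt using n by (simp add: power_mult_distrib power_mult[symmetric])
      finally show "norm (g t - a * of_real t ^ 2 - 0 * of_real t ^ 3) \<le> 89 * t ^ 4" .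
    qed (use \<Lambda> Re_a wt in \<open>auto intro!: continuous_weight continuous_intros\<close>)
    define q where "q = csqrt (c * D0\<^sup>2)"
    have q0: "q \<noteq> 0" and a0: "csqrt a \<noteq> 0" using Re_cD0 Re_a by (auto simp: q_def)
    have Z: "partition_fun (1 / (2 * c)) N = of_real (sqrt \<Lambda> / sqrt n) * q / of_real (sqrt pi) * (LINT t:UNIV|lborel. weight P N (D * of_real t))"
    proof -
      have "of_nat N * (c * D\<^sup>2) = of_real (real N * n) * (c * D0\<^sup>2)" by (simp add: D2 mult_ac)
      hence "csqrt (of_nat N * (c * D\<^sup>2)) = of_real (sqrt (real N * n)) * q"
        using n by (simp only: q_def) (rule csqrt_of_real_mult, simp)
      also have "sqrt (real N * n) = sqrt \<Lambda> / sqrt n"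
      proof -
        have "sqrt \<Lambda> = sqrt (real N) * n" using n by (simp add: \<Lambda>_def real_sqrt_mult)
        hence "sqrt \<Lambda> / sqrt n = sqrt (real N) * (n / sqrt n)" by simp
        also have "n / sqrt n = sqrt n" using n by (simp add: real_div_sqrt)
        finally show ?thesis by (simp add: real_sqrt_mult)
      qed
      finally show ?thesis
        using partition_fun_weight(2)[OF N, of P D] Re_cD0 n
        by (simp add: c_def[symmetric] D2 set_lebesgue_integral_def mult_ac)
    qed
    have r: "csqrt (1 - 1 / (2 * c)) = of_real (sqrt n) * csqrt a / q"
    proof -
      have "Re A0 > 0" using Re_A0 n by simp
      hence "csqrt (A0 / (c * D0\<^sup>2)) = csqrt A0 / q" unfolding q_def by (rule csqrt_divide_Re_pos[OF _ Re_cD0])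
      moreover have "A0 / (c * D0\<^sup>2) = 1 - 1 / (2 * c)"
      proof -
        have "c \<noteq> 0" "D0\<^sup>2 \<noteq> 0" using Re_cD0 by auto
        hence "A0 / (c * D0\<^sup>2) = (c - 1 / 2) / c" by (simp add: A0_def)
        thus ?thesis using \<open>c \<noteq> 0\<close> by (simp add: field_simps)
      qed
      moreover have "csqrt A0 = of_real (sqrt n) * csqrt a"
        using csqrt_of_real_mult[of n a] n by (simp add: a_def)
      ultimately show ?thesis by simp
    qed
    let ?I = "LINT t:UNIV|lborel. weight P N (D * of_real t)"
    have "csqrt (1 - 1 / (2 * c)) * partition_fun (1 / (2 * c)) N - 1
        = csqrt a / of_real (sqrt pi) * (of_real (sqrt \<Lambda>) * ?I - of_real (sqrt pi) / csqrt a)"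
      unfolding r Z using q0 a0 n by (simp add: field_simps)
    also have "norm \<dots> \<le> 3 * (K / \<Lambda>)"
    proof -
      have "norm a \<le> (n / 5 * 29) / n"
      proof -
        have "norm a = norm (c - 1 / 2) * 29 / n"
          using n unfolding a_def A0_def norm_divide norm_mult nD0 by simp
        also have "norm (c - 1 / 2) \<le> n / 5" using L1_near_half(1)[OF PB] by (simp add: c_def n_def)
        finally show ?thesis using n by (simp add: divide_right_mono)
      qed
      hence "norm a \<le> 3\<^sup>2" using n by simp
      hence "norm (csqrt a) \<le> 3" by (simp add: norm_csqrt real_le_lsqrt)
      moreover have "sqrt pi \<ge> 1" using pi_gt3 by simp
      ultimately have "norm (csqrt a / of_real (sqrt pi)) \<le> 3"
        by (simp add: norm_divide divide_le_eq mult_le_cancel_left1 order.trans)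
      thus ?thesis unfolding norm_mult[of "csqrt a / of_real (sqrt pi)"]
        using main by (intro mult_mono) auto
    qed
    finally show ?thesis by (simp add: \<Lambda>_def n_def c_def)
  qed
  thus ?thesis using K(1) by (intro that[of "3 * K"]) auto
qed

end

section \<open>The outer saddles\<close>

context log_cosh_disc
begin

lemma L2_bounds:
  assumes "P \<in> ball 0 \<rho>"
  shows "norm (L2 P) \<le> 1 / 5" "4 / 25 \<le> norm (L2 P)"
proof -
  have "norm (L2 P) \<le> norm (L2 P + 1 / 6) + norm (1 / 6 :: complex)"
    by (metis add_diff_cancel_right' norm_triangle_ineq4)
  thus "norm (L2 P) \<le> 1 / 5" using d2[OF assms] by simp
  have "norm (1 / 6 :: complex) \<le> norm (L2 P + 1 / 6) + norm (L2 P)"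
    by (metis add_diff_cancel_left' norm_triangle_ineq4)
  thus "4 / 25 \<le> norm (L2 P)" using d2[OF assms] by simp
qed

text \<open>The quadratic Taylor coefficient of the phase at \<open>u\<close> along the line \<open>u (1 + v t)\<close>, divided by
  \<open>\<bar>P\<bar>\<^sup>2\<close>. It is close to a third of \<open>(P / \<bar>P\<bar>)\<^sup>2 v\<^sup>2\<close>.\<close>

definition saddle_coeff :: "complex \<Rightarrow> complex \<Rightarrow> complex" where
  "saddle_coeff P v = - 2 * L2 P * (P / of_real (norm P))\<^sup>2 * v\<^sup>2"

lemma saddle_coeff_approx:
  assumes "P \<in> ball 0 \<rho>" "P \<noteq> 0"
  shows "norm (saddle_coeff P v - (P / of_real (norm P))\<^sup>2 * v\<^sup>2 / 3) \<le> (norm v)\<^sup>2 / 500"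
proof -
  have "saddle_coeff P v - (P / of_real (norm P))\<^sup>2 * v\<^sup>2 / 3 = - 2 * (L2 P + 1 / 6) * ((P / of_real (norm P))\<^sup>2 * v\<^sup>2)"
    by (simp add: saddle_coeff_def algebra_simps)
  also have "norm \<dots> = 2 * norm (L2 P + 1 / 6) * (norm v)\<^sup>2"
  proof -
    have "norm (- 2 * X * ((P / of_real (norm P))\<^sup>2 * v\<^sup>2)) = 2 * norm X * (norm v)\<^sup>2" for X
      using assms(2) by (simp add: norm_mult norm_power norm_divide)
    thus ?thesis .
  qed
  also have "\<dots> \<le> 2 * (1 / 1000) * (norm v)\<^sup>2"
    using d2[OF assms(1)] by (intro mult_right_mono mult_left_mono) auto
  finally show ?thesis by simp
qed

lemma norm_saddle_coeff:
  assumes "P \<in> ball 0 \<rho>" "P \<noteq> 0"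
  shows "norm (saddle_coeff P v) \<le> 2 / 5 * (norm v)\<^sup>2"
proof -
  have "norm (saddle_coeff P v) = 2 * norm (L2 P) * (norm v)\<^sup>2"
    using assms(2) by (simp add: saddle_coeff_def norm_mult norm_power norm_divide)
  also have "\<dots> \<le> 2 * (1 / 5) * (norm v)\<^sup>2"
    using L2_bounds(1)[OF assms(1)] by (intro mult_right_mono mult_left_mono) auto
  finally show ?thesis by simp
qed

text \<open>The expansion of the phase at the saddle \<open>u\<close>, \<open>u\<^sup>2 = P\<close>, along the line \<open>u (1 + v t)\<close>.\<close>

lemma H_saddle_expansion:
  assumes P: "P \<noteq> 0" "norm P \<le> \<rho> / 10000" and v: "norm v \<le> 2"
  obtains e where "norm e \<le> 89 + 1400 * M"
    "\<And>t. \<bar>t\<bar> \<le> 1/2 \<Longrightarrow> norm ((H P (P * (1 + v * of_real t)\<^sup>2) - H P P) / of_real ((norm P)\<^sup>2)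
       - saddle_coeff P v * of_real t ^ 2 - e * of_real t ^ 3) \<le> (89 + 1400 * M) * t ^ 4"
proof -
  define n where "n = norm P"
  have n: "n > 0" "n \<le> \<rho> / 10000" "n \<le> 1" using P \<rho> by (auto simp: n_def)
  have PB: "P \<in> ball 0 \<rho>" using P \<rho> by simp
  have vp: "norm v ^ k \<le> 2 ^ k" for k using v by (intro power_mono) auto
  have quot: "norm (- X / of_real (n\<^sup>2)) \<le> B" if "norm X \<le> B * n\<^sup>2" for X :: complex and B
    using that n by (simp add: norm_divide divide_le_eq norm_power)
  define e where "e = - (2 * L2 P * P\<^sup>2 * v ^ 3 + 4 / 3 * L3 P * P ^ 3 * v ^ 3) / of_real (n\<^sup>2)"
  have "norm (2 * L2 P * P\<^sup>2 * v ^ 3 + 4 / 3 * L3 P * P ^ 3 * v ^ 3) \<le> 2 * (1/5) * n\<^sup>2 * 2 ^ 3 + 4 / 3 * M * n\<^sup>2 * 2 ^ 3"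
  proof (rule norm_triangle_mono)
    show "norm (2 * L2 P * P\<^sup>2 * v ^ 3) \<le> 2 * (1/5) * n\<^sup>2 * 2 ^ 3"
      unfolding norm_mult norm_power n_def[symmetric]
      using L2_bounds(1)[OF PB] vp[of 3] by (intro mult_mono) auto
    have "n ^ 3 \<le> n\<^sup>2" using n by (intro power_decreasing) auto
    thus "norm (4 / 3 * L3 P * P ^ 3 * v ^ 3) \<le> 4 / 3 * M * n\<^sup>2 * 2 ^ 3"
      unfolding norm_mult norm_power n_def[symmetric]
      using d3[OF PB] vp[of 3] M n by (intro mult_mono) auto
  qed
  also have "\<dots> \<le> (89 + 1400 * M) * n\<^sup>2"
  proof -
    have "0 \<le> (89 - 16/5) * n\<^sup>2 + (1400 - 32/3) * (M * n\<^sup>2)"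
      using M by (intro add_nonneg_nonneg mult_nonneg_nonneg) auto
    thus ?thesis by (simp add: field_simps)
  qed
  finally have e: "norm e \<le> 89 + 1400 * M"
    unfolding e_def by (rule quot)
  show ?thesis
  proof (rule that[OF e])
    fix t :: real assume t: "\<bar>t\<bar> \<le> 1/2"
    define p d where "p = P * (1 + v * of_real t)\<^sup>2" and "d = p - P"
    have tn: "norm (of_real t :: complex) \<le> 1/2" using t by simp
    have vt: "norm (v * of_real t) \<le> 1"
      using mult_mono[OF v tn] by (simp add: norm_mult)
    have pB: "p \<in> ball 0 \<rho>"
    proof -
      have "norm (1 + v * of_real t) \<le> 2" using vt by (intro norm_triangle_le) simp
      hence "norm p \<le> n * 2\<^sup>2" unfolding p_def norm_mult norm_power n_def
        by (intro mult_left_mono power_mono) auto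
      thus ?thesis using n \<rho> by simp
    qed
    define R where "R = L p - L P - L1 P * d - L2 P * d\<^sup>2 / 2 - L3 P * d ^ 3 / 6"
    have d: "d = P * of_real t * (2 * v + v\<^sup>2 * of_real t)"
      by (simp add: d_def p_def power2_eq_square algebra_simps)
    have nd: "norm d \<le> n * \<bar>t\<bar> * 6"
    proof -
      have "norm (v\<^sup>2 * of_real t) \<le> 2\<^sup>2 * (1/2)"
        unfolding norm_mult norm_power using vp[of 2] tn by (intro mult_mono) auto
      hence "norm (2 * v + v\<^sup>2 * of_real t) \<le> 6"
        using v by (intro norm_triangle_le) (simp add: norm_mult)
      hence "norm P * \<bar>t\<bar> * norm (2 * v + v\<^sup>2 * of_real t) \<le> norm P * \<bar>t\<bar> * 6"
        by (rule mult_left_mono) simp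
      thus ?thesis by (simp only: d norm_mult n_def norm_of_real)
    qed
    have R: "norm R \<le> 1296 * M * t ^ 4 * n\<^sup>2"
    proof -
      have "norm R \<le> M * norm d ^ 4" unfolding R_def d_def by (rule L_cubic_Taylor[OF pB PB])
      also have "\<dots> \<le> M * (n * \<bar>t\<bar> * 6) ^ 4"
        using nd M by (intro mult_left_mono power_mono) auto
      also have "\<dots> = 1296 * M * t ^ 4 * n ^ 4" by (simp add: power_mult_distrib power_even_abs_numeral)
      also have "n ^ 4 \<le> n\<^sup>2" using n by (intro power_decreasing) auto
      hence "1296 * M * t ^ 4 * n ^ 4 \<le> 1296 * M * t ^ 4 * n\<^sup>2" using M by (intro mult_left_mono) auto
      finally show ?thesis .
    qed
    define T1 T2 where "T1 = L2 P * P\<^sup>2 * v ^ 4 / 2"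
      and "T2 = L3 P * P ^ 3 * (12 * v ^ 4 + 6 * v ^ 5 * of_real t + v ^ 6 * of_real t ^ 2) / 6"
    have T1: "norm T1 \<le> 2 * n\<^sup>2"
    proof -
      have "norm (L2 P * P\<^sup>2 * v ^ 4) \<le> 1/5 * n\<^sup>2 * 2 ^ 4"
        unfolding norm_mult norm_power n_def[symmetric]
        using L2_bounds(1)[OF PB] vp[of 4] by (intro mult_mono) auto
      hence "norm (L2 P * P\<^sup>2 * v ^ 4) \<le> 16/5 * n\<^sup>2" by simp
      moreover have "norm T1 = norm (L2 P * P\<^sup>2 * v ^ 4) / 2" by (simp add: T1_def norm_divide)
      ultimately show ?thesis using zero_le_power2[of n] by argo
    qed
    have T2: "norm T2 \<le> 60 * M * n\<^sup>2"
    proof -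
      have 1: "norm (12 * v ^ 4) \<le> 12 * 2 ^ 4" using vp[of 4] by (simp add: norm_mult norm_power)
      have 2: "norm (6 * v ^ 5 * of_real t) \<le> 6 * 2 ^ 5 * (1/2)"
        unfolding norm_mult norm_power using vp[of 5] tn by (intro mult_mono) auto
      have 3: "norm (v ^ 6 * of_real t ^ 2) \<le> 2 ^ 6 * (1/2) ^ 2"
        unfolding norm_mult norm_power using vp[of 6] power_mono[OF tn norm_ge_zero, of 2]
        by (intro mult_mono) auto
      have s: "norm (12 * v ^ 4 + 6 * v ^ 5 * of_real t + v ^ 6 * of_real t ^ 2) \<le> 360"
        using norm_triangle_mono[OF norm_triangle_mono[OF 1 2] 3] by (simp add: power_divide)
      have "n ^ 3 \<le> n\<^sup>2" using n by (intro power_decreasing) auto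
      hence "norm (L3 P * P ^ 3 * (12 * v ^ 4 + 6 * v ^ 5 * of_real t + v ^ 6 * of_real t ^ 2)) \<le> M * n\<^sup>2 * 360"
        unfolding norm_mult[of _ "12 * v ^ 4 + 6 * v ^ 5 * of_real t + v ^ 6 * of_real t ^ 2"] norm_mult[of "L3 P"] norm_power n_def[symmetric]
        using d3[OF PB] s M n by (intro mult_mono) auto
      thus ?thesis by (simp add: T2_def norm_divide)
    qed
    have key: "(H P p - H P P) / of_real (n\<^sup>2) - saddle_coeff P v * of_real t ^ 2 - e * of_real t ^ 3
        = - ((T1 + T2) * of_real t ^ 4 + R) / of_real (n\<^sup>2)"
    proof -
      have nn: "of_real n \<noteq> (0::complex)" using n by simp
      have "H P p - H P P = - (L2 P * d\<^sup>2 / 2 + L3 P * d ^ 3 / 6 + R)"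
        by (simp add: R_def H_def d_def algebra_simps)
      also have "L2 P * d\<^sup>2 / 2 = 2 * L2 P * P\<^sup>2 * v\<^sup>2 * of_real t ^ 2 + 2 * L2 P * P\<^sup>2 * v ^ 3 * of_real t ^ 3 + T1 * of_real t ^ 4"
        unfolding d T1_def by (simp add: field_simps eval_nat_numeral)
      also have "L3 P * d ^ 3 / 6 = 4 / 3 * L3 P * P ^ 3 * v ^ 3 * of_real t ^ 3 + T2 * of_real t ^ 4"
        unfolding d T2_def by (simp add: field_simps eval_nat_numeral)
      finally have "H P p - H P P = saddle_coeff P v * of_real (n\<^sup>2) * of_real t ^ 2 + e * of_real (n\<^sup>2) * of_real t ^ 3
          - ((T1 + T2) * of_real t ^ 4 + R)"
      proof -
        have sc: "saddle_coeff P v * of_real (n\<^sup>2) = - 2 * L2 P * P\<^sup>2 * v\<^sup>2"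
          using nn by (simp add: saddle_coeff_def n_def[symmetric] power_divide)
        have en: "e * of_real (n\<^sup>2) = - (2 * L2 P * P\<^sup>2 * v ^ 3 + 4 / 3 * L3 P * P ^ 3 * v ^ 3)"
          using nn by (simp add: e_def)
        assume "H P p - H P P = - (2 * L2 P * P\<^sup>2 * v\<^sup>2 * of_real t ^ 2 + 2 * L2 P * P\<^sup>2 * v ^ 3 * of_real t ^ 3 + T1 * of_real t ^ 4
          + (4 / 3 * L3 P * P ^ 3 * v ^ 3 * of_real t ^ 3 + T2 * of_real t ^ 4) + R)"
        thus ?thesis unfolding sc en by (simp add: algebra_simps)
      qed
      thus ?thesis using nn by (simp add: diff_divide_distrib add_divide_distrib)
    qed
    have "norm ((T1 + T2) * of_real t ^ 4 + R) \<le> (2 * n\<^sup>2 + 60 * M * n\<^sup>2) * t ^ 4 + 1296 * M * t ^ 4 * n\<^sup>2"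
    proof (rule norm_triangle_mono[OF _ R])
      show "norm ((T1 + T2) * of_real t ^ 4) \<le> (2 * n\<^sup>2 + 60 * M * n\<^sup>2) * t ^ 4"
        unfolding norm_mult using norm_triangle_mono[OF T1 T2]
        by (intro mult_mono) (auto simp: norm_power power_even_abs_numeral M)
    qed
    also have "\<dots> = (2 + 1356 * M) * t ^ 4 * n\<^sup>2" by (simp add: algebra_simps)
    also have "\<dots> \<le> (89 + 1400 * M) * t ^ 4 * n\<^sup>2"
      using M by (intro mult_right_mono) auto
    finally have "norm (- ((T1 + T2) * of_real t ^ 4 + R) / of_real (n\<^sup>2)) \<le> (89 + 1400 * M) * t ^ 4"
      by (rule quot)
    thus "norm ((H P (P * (1 + v * of_real t)\<^sup>2) - H P P) / of_real ((norm P)\<^sup>2)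
       - saddle_coeff P v * of_real t ^ 2 - e * of_real t ^ 3) \<le> (89 + 1400 * M) * t ^ 4"
      using key by (simp only: n_def p_def)
  qed
qed

text \<open>The contribution of the two saddles \<open>\<plusminus>u\<close>, expressed through \<open>P = u\<^sup>2\<close>. The next lemma identifies
  its prefactor with \<open>\<beta> / (\<beta> - \<beta>\<^sup>2 + u\<^sup>2)\<close>.\<close>

definition saddle_term :: "complex \<Rightarrow> nat \<Rightarrow> complex" where
  "saddle_term P N = 2 * csqrt (- L1 P / (2 * P * L2 P)) * exp (- (of_nat N * H P P))"

lemma saddle_prefactor:
  assumes u: "u\<^sup>2 = P" "P \<noteq> 0" "P \<in> ball 0 \<rho>" and \<beta>: "\<beta> = 1 / (2 * L1 P)" "L1 P \<noteq> 0"
  shows "\<beta> / (\<beta> - \<beta>\<^sup>2 + u\<^sup>2) = - L1 P / (2 * P * L2 P)"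
proof -
  define c l where "c = L1 P" and "l = L2 P"
  have l: "l \<noteq> 0" and c: "c \<noteq> 0" using L2_bounds(2)[OF u(3)] \<beta>(2) by (auto simp: l_def c_def)
  have "1 - (2 * u * c)\<^sup>2 = 2 * c + 4 * P * l"
    using tanh_square_eq[of u] tanh_eq[of u] u by (simp add: c_def l_def)
  hence eq: "1 - 4 * P * c\<^sup>2 = 2 * c + 4 * P * l" by (simp add: power_mult_distrib u(1))
  have "\<beta> - \<beta>\<^sup>2 + P = (2 * c - 1 + 4 * P * c\<^sup>2) / (4 * c\<^sup>2)"
    using c by (simp add: \<beta>(1) c_def[symmetric] power2_eq_square field_simps)
  also have "2 * c - 1 + 4 * P * c\<^sup>2 = - (4 * P * l)" using eq by (simp add: algebra_simps)
  finally have "\<beta> - \<beta>\<^sup>2 + P = - (P * l) / c\<^sup>2" using c by (simp add: field_simps)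
  thus ?thesis
    using c l u(2) unfolding u(1) c_def[symmetric] l_def[symmetric]
    by (simp add: \<beta>(1) c_def[symmetric] power2_eq_square)
qed

end

section \<open>Parameters for which the outer saddles dominate\<close>

context log_cosh_disc
begin

lemma one_minus_inverse:
  assumes "P \<in> ball 0 \<rho>" "P \<noteq> 0" "norm P \<le> \<rho> / 10000"
  shows "L1 P \<noteq> 0" "1 - 1 / (2 * L1 P) = (L1 P - 1 / 2) / L1 P" "2/5 \<le> norm (L1 P)" "norm (L1 P) \<le> 3/5"
proof -
  have d: "norm (L1 P - 1 / 2) \<le> 1/10" using L1_near_half(1)[OF assms(1)] assms(3) \<rho> by simp
  have "norm (1 / 2 :: complex) \<le> norm (L1 P) + norm (L1 P - 1 / 2)"
    by (metis diff_diff_eq2 add_diff_cancel_left' norm_triangle_ineq4)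
  thus 1: "2/5 \<le> norm (L1 P)" using d by simp
  have "norm (L1 P) \<le> norm (L1 P - 1 / 2) + norm (1 / 2 :: complex)"
    by (metis diff_add_cancel norm_triangle_ineq)
  thus "norm (L1 P) \<le> 3/5" using d by simp
  show "L1 P \<noteq> 0" using 1 by auto
  thus "1 - 1 / (2 * L1 P) = (L1 P - 1 / 2) / L1 P" by (simp add: field_simps)
qed

lemma sqrt_49_25_divide: "sqrt (49 / 25 / n) = 7 / 5 / sqrt n"
proof -
  have "(49 / 25 :: real) = (7 / 5)\<^sup>2" by (simp add: power_divide)
  thus ?thesis by (simp only: real_sqrt_divide[of "(7 / 5)\<^sup>2"] real_sqrt_abs)
qed

lemma norm_origin_term:
  assumes "P \<noteq> 0" "norm P \<le> \<rho> / 10000"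
  shows "7/5 / sqrt (norm P) \<le> norm (1 / csqrt (1 - 1 / (2 * L1 P)))"
    "norm (1 / csqrt (1 - 1 / (2 * L1 P))) \<le> 2 / sqrt (norm P)"
proof -
  define n where "n = norm P"
  have n: "n > 0" using assms by (simp add: n_def)
  have PB: "P \<in> ball 0 \<rho>" using assms \<rho> by simp
  note c = one_minus_inverse[OF PB assms]
  define x y where "x = norm (L1 P)" and "y = norm (L1 P - 1 / 2)"
  have x: "2/5 \<le> x" "x \<le> 3/5" using c by (simp_all add: x_def)
  have y: "y \<le> n / 5" "n * (4/25) \<le> y" using L1_near_half[OF PB] by (simp_all add: y_def n_def)
  have e: "norm (1 / csqrt (1 - 1 / (2 * L1 P))) = sqrt (x / y)"
    unfolding c(2) by (simp add: norm_divide norm_csqrt real_sqrt_divide x_def y_def)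
  have yp: "y > 0" using y n by (smt (verit) mult_pos_pos divide_pos_pos)
  have "49/25 / n \<le> x / y"
  proof -
    have "49/25 * y \<le> x * n"
    proof -
      have "49/25 * y \<le> 49/25 * (n / 5)" using y by simp
      also have "\<dots> \<le> 2/5 * n" using n by simp
      also have "\<dots> \<le> x * n" using x n by (intro mult_right_mono) auto
      finally show ?thesis .
    qed
    thus ?thesis using n yp by (simp add: field_simps)
  qed
  hence "sqrt (49/25 / n) \<le> sqrt (x / y)" by simp
  thus "7/5 / sqrt (norm P) \<le> norm (1 / csqrt (1 - 1 / (2 * L1 P)))"
    unfolding e sqrt_49_25_divide by (simp only: n_def)
  have "x / y \<le> 4 / n"
  proof -
    have "x * n \<le> 3/5 * n" using x n by (intro mult_right_mono) auto
    also have "\<dots> \<le> 4 * y" using y n by argo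
    finally show ?thesis using n yp by (simp add: field_simps)
  qed
  hence "sqrt (x / y) \<le> sqrt (4 / n)" by simp
  thus "norm (1 / csqrt (1 - 1 / (2 * L1 P))) \<le> 2 / sqrt (norm P)" unfolding e n_def by (simp add: real_sqrt_divide)
qed

lemma norm_saddle_term:
  assumes "P \<noteq> 0" "norm P \<le> \<rho> / 10000"
  shows "2 / sqrt (norm P) * exp (- (real N * Re (H P P))) \<le> norm (saddle_term P N)"
    "norm (saddle_term P N) \<le> 14/5 / sqrt (norm P) * exp (- (real N * Re (H P P)))"
proof -
  define n where "n = norm P"
  have n: "n > 0" using assms by (simp add: n_def)
  have PB: "P \<in> ball 0 \<rho>" using assms \<rho> by simp
  define x y where "x = norm (L1 P)" and "y = norm (L2 P)"
  have x: "2/5 \<le> x" "x \<le> 3/5" using one_minus_inverse[OF PB assms] by (simp_all add: x_def)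
  have y: "y \<le> 1/5" "4/25 \<le> y" using L2_bounds[OF PB] by (simp_all add: y_def)
  have e: "norm (saddle_term P N) = 2 * sqrt (x / (2 * n * y)) * exp (- (real N * Re (H P P)))"
    by (simp add: saddle_term_def norm_mult norm_csqrt norm_divide x_def y_def n_def)
  have "1 / n \<le> x / (2 * n * y)" "x / (2 * n * y) \<le> 49/25 / n"
    using x y n by (simp_all add: field_simps)
  hence "sqrt (1 / n) \<le> sqrt (x / (2 * n * y))" "sqrt (x / (2 * n * y)) \<le> sqrt (49/25 / n)"
    by simp_all
  moreover note sqrt_49_25_divide[of n]
  ultimately have s: "2 * (1 / sqrt n) \<le> 2 * sqrt (x / (2 * n * y))" "2 * sqrt (x / (2 * n * y)) \<le> 2 * (7/5 / sqrt n)"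
    by (simp_all add: real_sqrt_divide)
  show "2 / sqrt (norm P) * exp (- (real N * Re (H P P))) \<le> norm (saddle_term P N)"
    unfolding e using mult_right_mono[OF s(1), of "exp (- (real N * Re (H P P)))"] by (simp add: n_def)
  show "norm (saddle_term P N) \<le> 14/5 / sqrt (norm P) * exp (- (real N * Re (H P P)))"
    unfolding e using mult_right_mono[OF s(2), of "exp (- (real N * Re (H P P)))"] by (simp add: n_def)
qed

lemma exp_neg_le_inverse: "x > 0 \<Longrightarrow> exp (- x) \<le> 1 / (x :: real)"
  using le_imp_inverse_le[of x "exp x"] exp_ge_add_one_self[of x] by (simp add: exp_minus inverse_eq_divide)

text \<open>By \<open>Re_H_saddle\<close> the phase at the saddles \<open>\<plusminus>u\<close> is \<open>- P\<^sup>2 / 12\<close> up to a small relative error. So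
  where \<open>Re (P\<^sup>2)\<close> is negative the saddle term is negligible against the first term, and where it is
  positive the roles are exchanged.\<close>

lemma saddle_term_negligible:
  assumes "P \<noteq> 0" "norm P \<le> \<rho> / 10000" "N \<ge> 1" "Re (P\<^sup>2) \<le> - (3/50) * (norm P)\<^sup>2"
  shows "norm (saddle_term P N) \<le> 1000 / (real N * (norm P)\<^sup>2) * norm (1 / csqrt (1 - 1 / (2 * L1 P)))"
proof -
  define n \<Lambda> where "n = norm P" and "\<Lambda> = real N * n\<^sup>2"
  have n: "n > 0" and \<Lambda>: "\<Lambda> > 0" using assms by (simp_all add: n_def \<Lambda>_def)
  have PB: "P \<in> ball 0 \<rho>" using assms \<rho> by simp
  have "Re (H P P) \<ge> n\<^sup>2 / 250"
    using Re_H_saddle(2)[OF PB] assms(4) zero_le_power2[of n] unfolding n_def by argo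
  hence "real N * (n\<^sup>2 / 250) \<le> real N * Re (H P P)" by (intro mult_left_mono) auto
  hence "exp (- (real N * Re (H P P))) \<le> exp (- (\<Lambda> / 250))" by (simp add: \<Lambda>_def)
  also have "\<dots> \<le> 250 / \<Lambda>" using exp_neg_le_inverse[of "\<Lambda> / 250"] \<Lambda> by simp
  finally have E: "exp (- (real N * Re (H P P))) \<le> 250 / \<Lambda>" .
  have "norm (saddle_term P N) \<le> 14/5 / sqrt n * exp (- (real N * Re (H P P)))"
    unfolding n_def by (rule norm_saddle_term(2)[OF assms(1,2)])
  also have "\<dots> \<le> 14/5 / sqrt n * (250 / \<Lambda>)"
    using E n by (intro mult_left_mono) auto
  also have "\<dots> \<le> 1000 / \<Lambda> * (7/5 / sqrt n)"
    using n \<Lambda> by (simp add: field_simps)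
  also have "\<dots> \<le> 1000 / \<Lambda> * norm (1 / csqrt (1 - 1 / (2 * L1 P)))"
    unfolding n_def using norm_origin_term(1)[OF assms(1,2)] \<Lambda> by (intro mult_left_mono) auto
  finally show ?thesis by (simp add: \<Lambda>_def n_def)
qed

lemma origin_term_negligible:
  assumes "P \<noteq> 0" "norm P \<le> \<rho> / 10000" "N \<ge> 1" "Re (P\<^sup>2) \<ge> (norm P)\<^sup>2 / 10"
  shows "norm (1 / csqrt (1 - 1 / (2 * L1 P))) \<le> 200 / (real N * (norm P)\<^sup>2) * norm (saddle_term P N)"
proof -
  define n \<Lambda> where "n = norm P" and "\<Lambda> = real N * n\<^sup>2"
  have n: "n > 0" and \<Lambda>: "\<Lambda> > 0" using assms by (simp_all add: n_def \<Lambda>_def)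
  have PB: "P \<in> ball 0 \<rho>" using assms \<rho> by simp
  have "Re (H P P) \<le> - (n\<^sup>2 / 200)"
    using Re_H_saddle(1)[OF PB] assms(4) zero_le_power2[of n] unfolding n_def by argo
  hence "real N * (n\<^sup>2 / 200) \<le> real N * (- Re (H P P))" by (intro mult_left_mono) auto
  hence h: "\<Lambda> / 200 \<le> - (real N * Re (H P P))" by (simp add: \<Lambda>_def)
  have "\<Lambda> / 200 \<le> exp (\<Lambda> / 200)" using exp_ge_add_one_self[of "\<Lambda> / 200"] by linarith
  also have "\<dots> \<le> exp (- (real N * Re (H P P)))" using h by simp
  finally have E: "1 \<le> 200 / \<Lambda> * exp (- (real N * Re (H P P)))" using \<Lambda> by (simp add: field_simps)
  have "norm (1 / csqrt (1 - 1 / (2 * L1 P))) \<le> 2 / sqrt n * 1"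
    unfolding n_def using norm_origin_term(2)[OF assms(1,2)] by simp
  also have "\<dots> \<le> 2 / sqrt n * (200 / \<Lambda> * exp (- (real N * Re (H P P))))"
    using n by (intro mult_left_mono E) auto
  also have "\<dots> = 200 / \<Lambda> * (2 / sqrt n * exp (- (real N * Re (H P P))))" by simp
  also have "\<dots> \<le> 200 / \<Lambda> * norm (saddle_term P N)"
    unfolding n_def using norm_saddle_term(1)[OF assms(1,2)] \<Lambda> by (intro mult_left_mono) auto
  finally show ?thesis by (simp add: \<Lambda>_def n_def)
qed

lemma weight_minus: "weight P N (- z) = weight P N z"
  by (simp add: weight_def)

text \<open>On the part of the parameter domain where the saddles \<open>\<plusminus>u\<close> dominate strictly, the line
  through \<open>-u\<close>, \<open>0\<close> and \<open>u\<close> passes both of them along directions of descent.\<close>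

lemma partition_fun_outer_saddles:
  obtains K where "K \<ge> 0"
    "\<And>P N. \<lbrakk>P \<noteq> 0; norm P \<le> \<rho> / 10000; N \<ge> 1; 0 < Re P; 10 * \<bar>Im P\<bar> \<le> 9 * Re P\<rbrakk> \<Longrightarrow>
      norm (partition_fun (1 / (2 * L1 P)) N - saddle_term P N) \<le> K / (real N * (norm P)\<^sup>2) * norm (saddle_term P N)"
proof -
  have M89: "89 + 1400 * M \<ge> 0" using M by simp
  obtain K where K: "K \<ge> 0" "laplace_bound (1/200) (89 + 1400 * M) (1/2) K"
    using laplace_asymptotics[of "1/200" "89 + 1400 * M" "1/2"] M89 by auto
  have "norm (partition_fun (1 / (2 * L1 P)) N - saddle_term P N) \<le> K / (real N * (norm P)\<^sup>2) * norm (saddle_term P N)"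
    if P: "P \<noteq> 0" "norm P \<le> \<rho> / 10000" and N: "N \<ge> 1" and reg: "0 < Re P" "10 * \<bar>Im P\<bar> \<le> 9 * Re P" for P N
  proof -
    define n c \<Lambda> where "n = norm P" and "c = L1 P" and "\<Lambda> = real N * n\<^sup>2"
    have n: "n > 0" "n \<le> \<rho> / 10000" using P by (simp_all add: n_def)
    have \<Lambda>: "\<Lambda> > 0" using n N by (simp add: \<Lambda>_def)
    have PB: "P \<in> ball 0 \<rho>" using P \<rho> by simp
    define u where "u = csqrt P"
    have u2: "u\<^sup>2 = P" by (simp add: u_def)
    have n2: "n\<^sup>2 = (Re P)\<^sup>2 + (Im P)\<^sup>2" by (simp add: n_def cmod_power2)
    have sq: "100 * (Im P)\<^sup>2 \<le> 81 * (Re P)\<^sup>2"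
      using power_mono[OF reg(2), of 2] by (simp add: power_mult_distrib)
    have ReP2: "Re (P\<^sup>2) \<ge> n\<^sup>2 / 10"
      unfolding n2 Re_power2 using sq zero_le_power2[of "Re P"] by argo
    have sector: "25 * (Im u)\<^sup>2 \<le> 4 * (Re u)\<^sup>2"
    proof (rule ccontr)
      assume "\<not> ?thesis"
      hence "25 * (Im u)\<^sup>2 > 4 * (Re u)\<^sup>2" by simp
      from power2_outside_sector[OF this] show False using reg by (simp add: u2)
    qed
    have Re_cP: "Re (c * P) > 0"
    proof -
      have "n \<le> \<bar>Re P\<bar> + \<bar>Im P\<bar>" unfolding n_def by (rule cmod_le)
      hence "n \<le> 2 * Re P" using reg by argo
      have "norm (c * P - P / 2) = norm (c - 1 / 2) * n" by (simp add: n_def algebra_simps flip: norm_mult)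
      also have "\<dots> \<le> 1/50000 * n"
        using L1_near_half(1)[OF PB] n \<rho> by (intro mult_right_mono) (auto simp: c_def n_def)
      finally have "Re (c * P) \<ge> Re (P / 2) - 1/50000 * n" by (rule Re_ge_of_norm)
      moreover have "Re (P / 2) = Re P / 2" by simp
      ultimately show ?thesis using \<open>n \<le> 2 * Re P\<close> n(1) by argo
    qed
    define J :: "real set" where "J = {-1..}"
    define \<Phi> where "\<Phi> t = weight P N (u * of_real (1 + t)) * exp (of_nat N * H P P)" for t :: real
    define a where "a = saddle_coeff P 1"
    obtain e where e: "norm e \<le> 89 + 1400 * M"
      "\<And>t. \<bar>t\<bar> \<le> 1/2 \<Longrightarrow> norm ((H P (P * (1 + 1 * of_real t)\<^sup>2) - H P P) / of_real ((norm P)\<^sup>2)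
         - saddle_coeff P 1 * of_real t ^ 2 - e * of_real t ^ 3) \<le> (89 + 1400 * M) * t ^ 4"
      using H_saddle_expansion[OF P, of 1] by auto
    have Re_a: "Re a \<ge> 1/200"
    proof -
      have "Re a \<ge> Re ((P / of_real (norm P))\<^sup>2 * 1\<^sup>2 / 3) - (norm (1::complex))\<^sup>2 / 500"
        unfolding a_def by (rule Re_ge_of_norm[OF saddle_coeff_approx[OF PB P(1)]])
      also have "Re ((P / of_real (norm P))\<^sup>2 * 1\<^sup>2 / 3) = Re (P\<^sup>2) / n\<^sup>2 / 3"
        by (simp add: power_divide n_def[symmetric] Re_divide_of_real flip: of_real_power)
      finally have "Re a \<ge> Re (P\<^sup>2) / n\<^sup>2 / 3 - 1/500" by simp
      moreover have "Re (P\<^sup>2) / n\<^sup>2 \<ge> 1/10" using ReP2 n by (simp add: field_simps)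
      ultimately show ?thesis by argo
    qed
    have z2: "(u * of_real (1 + t))\<^sup>2 = P * of_real ((1 + t)\<^sup>2)" for t
      by (simp add: power_mult_distrib u2)
    have nz2: "norm ((u * of_real (1 + t))\<^sup>2) = n * (1 + t)\<^sup>2" for t
      unfolding z2 norm_mult n_def by (subst norm_of_real) simp
    have \<Phi>_eq: "\<Phi> t = exp (- (of_nat N * (H P (P * of_real ((1 + t)\<^sup>2)) - H P P)))"
      if "P * of_real ((1 + t)\<^sup>2) \<in> ball 0 \<rho>" for t
      using weight_eq_exp[of "u * of_real (1 + t)" P N] that unfolding z2 \<Phi>_def
      by (simp add: mult_exp_exp algebra_simps)
    have bound: "norm (\<Phi> t) \<le> exp (- (\<Lambda> * (1/200) * t\<^sup>2))" if t: "t \<in> J" for t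
    proof (cases "P * of_real ((1 + t)\<^sup>2) \<in> ball 0 \<rho>")
      case True
      define q where "q = (1 + t)\<^sup>2 - 1"
      have pP: "P * of_real ((1 + t)\<^sup>2) - P = P * of_real q" by (simp add: q_def algebra_simps)
      have "Re (H P (P * of_real ((1 + t)\<^sup>2)) - H P P) \<ge> Re ((P * of_real q)\<^sup>2 / 12) - (norm (P * of_real q))\<^sup>2 / 1000"
        using Re_ge_of_norm[OF H_diff_approx[OF True PB]] unfolding pP .
      also have "Re ((P * of_real q)\<^sup>2 / 12) = q\<^sup>2 * Re (P\<^sup>2) / 12"
        by (simp add: power_mult_distrib mult.commute flip: of_real_power)
      also have "(norm (P * of_real q))\<^sup>2 = q\<^sup>2 * n\<^sup>2"
        by (simp add: norm_mult power_mult_distrib n_def)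
      finally have "Re (H P (P * of_real ((1 + t)\<^sup>2)) - H P P) \<ge> q\<^sup>2 * Re (P\<^sup>2) / 12 - q\<^sup>2 * n\<^sup>2 / 1000" .
      moreover have "q\<^sup>2 * (n\<^sup>2 / 10) \<le> q\<^sup>2 * Re (P\<^sup>2)" using ReP2 by (intro mult_left_mono) auto
      moreover have "0 \<le> q\<^sup>2 * n\<^sup>2" by simp
      ultimately have 1: "Re (H P (P * of_real ((1 + t)\<^sup>2)) - H P P) \<ge> q\<^sup>2 * n\<^sup>2 / 200" by argo
      have q: "q = t * (2 + t)" by (simp add: q_def power2_eq_square algebra_simps)
      have "1\<^sup>2 \<le> (2 + t)\<^sup>2" using t by (intro power_mono) (auto simp: J_def)
      hence "t\<^sup>2 * 1 \<le> t\<^sup>2 * (2 + t)\<^sup>2" by (intro mult_left_mono) auto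
      hence "t\<^sup>2 \<le> q\<^sup>2" by (simp add: q power_mult_distrib)
      hence "t\<^sup>2 * n\<^sup>2 \<le> q\<^sup>2 * n\<^sup>2" by (rule mult_right_mono) simp
      hence "Re (H P (P * of_real ((1 + t)\<^sup>2)) - H P P) \<ge> t\<^sup>2 * n\<^sup>2 / 200" using 1 by argo
      hence "real N * (t\<^sup>2 * n\<^sup>2 / 200) \<le> real N * Re (H P (P * of_real ((1 + t)\<^sup>2)) - H P P)"
        by (rule mult_left_mono) simp
      thus ?thesis unfolding \<Phi>_eq[OF True] by (simp add: \<Lambda>_def mult_ac)
    next
      case False
      hence far: "\<rho> \<le> n * (1 + t)\<^sup>2" using nz2[of t] unfolding z2 by (simp only: mem_ball_0 not_less)
      have "t \<ge> 0"
      proof (rule ccontr)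
        assume "\<not> t \<ge> 0"
        hence "(1 + t)\<^sup>2 \<le> 1" using t by (auto simp: J_def power_le_one)
        hence "n * (1 + t)\<^sup>2 \<le> n * 1" using n by (intro mult_left_mono) auto
        thus False using far n \<rho> by argo
      qed
      have "norm (weight P N (u * of_real (1 + t))) \<le> exp (- (real N * (\<rho> / 1600 * norm ((u * of_real (1 + t))\<^sup>2))))"
      proof (rule norm_weight_far[OF P(2)])
        have "25 * (Im u)\<^sup>2 * (1 + t)\<^sup>2 \<le> 4 * (Re u)\<^sup>2 * (1 + t)\<^sup>2"
          using sector by (rule mult_right_mono) simp
        moreover have "Re (u * of_real x) = Re u * x" "Im (u * of_real x) = Im u * x" for x by simp_all
        ultimately show "25 * (Im (u * of_real (1 + t)))\<^sup>2 \<le> 4 * (Re (u * of_real (1 + t)))\<^sup>2"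
          by (simp only: power_mult_distrib mult.assoc)
        show "\<rho> \<le> norm ((u * of_real (1 + t))\<^sup>2)" unfolding nz2 by (rule far)
      qed
      also have "\<dots> \<le> exp (- (\<Lambda> * (1/200) * t\<^sup>2))"
      proof -
        have "n / 200 * (n * t\<^sup>2) \<le> \<rho> / 1600 * (n * (1 + t)\<^sup>2)"
          using n \<rho> \<open>t \<ge> 0\<close> by (intro mult_mono) (auto intro!: power_mono)
        hence "real N * (n / 200 * (n * t\<^sup>2)) \<le> real N * (\<rho> / 1600 * (n * (1 + t)\<^sup>2))"
          by (rule mult_left_mono) simp
        thus ?thesis unfolding nz2 by (simp add: \<Lambda>_def power2_eq_square mult_ac)
      qed
      finally have w: "norm (weight P N (u * of_real (1 + t))) \<le> exp (- (\<Lambda> * (1/200) * t\<^sup>2))" .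
      have "Re (H P P) \<le> 0"
        using Re_H_saddle(1)[OF PB] ReP2 zero_le_power2[of n] unfolding n_def by argo
      hence "norm (exp (of_nat N * H P P)) \<le> 1" by (simp add: mult_nonneg_nonpos)
      with w have "norm (weight P N (u * of_real (1 + t))) * norm (exp (of_nat N * H P P)) \<le> exp (- (\<Lambda> * (1/200) * t\<^sup>2)) * 1"
        by (intro mult_mono) auto
      thus ?thesis by (simp add: \<Phi>_def norm_mult)
    qed
    let ?I = "LINT t:J|lborel. \<Phi> t"
    have main: "norm (of_real (sqrt \<Lambda>) * ?I - of_real (sqrt pi) / csqrt a) \<le> K / \<Lambda>"
    proof (rule laplace_boundD[OF K(2) \<Lambda> _ _ _ bound Re_a e(1)])
      show "closed J" "{- (1/2)..1/2} \<subseteq> J" by (auto simp: J_def)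
      show "continuous_on J \<Phi>" unfolding \<Phi>_def by (intro continuous_intros continuous_weight)
    next
      fix t :: real assume t: "\<bar>t\<bar> \<le> 1/2"
      have "(1 + t)\<^sup>2 \<le> 2\<^sup>2" using t by (intro power_mono) auto
      hence "n * (1 + t)\<^sup>2 \<le> n * 4" using n by (intro mult_left_mono) auto
      hence "norm (P * of_real ((1 + t)\<^sup>2)) < \<rho>" using nz2[of t] n \<rho> unfolding z2 by argo
      hence "P * of_real ((1 + t)\<^sup>2) \<in> ball 0 \<rho>" by (simp only: mem_ball_0)
      from \<Phi>_eq[OF this] show "\<Phi> t = exp (- (of_real \<Lambda> * ((H P (P * of_real ((1 + t)\<^sup>2)) - H P P) / of_real (n\<^sup>2))))"
        using n by (simp add: \<Lambda>_def)
      show "norm ((H P (P * of_real ((1 + t)\<^sup>2)) - H P P) / of_real (n\<^sup>2) - a * of_real t ^ 2 - e * of_real t ^ 3)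
          \<le> (89 + 1400 * M) * t ^ 4"
        using e(2)[OF t] by (simp add: a_def n_def)
    qed
    have half: "(\<integral>s. weight P N (u * of_real s) \<partial>lborel) = 2 * (exp (- (of_nat N * H P P)) * ?I)"
    proof -
      let ?f = "\<lambda>s. weight P N (u * of_real s)"
      have i: "integrable lborel ?f"
        using partition_fun_weight(1)[OF N, of P u] Re_cP by (simp add: u2 c_def)
      have "integrable lborel (\<lambda>s. indicator {0..} s *\<^sub>R ?f s)"
        by (rule integrable_mult_indicator[OF _ i]) simp
      hence "has_bochner_integral lborel ?f (2 *\<^sub>R (\<integral>s. indicator {0..} s *\<^sub>R ?f s \<partial>lborel))"
        by (intro has_bochner_integral_even_function) (auto simp: has_bochner_integral_iff weight_minus)
      hence "(\<integral>s. ?f s \<partial>lborel) = 2 *\<^sub>R (\<integral>s. indicator {0..} s *\<^sub>R ?f s \<partial>lborel)"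
        by (rule has_bochner_integral_integral_eq)
      also have "(\<integral>s. indicator {0..} s *\<^sub>R ?f s \<partial>lborel) = (\<integral>t. indicator {0..} (1 + t) *\<^sub>R ?f (1 + t) \<partial>lborel)"
        using lborel_integral_real_affine[of 1 "\<lambda>s. indicator {0..} s *\<^sub>R ?f s" 1] by simp
      also have "\<dots> = (\<integral>t. exp (- (of_nat N * H P P)) * (indicator J t *\<^sub>R \<Phi> t) \<partial>lborel)"
        by (rule Bochner_Integration.integral_cong) (auto simp: \<Phi>_def J_def indicator_def exp_minus)
      also have "\<dots> = exp (- (of_nat N * H P P)) * ?I"
        by (simp only: set_lebesgue_integral_def integral_mult_right_zero)
      finally show ?thesis by (simp add: scaleR_conv_of_real)
    qed
    define q where "q = csqrt (c * P)"
    have q0: "q \<noteq> 0" and a0: "csqrt a \<noteq> 0" using Re_cP Re_a by (auto simp: q_def)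
    have Z: "partition_fun (1 / (2 * c)) N = of_real (sqrt \<Lambda> / n) * q / of_real (sqrt pi) * (2 * (exp (- (of_nat N * H P P)) * ?I))"
    proof -
      have "csqrt (of_nat N * (c * P)) = of_real (sqrt (real N)) * q"
        using csqrt_of_real_mult[of "real N" "c * P"] by (simp add: q_def)
      also have "sqrt (real N) = sqrt \<Lambda> / n" using n by (simp add: \<Lambda>_def real_sqrt_mult)
      finally show ?thesis
        using partition_fun_weight(2)[OF N, of P u] Re_cP unfolding half by (simp add: c_def u2)
    qed
    have B: "saddle_term P N = 2 * (q / (of_real n * csqrt a)) * exp (- (of_nat N * H P P))"
    proof -
      have sc: "of_real (n\<^sup>2) * a = - 2 * L2 P * P\<^sup>2"
        using n by (simp add: a_def saddle_coeff_def n_def[symmetric] power_divide)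
      have "csqrt (c * P / (of_real (n\<^sup>2) * a)) = q / csqrt (of_real (n\<^sup>2) * a)"
        unfolding q_def using Re_a n by (intro csqrt_divide_Re_pos Re_cP) auto
      also have "csqrt (of_real (n\<^sup>2) * a) = of_real n * csqrt a"
        using csqrt_of_real_mult[of "n\<^sup>2" a] n by simp
      also have "c * P / (of_real (n\<^sup>2) * a) = - L1 P / (2 * P * L2 P)"
        unfolding sc using P(1) by (simp add: c_def power2_eq_square)
      finally show ?thesis by (simp add: saddle_term_def)
    qed
    have "partition_fun (1 / (2 * c)) N - saddle_term P N
        = saddle_term P N * (csqrt a / of_real (sqrt pi)) * (of_real (sqrt \<Lambda>) * ?I - of_real (sqrt pi) / csqrt a)"
      unfolding B Z using q0 a0 n by (simp add: field_simps)
    also have "norm \<dots> \<le> norm (saddle_term P N) * 1 * (K / \<Lambda>)"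
    proof -
      have "norm a \<le> 1\<^sup>2" using norm_saddle_coeff[OF PB P(1), of 1] by (simp add: a_def)
      hence "norm (csqrt a) \<le> 1" by (simp add: norm_csqrt)
      moreover have "sqrt pi \<ge> 1" using pi_gt3 by simp
      ultimately have "norm (csqrt a / of_real (sqrt pi)) \<le> 1"
        by (simp add: norm_divide divide_le_eq)
      thus ?thesis unfolding norm_mult[of _ "_ - _"] norm_mult[of "saddle_term P N"]
        using main by (intro mult_mono) auto
    qed
    finally show ?thesis by (simp add: c_def \<Lambda>_def n_def mult_ac)
  qed
  thus ?thesis using K(1) by (intro that[of K]) auto
qed

end

section \<open>Parameters for which all saddles matter\<close>

lemma gaussian_tail:
  fixes m :: real
  assumes "m > 0"
  shows "\<exists>K\<ge>0. \<forall>\<Lambda> (f :: real \<Rightarrow> complex). \<Lambda> > 0 \<longrightarrow> integrable lborel f \<longrightarrow>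
    (\<forall>s. norm (f s) \<le> s\<^sup>2 * exp (- (\<Lambda> * m * s\<^sup>2))) \<longrightarrow> sqrt \<Lambda> * norm (\<integral>s. f s \<partial>lborel) \<le> K / \<Lambda>"
proof -
  define W where "W s = s\<^sup>2 * exp (- m * s\<^sup>2)" for s :: real
  have W: "integrable lborel W"
    using integrable_gaussian_moment[OF assms, of 1] unfolding W_def by simp
  have "0 \<le> (\<integral>s. W s \<partial>lborel)" by (intro Bochner_Integration.integral_nonneg) (simp add: W_def)
  moreover have "sqrt \<Lambda> * norm (\<integral>s. f s \<partial>lborel) \<le> (\<integral>s. W s \<partial>lborel) / \<Lambda>"
    if \<Lambda>: "\<Lambda> > 0" and f: "integrable lborel f" "\<And>s. norm (f s) \<le> s\<^sup>2 * exp (- (\<Lambda> * m * s\<^sup>2))" for \<Lambda> and f :: "real \<Rightarrow> complex"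
  proof -
    define q where "q = sqrt \<Lambda>"
    have q: "q > 0" "q\<^sup>2 = \<Lambda>" using \<Lambda> by (simp_all add: q_def)
    have fW: "norm (f s) \<le> W (q * s) / \<Lambda>" for s
      using f(2)[of s] \<Lambda> by (simp add: W_def power_mult_distrib q mult_ac)
    have Wq: "integrable lborel (\<lambda>s. W (q * s) / \<Lambda>)"
      using lborel_integrable_real_affine[OF W, of q 0] q by simp
    have "norm (\<integral>s. f s \<partial>lborel) \<le> (\<integral>s. W (q * s) / \<Lambda> \<partial>lborel)"
      by (rule Bochner_Integration.integral_norm_bound_integral[OF f(1) Wq fW])
    also have "\<dots> = (\<integral>s. W (q * s) \<partial>lborel) / \<Lambda>" by simp
    finally have "q * norm (\<integral>s. f s \<partial>lborel) \<le> q * ((\<integral>s. W (q * s) \<partial>lborel) / \<Lambda>)"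
      using q by (intro mult_left_mono) auto
    also have "\<dots> = (\<integral>s. W s \<partial>lborel) / \<Lambda>"
      using lborel_integral_real_affine[of q W 0] q by simp
    finally show ?thesis by (simp add: q_def)
  qed
  ultimately show ?thesis by blast
qed

context log_cosh_disc
begin

text \<open>Cauchy's theorem for the entire function \<open>weight P N\<close>, in the form of a primitive.\<close>

lemma weight_odd_primitive:
  obtains F where "\<And>z. F (- z) = - F z"
    "\<And>z v x y. x \<le> y \<Longrightarrow> v * (LINT t:{x..y}|lborel. weight P N (z + v * of_real t)) = F (z + v * of_real y) - F (z + v * of_real x)"
proof -
  have "weight P N holomorphic_on UNIV"
    unfolding weight_def[abs_def] cosh_field_def by (intro holomorphic_intros) auto
  from entire_primitive[OF this]
  obtain G where G: "\<And>z. (G has_field_derivative weight P N z) (at z)" by blast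
  define F where "F z = (G z - G (- z)) / 2" for z
  have F: "(F has_field_derivative weight P N z) (at z)" for z
  proof -
    have "((\<lambda>z. G (- z)) has_field_derivative weight P N (- z) * (- 1)) (at z)"
      by (rule DERIV_chain2[OF G]) (auto intro!: derivative_eq_intros)
    from DERIV_cdivide[OF DERIV_diff[OF G this], of 2] show ?thesis
      unfolding F_def[abs_def] by (simp add: weight_minus)
  qed
  show ?thesis
  proof (rule that[of F])
    show "F (- z) = - F z" for z by (simp add: F_def field_simps)
    fix z v and x y :: real assume xy: "x \<le> y"
    let ?f = "\<lambda>t. v * weight P N (z + v * of_real t)"
    have "(\<integral>t. indicator {x..y} t *\<^sub>R ?f t \<partial>lborel) = F (z + v * of_real y) - F (z + v * of_real x)"
    proof (rule integral_FTC_Icc[OF xy])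
      fix t :: real
      have "((\<lambda>w. F (z + v * w)) has_field_derivative weight P N (z + v * of_real t) * v) (at (of_real t))"
        by (rule DERIV_chain2[OF F]) (auto intro!: derivative_eq_intros)
      hence "((\<lambda>w. F (z + v * w)) has_field_derivative ?f t) (at (of_real t))"
        by (rule DERIV_cong) (rule mult.commute)
      thus "((\<lambda>t. F (z + v * of_real t)) has_vector_derivative ?f t) (at t within {x..y})"
        by (rule has_vector_derivative_real_field)
    qed (intro continuous_intros continuous_weight)
    thus "v * (LINT t:{x..y}|lborel. weight P N (z + v * of_real t)) = F (z + v * of_real y) - F (z + v * of_real x)"
      by (simp only: set_lebesgue_integral_def mult_scaleR_right[symmetric] integral_mult_right_zero)
  qed
qed

text \<open>Where the saddles at \<open>0\<close> and at \<open>\<plusminus>u\<close> may have comparable weight, the path of integration has to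
  pass all of them. With \<open>j = \<plusminus>\<i>\<close>, the sign being that of \<open>Im P\<close>, half of the path is
  \<open>0 \<rightarrow> u (1 + j) / 2 \<rightarrow> u (2 - j)\<close>, a broken line through \<open>u\<close>, followed by a ray.\<close>

lemma partition_fun_all_saddles:
  obtains K where "K \<ge> 0"
    "\<And>P N. \<lbrakk>P \<noteq> 0; norm P \<le> \<rho> / 10000; N \<ge> 1; 0 < Re P; 9 * Re P \<le> 10 * \<bar>Im P\<bar>; 10 * \<bar>Im P\<bar> \<le> 12 * Re P\<rbrakk> \<Longrightarrow>
      norm (partition_fun (1 / (2 * L1 P)) N - 1 / csqrt (1 - 1 / (2 * L1 P)) - saddle_term P N)
      \<le> K / (real N * (norm P)\<^sup>2) * (norm (1 / csqrt (1 - 1 / (2 * L1 P))) + norm (saddle_term P N))"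
proof -
  have M89: "89 + 1400 * M \<ge> 0" using M by simp
  obtain K where K: "K \<ge> 0" "laplace_bound (1/200) (89 + 1400 * M) (1/2) K"
    using laplace_asymptotics[of "1/200" "89 + 1400 * M" "1/2"] M89 by auto
  have "(0::real) < 1/200" by simp
  from gaussian_tail[OF this] obtain KT where KT: "KT \<ge> 0"
    "\<forall>\<Lambda> (f :: real \<Rightarrow> complex). \<Lambda> > 0 \<longrightarrow> integrable lborel f \<longrightarrow>
      (\<forall>s. norm (f s) \<le> s\<^sup>2 * exp (- (\<Lambda> * (1/200) * s\<^sup>2))) \<longrightarrow> sqrt \<Lambda> * norm (\<integral>s. f s \<partial>lborel) \<le> KT / \<Lambda>"
    by blast
  have "norm (partition_fun (1 / (2 * L1 P)) N - 1 / csqrt (1 - 1 / (2 * L1 P)) - saddle_term P N)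
      \<le> (K + 4 * KT) / (real N * (norm P)\<^sup>2) * (norm (1 / csqrt (1 - 1 / (2 * L1 P))) + norm (saddle_term P N))"
    if P: "P \<noteq> 0" "norm P \<le> \<rho> / 10000" and N: "N \<ge> 1"
      and reg: "0 < Re P" "9 * Re P \<le> 10 * \<bar>Im P\<bar>" "10 * \<bar>Im P\<bar> \<le> 12 * Re P" for P N
  proof -
    define n c \<Lambda> where "n = norm P" and "c = L1 P" and "\<Lambda> = real N * n\<^sup>2"
    have n: "n > 0" "n \<le> \<rho> / 10000" using P by (simp_all add: n_def)
    have \<Lambda>: "\<Lambda> > 0" using n N by (simp add: \<Lambda>_def)
    have PB: "P \<in> ball 0 \<rho>" using P \<rho> by simp
    define u where "u = csqrt P"
    have u2: "u\<^sup>2 = P" and u0: "u \<noteq> 0" using P(1) by (simp_all add: u_def)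
    define \<sigma> :: real where "\<sigma> = (if Im P \<ge> 0 then 1 else -1)"
    have \<sigma>: "\<sigma> = 1 \<or> \<sigma> = -1" "\<sigma> * Im P = \<bar>Im P\<bar>" "Im P = \<sigma> * \<bar>Im P\<bar>" by (auto simp: \<sigma>_def)
    define j where "j = Complex 0 \<sigma>"
    have jj: "j * j = - 1" "j\<^sup>2 = - 1" using \<sigma>(1) by (auto simp: j_def complex_eq_iff power2_eq_square)
    have jjz: "j * (j * z) = - z" for z using jj(1) by (simp add: mult.assoc[symmetric])
    define w1 w2 v where "w1 = (1 + j) / 2" and "w2 = 2 - j" and "v = 1 - j"
    have w1sq: "w1\<^sup>2 = j / 2" and w2sq: "w2\<^sup>2 = 3 - 4 * j" and vsq: "v\<^sup>2 = - 2 * j"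
      and w12: "w1 * (1 - 3 * j) = w2" and vw2: "v * 5 = (3 - j) * w2"
      using \<sigma>(1) by (auto simp: w1_def w2_def v_def j_def complex_eq_iff power2_eq_square)
    have w20: "w2 \<noteq> 0" and w10: "w1 \<noteq> 0" using w1sq w2sq by (auto simp: w2_def w1_def j_def complex_eq_iff)
    have nj: "norm j = 1" and nv2: "(norm v)\<^sup>2 = 2" and nw: "norm (1 - 3 * j) \<le> 4" and nw2: "norm (3 - 4 * j) = 5"
      using \<sigma>(1) by (auto simp: j_def v_def cmod_def power2_eq_square real_le_lsqrt)
    define x y where "x = Re P" and "y = \<bar>Im P\<bar>"
    have xy: "0 < x" "9 * x \<le> 10 * y" "10 * y \<le> 12 * x" using reg by (simp_all add: x_def y_def)
    have n2: "n\<^sup>2 = x\<^sup>2 + y\<^sup>2" by (simp add: n_def cmod_power2 x_def y_def)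
    have Pxy: "P = of_real x + of_real y * j"
      using \<sigma>(3) by (simp add: complex_eq_iff j_def x_def y_def mult.commute)
    \<comment> \<open>\<open>P\<^sup>2\<close> is nearly a positive multiple of \<open>j\<close>; \<open>\<kappa>\<close> is the unimodular quotient, close to \<open>1\<close>.\<close>
    define \<kappa> where "\<kappa> = - j * P\<^sup>2 / of_real (n\<^sup>2)"
    have P2: "P\<^sup>2 = of_real (n\<^sup>2) * (j * \<kappa>)"
      using n jj by (simp add: \<kappa>_def) (simp add: mult.assoc[symmetric])
    have \<kappa>: "9/10 \<le> Re \<kappa>" "\<bar>Im \<kappa>\<bar> \<le> 1/5"
    proof -
      have e: "\<kappa> * of_real (n\<^sup>2) = - j * P\<^sup>2" using n by (simp add: \<kappa>_def)
      have "Re \<kappa> * n\<^sup>2 = 2 * (x * y)"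
        using arg_cong[OF e, of Re] \<sigma>(1,2) by (simp add: j_def Im_power2 x_def y_def mult_ac)
      moreover have "9/10 * n\<^sup>2 \<le> 2 * (x * y)"
      proof -
        have "0 \<le> (10 * y - 9 * x) * (12 * x - 10 * y)" using xy by (intro mult_nonneg_nonneg) auto
        hence "108 * (x * x) + 100 * (y * y) \<le> 210 * (x * y)" by (simp add: algebra_simps)
        thus ?thesis unfolding n2 power2_eq_square[of x] power2_eq_square[of y]
          using zero_le_square[of x] zero_le_square[of y] by argo
      qed
      ultimately have "9/10 * n\<^sup>2 \<le> Re \<kappa> * n\<^sup>2" by simp
      thus "9/10 \<le> Re \<kappa>" using n by simp
      have "\<bar>Im \<kappa> * n\<^sup>2\<bar> = \<bar>x\<^sup>2 - y\<^sup>2\<bar>"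
        using arg_cong[OF e, of Im] \<sigma>(1) by (auto simp: j_def Re_power2 x_def y_def)
      also have "\<dots> \<le> 1/5 * n\<^sup>2"
      proof -
        have "81 * x\<^sup>2 \<le> 100 * y\<^sup>2" "100 * y\<^sup>2 \<le> 144 * x\<^sup>2"
          using power_mono[OF xy(2), of 2] power_mono[OF xy(3), of 2] xy(1) by (auto simp: power_mult_distrib y_def)
        thus ?thesis unfolding n2 using zero_le_power2[of x] by (intro abs_leI) argo+
      qed
      finally have "\<bar>Im \<kappa>\<bar> * n\<^sup>2 \<le> 1/5 * n\<^sup>2" by (simp add: abs_mult)
      thus "\<bar>Im \<kappa>\<bar> \<le> 1/5" using n by simp
    qed
    have Re_\<kappa>: "Re (of_real (n\<^sup>2) * (\<kappa> * (of_real A + of_real B * j))) \<ge> n\<^sup>2 * (9/10 * A - 1/5 * \<bar>B\<bar>)" if "A \<ge> 0" for A B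
    proof -
      have "Re (\<kappa> * (of_real A + of_real B * j)) = A * Re \<kappa> - \<sigma> * (B * Im \<kappa>)"
        by (simp add: j_def algebra_simps)
      moreover have "9/10 * A \<le> A * Re \<kappa>" using mult_left_mono[OF \<kappa>(1) that] by simp
      moreover have "\<sigma> * (B * Im \<kappa>) \<le> \<bar>B\<bar> * (1/5)"
      proof -
        have "\<sigma> * (B * Im \<kappa>) \<le> \<bar>\<sigma> * (B * Im \<kappa>)\<bar>" by simp
        also have "\<dots> = \<bar>B\<bar> * \<bar>Im \<kappa>\<bar>" using \<sigma>(1) by (auto simp: abs_mult)
        also have "\<dots> \<le> \<bar>B\<bar> * (1/5)" using \<kappa>(2) by (intro mult_left_mono) auto
        finally show ?thesis .
      qed
      ultimately have "9/10 * A - 1/5 * \<bar>B\<bar> \<le> Re (\<kappa> * (of_real A + of_real B * j))" by argo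
      hence "n\<^sup>2 * (9/10 * A - 1/5 * \<bar>B\<bar>) \<le> n\<^sup>2 * Re (\<kappa> * (of_real A + of_real B * j))"
        by (rule mult_left_mono) simp
      also have "r * Re z = Re (of_real r * z)" for r z by simp
      finally show ?thesis .
    qed
    define E where "E = exp (- (of_nat N * H P P))"
    define D where "D = u * w2"
    have D2: "D\<^sup>2 = P * (3 - 4 * j)" by (simp add: D_def power_mult_distrib u2 w2sq)
    have D2xy: "Re (D\<^sup>2) = 3 * x + 4 * y" "\<bar>Im (D\<^sup>2)\<bar> = 4 * x - 3 * y"
    proof -
      have "D\<^sup>2 = of_real (3 * x + 4 * y) + of_real (3 * y - 4 * x) * j"
        unfolding D2 Pxy by (simp add: algebra_simps jjz)
      hence "Re (D\<^sup>2) = 3 * x + 4 * y" "Im (D\<^sup>2) = (3 * y - 4 * x) * \<sigma>" by (simp_all add: j_def)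
      thus "Re (D\<^sup>2) = 3 * x + 4 * y" "\<bar>Im (D\<^sup>2)\<bar> = 4 * x - 3 * y"
        using \<sigma>(1) xy by (auto simp: abs_mult)
    qed
    have cD2: "Re (c * D\<^sup>2) > 0" "\<bar>Im (c * D\<^sup>2)\<bar> \<le> 1/4 * Re (c * D\<^sup>2)"
    proof -
      have "n \<le> x + y" unfolding n_def x_def y_def using cmod_le[of P] reg(1) by simp
      have "norm (c * D\<^sup>2 - D\<^sup>2 / 2) = norm (c - 1 / 2) * (n * 5)"
      proof -
        have "c * X - X / 2 = (c - 1 / 2) * X" for X by (simp add: algebra_simps)
        hence "c * D\<^sup>2 - D\<^sup>2 / 2 = (c - 1 / 2) * (P * (3 - 4 * j))" unfolding D2 .
        thus ?thesis by (simp only: norm_mult nw2 n_def)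
      qed
      also have "\<dots> \<le> 1/1000 * (n * 5)"
        using L1_near_half(1)[OF PB] n \<rho> by (intro mult_right_mono) (auto simp: c_def n_def)
      finally have le: "norm (c * D\<^sup>2 - D\<^sup>2 / 2) \<le> 1/200 * (x + y)" using \<open>n \<le> x + y\<close> by argo
      have "Re (c * D\<^sup>2) \<ge> Re (D\<^sup>2 / 2) - 1/200 * (x + y)" using le by (rule Re_ge_of_norm)
      hence R: "Re (c * D\<^sup>2) \<ge> (3 * x + 4 * y) / 2 - 1/200 * (x + y)" using D2xy(1) by simp
      have "\<bar>Im (c * D\<^sup>2) - Im (D\<^sup>2) / 2\<bar> \<le> 1/200 * (x + y)"
        using le abs_Im_le_cmod[of "c * D\<^sup>2 - D\<^sup>2 / 2"] by simp
      hence "\<bar>Im (c * D\<^sup>2)\<bar> \<le> \<bar>Im (D\<^sup>2)\<bar> / 2 + 1/200 * (x + y)" by argo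
      hence I: "\<bar>Im (c * D\<^sup>2)\<bar> \<le> (4 * x - 3 * y) / 2 + 1/200 * (x + y)" by (simp only: D2xy(2))
      show "Re (c * D\<^sup>2) > 0" using R xy by argo
      show "\<bar>Im (c * D\<^sup>2)\<bar> \<le> 1/4 * Re (c * D\<^sup>2)" using R I xy by argo
    qed
    \<comment> \<open>The segment from \<open>- u w1\<close> to \<open>u w1\<close> passes the saddle \<open>0\<close>. Since \<open>w1\<^sup>2 = j / 2\<close>, the phase is
      \<open>n\<^sup>2 \<kappa> (t\<^sup>2 / 12 - j t ^ 4 / 48)\<close> there up to a small error.\<close>
    define I1 where "I1 = (LINT t:{-1..1}|lborel. weight P N (0 + u * w1 * of_real t))"
    define a1 where "a1 = (c - 1 / 2) * P * j / of_real (2 * n\<^sup>2)"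
    have a1: "norm (a1 - \<kappa> / 12) \<le> 1 / 2000"
    proof -
      have "\<kappa> / 12 = - (P / 6) * P * j / of_real (2 * n\<^sup>2)" by (simp add: \<kappa>_def power2_eq_square mult_ac)
      hence "a1 - \<kappa> / 12 = (c - 1 / 2 + P / 6) * P * j / of_real (2 * n\<^sup>2)"
        by (simp add: a1_def algebra_simps add_divide_distrib diff_divide_distrib)
      hence "norm (a1 - \<kappa> / 12) = norm (c - 1 / 2 + P / 6) * n / (2 * n\<^sup>2)"
        by (simp add: norm_mult norm_divide nj n_def norm_power del: of_real_mult of_real_power)
      also have "\<dots> \<le> (n / 1000) * n / (2 * n\<^sup>2)"
        using L1_approx[OF PB] n by (intro divide_right_mono mult_right_mono) (auto simp: c_def n_def)
      also have "\<dots> = 1 / 2000" using n by (simp add: power2_eq_square)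
      finally show ?thesis .
    qed
    have a1s: "Re a1 \<ge> 1/200" "\<bar>Im a1\<bar> \<le> 1/4 * Re a1" "norm a1 \<le> 1"
    proof -
      have R: "\<bar>Re a1 - Re \<kappa> / 12\<bar> \<le> 1/2000" and I: "\<bar>Im a1 - Im \<kappa> / 12\<bar> \<le> 1/2000"
        using a1 abs_Re_le_cmod[of "a1 - \<kappa> / 12"] abs_Im_le_cmod[of "a1 - \<kappa> / 12"] by auto
      have I': "\<bar>Im a1\<bar> \<le> \<bar>Im \<kappa>\<bar> / 12 + 1/2000" using I by argo
      show "Re a1 \<ge> 1/200" using R \<kappa>(1) by argo
      show "\<bar>Im a1\<bar> \<le> 1/4 * Re a1" using R I' \<kappa> by argo
      have "norm \<kappa> = 1" using n nj by (simp add: \<kappa>_def norm_mult norm_divide norm_power n_def)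
      hence "norm (\<kappa> / 12) = 1/12" by (simp add: norm_divide)
      moreover have "norm a1 \<le> norm (a1 - \<kappa> / 12) + norm (\<kappa> / 12)"
        by (metis diff_add_cancel norm_triangle_ineq)
      ultimately show "norm a1 \<le> 1" using a1 by argo
    qed
    have main1: "norm (of_real (sqrt \<Lambda>) * I1 - of_real (sqrt pi) / csqrt a1) \<le> K / \<Lambda>"
      unfolding I1_def
    proof (rule laplace_boundD[OF K(2) \<Lambda>, where e = 0 and g = "\<lambda>t. H P ((0 + u * w1 * of_real t)\<^sup>2) / of_real (n\<^sup>2)"])
      have z2: "(0 + u * w1 * of_real t)\<^sup>2 = P * j / 2 * of_real (t\<^sup>2)" for t
        by (simp add: power_mult_distrib u2 w1sq)
      have nz2: "norm ((0 + u * w1 * of_real t)\<^sup>2) = n * t\<^sup>2 / 2" for t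
        unfolding z2 by (simp add: norm_mult norm_divide nj n_def norm_power)
      have zB: "(0 + u * w1 * of_real t)\<^sup>2 \<in> ball 0 \<rho>" if "\<bar>t\<bar> \<le> 1" for t
      proof -
        have "t\<^sup>2 \<le> 1" using that by (simp add: abs_square_le_1)
        hence "n * t\<^sup>2 \<le> n * 1" using n by (intro mult_left_mono) auto
        hence "norm ((0 + u * w1 * of_real t)\<^sup>2) < \<rho>" unfolding nz2 using n \<rho> by argo
        thus ?thesis by (simp only: mem_ball_0)
      qed
      show "norm (weight P N (0 + u * w1 * of_real t)) \<le> exp (- (\<Lambda> * (1/200) * t\<^sup>2))" if t: "t \<in> {-1..1}" for t
      proof -
        have t1: "\<bar>t\<bar> \<le> 1" using t by auto
        define p where "p = (0 + u * w1 * of_real t)\<^sup>2"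
        have pB: "p \<in> ball 0 \<rho>" unfolding p_def by (rule zB[OF t1])
        have np: "norm p = n * t\<^sup>2 / 2" unfolding p_def by (rule nz2)
        have "Re (H P p) \<ge> Re (p\<^sup>2 / 12 - P * p / 6) - (n * norm p + (norm p)\<^sup>2) / 1000"
          unfolding n_def by (rule Re_ge_of_norm[OF H_approx[OF pB PB]])
        moreover have "p\<^sup>2 / 12 - P * p / 6 = of_real (n\<^sup>2) * (\<kappa> * (of_real (t\<^sup>2 / 12) + of_real (- (t ^ 4) / 48) * j))"
        proof -
          have "p\<^sup>2 = P\<^sup>2 * j\<^sup>2 * of_real (t ^ 4) / 4" unfolding p_def z2 by (simp add: power_mult_distrib power_divide power_mult[symmetric])
          moreover have "P * p = P\<^sup>2 * j * of_real (t\<^sup>2) / 2" unfolding p_def z2 by (simp add: power2_eq_square)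
          moreover have "j * (j * z) = - z" for z using jj(1) by (simp add: mult.assoc[symmetric])
          ultimately show ?thesis unfolding P2 jj(2) by (simp add: algebra_simps)
        qed
        moreover have "Re (of_real (n\<^sup>2) * (\<kappa> * (of_real (t\<^sup>2 / 12) + of_real (- (t ^ 4) / 48) * j))) \<ge> n\<^sup>2 * (9/10 * (t\<^sup>2 / 12) - 1/5 * \<bar>- (t ^ 4) / 48\<bar>)"
          by (rule Re_\<kappa>) simp
        ultimately have "Re (H P p) \<ge> n\<^sup>2 * (9/10 * (t\<^sup>2 / 12) - 1/5 * \<bar>- (t ^ 4) / 48\<bar>) - (n * norm p + (norm p)\<^sup>2) / 1000"
          by (simp only:)
        also have "\<bar>- (t ^ 4) / 48\<bar> = t ^ 4 / 48" by simp
        also have "(n * norm p + (norm p)\<^sup>2) / 1000 = n\<^sup>2 * (t\<^sup>2 / 2000 + t ^ 4 / 4000)"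
          unfolding np by (simp add: field_simps power2_eq_square power4_eq_xxxx)
        finally have "Re (H P p) \<ge> n\<^sup>2 * (9/10 * (t\<^sup>2 / 12) - 1/5 * (t ^ 4 / 48) - (t\<^sup>2 / 2000 + t ^ 4 / 4000))"
          by (simp add: algebra_simps)
        moreover have "n\<^sup>2 * (t\<^sup>2 / 200) \<le> n\<^sup>2 * (9/10 * (t\<^sup>2 / 12) - 1/5 * (t ^ 4 / 48) - (t\<^sup>2 / 2000 + t ^ 4 / 4000))"
        proof (rule mult_left_mono)
          have "t ^ 4 = t\<^sup>2 * t\<^sup>2" by (simp add: power2_eq_square power4_eq_xxxx)
          also have "\<dots> \<le> t\<^sup>2 * 1" using t1 by (intro mult_left_mono) (auto simp: abs_square_le_1)
          finally show "t\<^sup>2 / 200 \<le> 9/10 * (t\<^sup>2 / 12) - 1/5 * (t ^ 4 / 48) - (t\<^sup>2 / 2000 + t ^ 4 / 4000)"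
            using zero_le_power2[of t] by argo
        qed simp
        ultimately have "Re (H P ((0 + u * w1 * of_real t)\<^sup>2)) \<ge> n\<^sup>2 * (t\<^sup>2 / 200)" unfolding p_def by argo
        from norm_weight_near[OF zB[OF t1] this, of N] show ?thesis
          by (simp add: \<Lambda>_def mult_ac)
      qed
      fix t :: real assume t: "\<bar>t\<bar> \<le> 1/2"
      hence t1: "\<bar>t\<bar> \<le> 1" by simp
      show "weight P N (0 + u * w1 * of_real t) = exp (- (of_real \<Lambda> * (H P ((0 + u * w1 * of_real t)\<^sup>2) / of_real (n\<^sup>2))))"
        unfolding weight_eq_exp[OF zB[OF t1]] using n by (simp add: \<Lambda>_def)
      define p where "p = (0 + u * w1 * of_real t)\<^sup>2"
      have pB: "p \<in> ball 0 \<rho>" unfolding p_def by (rule zB[OF t1])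
      have np: "norm p = n * t\<^sup>2 / 2" unfolding p_def by (rule nz2)
      have "a1 * of_real t ^ 2 = (c - 1 / 2) * p / of_real (n\<^sup>2)"
        unfolding p_def z2 a1_def by (simp add: field_simps)
      hence "H P p / of_real (n\<^sup>2) - a1 * of_real t ^ 2 - 0 * of_real t ^ 3 = - (L p - p / 2) / of_real (n\<^sup>2)"
        by (simp add: H_def c_def algebra_simps diff_divide_distrib add_divide_distrib)
      also have "norm \<dots> = norm (L p - p / 2) / n\<^sup>2"
        by (simp only: norm_divide norm_minus_cancel norm_of_real abs_power2)
      also have "\<dots> \<le> ((norm p)\<^sup>2 / 10) / n\<^sup>2"
        by (intro divide_right_mono L_quadratic pB) simp
      also have "\<dots> = t ^ 4 / 40" unfolding np using n by (simp add: power_mult_distrib power_divide power_mult[symmetric])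
      also have "\<dots> \<le> (89 + 1400 * M) * t ^ 4"
      proof -
        have "1/40 * t ^ 4 \<le> (89 + 1400 * M) * t ^ 4" using M by (intro mult_right_mono) auto
        thus ?thesis by simp
      qed
      finally show "norm (H P ((0 + u * w1 * of_real t)\<^sup>2) / of_real (n\<^sup>2) - a1 * of_real t ^ 2 - 0 * of_real t ^ 3) \<le> (89 + 1400 * M) * t ^ 4"
        by (simp only: p_def)
    qed (use a1s(1) M89 in \<open>auto intro!: continuous_weight continuous_intros\<close>)
    \<comment> \<open>The segment from \<open>u w1\<close> to \<open>u w2\<close> passes the saddle \<open>u\<close> at \<open>t = 0\<close>, in the direction \<open>v\<close>. With
      \<open>T = 1 + t\<close>, the phase minus its value at \<open>u\<close> is \<open>n\<^sup>2 \<kappa> (2 T + (1 - T\<^sup>2) j) t\<^sup>2 / 3\<close> up to a small error.\<close>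
    define \<Phi> where "\<Phi> t = weight P N (u + u * v * of_real t) * exp (of_nat N * H P P)" for t :: real
    define I2 where "I2 = (LINT t:{-(1/2)..1}|lborel. \<Phi> t)"
    define a2 where "a2 = saddle_coeff P v"
    have nv: "norm v \<le> 2" by (rule power2_le_imp_le) (simp_all add: nv2)
    obtain e where e: "norm e \<le> 89 + 1400 * M"
      "\<And>t. \<bar>t\<bar> \<le> 1/2 \<Longrightarrow> norm ((H P (P * (1 + v * of_real t)\<^sup>2) - H P P) / of_real ((norm P)\<^sup>2)
         - saddle_coeff P v * of_real t ^ 2 - e * of_real t ^ 3) \<le> (89 + 1400 * M) * t ^ 4"
      using H_saddle_expansion[OF P nv] by blast
    have a2: "norm (a2 - 2 / 3 * \<kappa>) \<le> 1 / 250"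
    proof -
      have "(P / of_real (norm P))\<^sup>2 * v\<^sup>2 / 3 = 2 / 3 * \<kappa>"
        by (simp add: vsq \<kappa>_def power_divide n_def mult_ac)
      thus ?thesis using saddle_coeff_approx[OF PB P(1), of v] by (simp add: a2_def nv2)
    qed
    have a2s: "Re a2 \<ge> 1/200" "Re a2 > 0" "\<bar>Im a2\<bar> \<le> 1/4 * Re a2" "norm a2 \<le> 1"
    proof -
      have R: "\<bar>Re a2 - 2 / 3 * Re \<kappa>\<bar> \<le> 1/250" and I: "\<bar>Im a2 - 2 / 3 * Im \<kappa>\<bar> \<le> 1/250"
        using a2 abs_Re_le_cmod[of "a2 - 2 / 3 * \<kappa>"] abs_Im_le_cmod[of "a2 - 2 / 3 * \<kappa>"] by auto
      have I': "\<bar>Im a2\<bar> \<le> 2 / 3 * \<bar>Im \<kappa>\<bar> + 1/250" using I by argo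
      show "Re a2 \<ge> 1/200" "Re a2 > 0" using R \<kappa>(1) by argo+
      show "\<bar>Im a2\<bar> \<le> 1/4 * Re a2" using R I' \<kappa> by argo
      show "norm a2 \<le> 1" using norm_saddle_coeff[OF PB P(1), of v] by (simp add: a2_def nv2)
    qed
    have main2: "norm (of_real (sqrt \<Lambda>) * I2 - of_real (sqrt pi) / csqrt a2) \<le> K / \<Lambda>"
      unfolding I2_def
    proof (rule laplace_boundD[OF K(2) \<Lambda> _ _ _ _ a2s(1) e(1), where g = "\<lambda>t. (H P (P * (1 + v * of_real t)\<^sup>2) - H P P) / of_real (n\<^sup>2)"])
      have z2: "(u + u * v * of_real t)\<^sup>2 = P * (1 + v * of_real t)\<^sup>2" for t
      proof -
        have "u + u * v * of_real t = u * (1 + v * of_real t)" by (simp add: algebra_simps)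
        thus ?thesis by (simp only: power_mult_distrib u2)
      qed
      have zB: "P * (1 + v * of_real t)\<^sup>2 \<in> ball 0 \<rho>" if "\<bar>t\<bar> \<le> 1" for t
      proof -
        have "norm (v * of_real t) \<le> 2 * 1" unfolding norm_mult using nv that by (intro mult_mono) auto
        hence "norm (1 + v * of_real t) \<le> 3" by (intro norm_triangle_le) simp
        hence "n * norm (1 + v * of_real t) ^ 2 \<le> n * 3 ^ 2" using n by (intro mult_left_mono power_mono) auto
        also have "n * 3 ^ 2 < \<rho>" using n \<rho> by simp
        finally show ?thesis by (simp only: mem_ball_0 norm_mult norm_power n_def)
      qed
      have \<Phi>_eq: "\<Phi> t = exp (- (of_nat N * (H P (P * (1 + v * of_real t)\<^sup>2) - H P P)))" if "\<bar>t\<bar> \<le> 1" for t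
        using weight_eq_exp[of "u + u * v * of_real t" P N] zB[OF that] unfolding z2 \<Phi>_def
        by (simp add: mult_exp_exp algebra_simps)
      show "closed {-(1/2)..1::real}" "{-(1/2)..1/2} \<subseteq> {-(1/2)..1::real}" by auto
      show "continuous_on {-(1/2)..1} \<Phi>" unfolding \<Phi>_def by (intro continuous_intros continuous_weight)
      show "norm (\<Phi> t) \<le> exp (- (\<Lambda> * (1/200) * t\<^sup>2))" if t: "t \<in> {-(1/2)..1}" for t
      proof -
        have t1: "\<bar>t\<bar> \<le> 1" using t by auto
        define p q T where "p = P * (1 + v * of_real t)\<^sup>2" and "q = (1 + v * of_real t)\<^sup>2 - 1" and "T = 1 + t"
        have T: "1/2 \<le> T" "T \<le> 2" using t by (auto simp: T_def)
        have pP: "p - P = P * q" by (simp add: p_def q_def algebra_simps)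
        have q: "q = of_real (2 * t) * (1 - of_real T * j)"
        proof -
          have "q = 2 * v * of_real t + v\<^sup>2 * of_real t ^ 2" by (simp add: q_def power2_eq_square algebra_simps)
          thus ?thesis unfolding vsq by (simp add: v_def T_def power2_eq_square algebra_simps)
        qed
        have q2: "q\<^sup>2 = of_real (4 * t\<^sup>2) * (of_real (1 - T\<^sup>2) - of_real (2 * T) * j)"
        proof -
          have "(1 - of_real T * j)\<^sup>2 = of_real (1 - T\<^sup>2) - of_real (2 * T) * j"
            using jj(2) by (simp add: power2_diff power_mult_distrib algebra_simps)
          thus ?thesis unfolding q by (simp add: power_mult_distrib)
        qed
        have nq: "(norm q)\<^sup>2 \<le> 20 * t\<^sup>2"
        proof -
          have "(norm (1 - of_real T * j))\<^sup>2 = 1 + T\<^sup>2"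
            using \<sigma>(1) by (auto simp: cmod_power2 j_def)
          also have "\<dots> \<le> 5" using power_mono[of T 2 2] T by simp
          finally have "4 * t\<^sup>2 * (norm (1 - of_real T * j))\<^sup>2 \<le> 4 * t\<^sup>2 * 5" by (intro mult_left_mono) auto
          thus ?thesis unfolding q norm_mult power_mult_distrib by (simp add: power_mult_distrib)
        qed
        have "Re (H P p - H P P) \<ge> Re ((p - P)\<^sup>2 / 12) - (norm (p - P))\<^sup>2 / 1000"
          unfolding p_def by (rule Re_ge_of_norm[OF H_diff_approx[OF zB[OF t1] PB]])
        moreover have "(p - P)\<^sup>2 / 12 = of_real (n\<^sup>2) * (\<kappa> * (of_real (2 * T * t\<^sup>2 / 3) + of_real ((1 - T\<^sup>2) * t\<^sup>2 / 3) * j))"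
          unfolding pP power_mult_distrib q2 P2 by (simp add: field_simps jjz)
        moreover have "Re (of_real (n\<^sup>2) * (\<kappa> * (of_real (2 * T * t\<^sup>2 / 3) + of_real ((1 - T\<^sup>2) * t\<^sup>2 / 3) * j)))
            \<ge> n\<^sup>2 * (9/10 * (2 * T * t\<^sup>2 / 3) - 1/5 * \<bar>(1 - T\<^sup>2) * t\<^sup>2 / 3\<bar>)"
          using T by (intro Re_\<kappa>) auto
        ultimately have "Re (H P p - H P P) \<ge> n\<^sup>2 * (9/10 * (2 * T * t\<^sup>2 / 3) - 1/5 * \<bar>(1 - T\<^sup>2) * t\<^sup>2 / 3\<bar>) - (norm (p - P))\<^sup>2 / 1000"
          by (simp only:)
        moreover have "(norm (p - P))\<^sup>2 / 1000 \<le> n\<^sup>2 * (t\<^sup>2 / 50)"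
          using mult_left_mono[OF nq, of "n\<^sup>2"] unfolding pP norm_mult power_mult_distrib n_def by simp
        moreover have "n\<^sup>2 * (t\<^sup>2 * (7/30)) \<le> n\<^sup>2 * (9/10 * (2 * T * t\<^sup>2 / 3) - 1/5 * \<bar>(1 - T\<^sup>2) * t\<^sup>2 / 3\<bar>)"
        proof (rule mult_left_mono)
          have "7/10 \<le> 9/10 * (2 * T) - 1/5 * \<bar>1 - T\<^sup>2\<bar>"
          proof (cases "T \<le> 1")
            case True
            hence "T\<^sup>2 \<le> 1" "0 \<le> T\<^sup>2" using T by (auto simp: power_le_one)
            moreover from this have "\<bar>1 - T\<^sup>2\<bar> = 1 - T\<^sup>2" by simp
            ultimately show ?thesis using T by argo
          next
            case False
            have "1 \<le> T\<^sup>2" "T\<^sup>2 \<le> 4" using False power_mono[of T 2 2] T by (auto intro: one_le_power)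
            moreover from this have "\<bar>1 - T\<^sup>2\<bar> = T\<^sup>2 - 1" by simp
            ultimately show ?thesis using False by argo
          qed
          moreover have ab: "\<bar>(1 - T\<^sup>2) * t\<^sup>2 / 3\<bar> = \<bar>1 - T\<^sup>2\<bar> * (t\<^sup>2 / 3)" by (simp add: abs_mult)
          ultimately show "t\<^sup>2 * (7/30) \<le> 9/10 * (2 * T * t\<^sup>2 / 3) - 1/5 * \<bar>(1 - T\<^sup>2) * t\<^sup>2 / 3\<bar>"
            unfolding ab using mult_left_mono[of "7/10" "9/10 * (2 * T) - 1/5 * \<bar>1 - T\<^sup>2\<bar>" "t\<^sup>2 / 3"]
            by (simp add: field_simps)
        qed simp
        moreover have "n\<^sup>2 * (t\<^sup>2 * (7/30)) - n\<^sup>2 * (t\<^sup>2 / 50) \<ge> n\<^sup>2 * (t\<^sup>2 / 200)"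
          using zero_le_mult_iff[of "n\<^sup>2" "t\<^sup>2"] by (simp add: field_simps)
        ultimately have "Re (H P p - H P P) \<ge> n\<^sup>2 * (t\<^sup>2 / 200)" by argo
        hence "real N * (n\<^sup>2 * (t\<^sup>2 / 200)) \<le> real N * Re (H P p - H P P)" by (rule mult_left_mono) simp
        thus ?thesis unfolding \<Phi>_eq[OF t1] p_def by (simp add: \<Lambda>_def mult_ac)
      qed
      fix t :: real assume t: "\<bar>t\<bar> \<le> 1/2"
      show "\<Phi> t = exp (- (of_real \<Lambda> * ((H P (P * (1 + v * of_real t)\<^sup>2) - H P P) / of_real (n\<^sup>2))))"
        using \<Phi>_eq[of t] t n by (simp add: \<Lambda>_def)
      show "norm ((H P (P * (1 + v * of_real t)\<^sup>2) - H P P) / of_real (n\<^sup>2) - a2 * of_real t ^ 2 - e * of_real t ^ 3) \<le> (89 + 1400 * M) * t ^ 4"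
        using e(2)[OF t] by (simp only: a2_def n_def)
    qed
    \<comment> \<open>On the rays from \<open>\<plusminus>u w2\<close> to infinity the weight is small even against the term of the saddle \<open>0\<close>.\<close>
    define T where "T = (\<integral>s. indicator (- {-1..1}) s *\<^sub>R weight P N (D * of_real s) \<partial>lborel)"
    have wi: "integrable lborel (\<lambda>s. weight P N (D * of_real s))"
      using partition_fun_weight(1)[OF N] cD2(1) by (simp add: c_def)
    have mainT: "norm (of_real (sqrt \<Lambda>) * T) \<le> KT / \<Lambda>"
    proof -
      have "sqrt \<Lambda> * norm T \<le> KT / \<Lambda>" unfolding T_def
      proof (rule KT(2)[rule_format, OF \<Lambda>])
        show "integrable lborel (\<lambda>s. indicator (- {-1..1}) s *\<^sub>R weight P N (D * of_real s))"
          by (rule integrable_mult_indicator[OF _ wi]) simp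
        fix s :: real
        show "norm (indicator (- {-1..1}) s *\<^sub>R weight P N (D * of_real s)) \<le> s\<^sup>2 * exp (- (\<Lambda> * (1/200) * s\<^sup>2))"
        proof (cases "s \<in> {-1..1}")
          case False
          have s2: "1 \<le> s\<^sup>2"
          proof -
            have "1 \<le> \<bar>s\<bar>" using False by auto
            from power_mono[OF this, of 2] show ?thesis by simp
          qed
          define p where "p = (D * of_real s)\<^sup>2"
          have p: "p = P * (3 - 4 * j) * of_real (s\<^sup>2)" by (simp add: p_def power_mult_distrib D2)
          have np: "norm p = n * 5 * s\<^sup>2" unfolding p norm_mult nw2 n_def by (subst norm_of_real) simp
          have "norm (weight P N (D * of_real s)) \<le> exp (- (real N * (n\<^sup>2 * (s\<^sup>2 / 200))))"
          proof (cases "p \<in> ball 0 \<rho>")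
            case True
            show ?thesis
            proof (rule norm_weight_near)
              show "(D * of_real s)\<^sup>2 \<in> ball 0 \<rho>" using True by (simp only: p_def)
              have "Re (H P p) \<ge> Re (p\<^sup>2 / 12 - P * p / 6) - (n * norm p + (norm p)\<^sup>2) / 1000"
                unfolding n_def by (rule Re_ge_of_norm[OF H_approx[OF True PB]])
              moreover have "p\<^sup>2 / 12 - P * p / 6 = of_real (n\<^sup>2) * (\<kappa> * (of_real (2 * s ^ 4 - 2 * s\<^sup>2 / 3) + of_real (- (7 * s ^ 4 / 12 + s\<^sup>2 / 2)) * j))"
              proof -
                have "p\<^sup>2 = P\<^sup>2 * (3 - 4 * j)\<^sup>2 * of_real (s ^ 4)"
                  unfolding p by (simp add: power_mult_distrib power_mult[symmetric])
                also have "(3 - 4 * j)\<^sup>2 = - 7 - 24 * j" using jj(1) by (simp add: power2_eq_square algebra_simps jjz)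
                finally have A: "p\<^sup>2 = P\<^sup>2 * (- 7 - 24 * j) * of_real (s ^ 4)" .
                have B: "P * p = P\<^sup>2 * (3 - 4 * j) * of_real (s\<^sup>2)" unfolding p by (simp add: power2_eq_square)
                show ?thesis unfolding A B P2 by (simp add: field_simps jjz)
              qed
              moreover have "Re (of_real (n\<^sup>2) * (\<kappa> * (of_real (2 * s ^ 4 - 2 * s\<^sup>2 / 3) + of_real (- (7 * s ^ 4 / 12 + s\<^sup>2 / 2)) * j)))
                  \<ge> n\<^sup>2 * (9/10 * (2 * s ^ 4 - 2 * s\<^sup>2 / 3) - 1/5 * \<bar>- (7 * s ^ 4 / 12 + s\<^sup>2 / 2)\<bar>)"
              proof (rule Re_\<kappa>)
                have "s\<^sup>2 * 1 \<le> s\<^sup>2 * s\<^sup>2" using s2 by (intro mult_left_mono) auto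
                hence "s\<^sup>2 \<le> s ^ 4" by (simp add: power2_eq_square power4_eq_xxxx)
                thus "0 \<le> 2 * s ^ 4 - 2 * s\<^sup>2 / 3" using s2 by argo
              qed
              ultimately have "Re (H P p) \<ge> n\<^sup>2 * (9/10 * (2 * s ^ 4 - 2 * s\<^sup>2 / 3) - 1/5 * \<bar>- (7 * s ^ 4 / 12 + s\<^sup>2 / 2)\<bar>)
                  - (n * norm p + (norm p)\<^sup>2) / 1000"
                by (simp only:)
              also have "\<bar>- (7 * s ^ 4 / 12 + s\<^sup>2 / 2)\<bar> = 7 * s ^ 4 / 12 + s\<^sup>2 / 2"
                unfolding abs_minus_cancel by (intro abs_of_nonneg add_nonneg_nonneg) auto
              also have "(n * norm p + (norm p)\<^sup>2) / 1000 = n\<^sup>2 * (s\<^sup>2 / 200 + s ^ 4 / 40)"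
                unfolding np by (simp add: field_simps power2_eq_square power4_eq_xxxx)
              finally have "Re (H P p) \<ge> n\<^sup>2 * (9/10 * (2 * s ^ 4 - 2 * s\<^sup>2 / 3) - 1/5 * (7 * s ^ 4 / 12 + s\<^sup>2 / 2) - (s\<^sup>2 / 200 + s ^ 4 / 40))"
                by (simp add: algebra_simps)
              moreover have "n\<^sup>2 * (s\<^sup>2 / 200) \<le> n\<^sup>2 * (9/10 * (2 * s ^ 4 - 2 * s\<^sup>2 / 3) - 1/5 * (7 * s ^ 4 / 12 + s\<^sup>2 / 2) - (s\<^sup>2 / 200 + s ^ 4 / 40))"
              proof (rule mult_left_mono)
                have "s\<^sup>2 * 1 \<le> s\<^sup>2 * s\<^sup>2" using s2 by (intro mult_left_mono) auto
                hence "s\<^sup>2 \<le> s ^ 4" by (simp add: power2_eq_square power4_eq_xxxx)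
                thus "s\<^sup>2 / 200 \<le> 9/10 * (2 * s ^ 4 - 2 * s\<^sup>2 / 3) - 1/5 * (7 * s ^ 4 / 12 + s\<^sup>2 / 2) - (s\<^sup>2 / 200 + s ^ 4 / 40)"
                  using s2 by argo
              qed simp
              ultimately show "Re (H P ((D * of_real s)\<^sup>2)) \<ge> n\<^sup>2 * (s\<^sup>2 / 200)" unfolding p_def by argo
            qed
          next
            case False
            have "norm (weight P N (D * of_real s)) \<le> exp (- (real N * (\<rho> / 1600 * norm ((D * of_real s)\<^sup>2))))"
            proof (rule norm_weight_far[OF P(2)])
              show "\<rho> \<le> norm ((D * of_real s)\<^sup>2)" using False by (simp only: p_def mem_ball_0 not_less)
              have "25 * (Im D)\<^sup>2 \<le> 4 * (Re D)\<^sup>2"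
              proof (rule ccontr)
                assume "\<not> ?thesis"
                hence "25 * (Im D)\<^sup>2 > 4 * (Re D)\<^sup>2" by simp
                moreover have "0 < Re (D\<^sup>2)" unfolding D2xy using xy by argo
                ultimately have "9 * Re (D\<^sup>2) < 10 * \<bar>Im (D\<^sup>2)\<bar>" by (rule power2_outside_sector)
                thus False unfolding D2xy using xy by argo
              qed
              hence "25 * (Im D)\<^sup>2 * s\<^sup>2 \<le> 4 * (Re D)\<^sup>2 * s\<^sup>2" by (rule mult_right_mono) simp
              moreover have "Re (D * of_real s) = Re D * s" "Im (D * of_real s) = Im D * s" by simp_all
              ultimately show "25 * (Im (D * of_real s))\<^sup>2 \<le> 4 * (Re (D * of_real s))\<^sup>2"
                by (simp only: power_mult_distrib mult.assoc)
            qed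
            also have "\<dots> \<le> exp (- (real N * (n\<^sup>2 * (s\<^sup>2 / 200))))"
            proof -
              have "n / 200 * (n * s\<^sup>2) \<le> \<rho> / 320 * (n * s\<^sup>2)" using n \<rho> by (intro mult_right_mono) auto
              hence "n\<^sup>2 * (s\<^sup>2 / 200) \<le> \<rho> / 1600 * norm ((D * of_real s)\<^sup>2)"
                unfolding p_def[symmetric] np by (simp add: power2_eq_square mult_ac)
              hence "real N * (n\<^sup>2 * (s\<^sup>2 / 200)) \<le> real N * (\<rho> / 1600 * norm ((D * of_real s)\<^sup>2))"
                by (rule mult_left_mono) simp
              thus ?thesis by (simp only: exp_le_cancel_iff neg_le_iff_le)
            qed
            finally show ?thesis .
          qed
          also have "\<dots> = 1 * exp (- (\<Lambda> * (1/200) * s\<^sup>2))" by (simp add: \<Lambda>_def)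
          also have "\<dots> \<le> s\<^sup>2 * exp (- (\<Lambda> * (1/200) * s\<^sup>2))" using s2 by (rule mult_right_mono) simp
          finally show ?thesis using False by simp
        qed simp
      qed
      thus ?thesis using \<Lambda> by (simp add: norm_mult)
    qed
    \<comment> \<open>The integrand is entire and even, so the integral from \<open>- D\<close> to \<open>D\<close> is twice the value at
      \<open>D = u w2\<close> of an odd primitive, and that value is collected along the broken line.\<close>
    have path: "(\<integral>s. weight P N (D * of_real s) \<partial>lborel) = w1 / w2 * I1 + 2 * (v / w2) * (E * I2) + T"
    proof -
      obtain F where F: "\<And>z. F (- z) = - F z"
        "\<And>z v x y. x \<le> y \<Longrightarrow> v * (LINT t:{x..y}|lborel. weight P N (z + v * of_real t)) = F (z + v * of_real y) - F (z + v * of_real x)"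
        by (rule weight_odd_primitive[of P N]) (rule that)
      have 1: "u * w1 * I1 = 2 * F (u * w1)"
        using F(2)[of "-1" 1 "u * w1" 0] F(1)[of "u * w1"] by (simp add: I1_def)
      have 2: "D * (LINT t:{-1..1}|lborel. weight P N (0 + D * of_real t)) = 2 * F D"
        using F(2)[of "-1" 1 D 0] F(1)[of D] by simp
      have 3: "u * v * (E * I2) = F D - F (u * w1)"
      proof -
        have "E * I2 = (LINT t:{-(1/2)..1}|lborel. weight P N (u + u * v * of_real t))"
          by (simp add: I2_def \<Phi>_def E_def exp_minus set_lebesgue_integral_def)
        moreover have "u + u * v * of_real 1 = D" by (simp add: D_def v_def w2_def algebra_simps)
        moreover have "u + u * v * of_real (- (1/2)) = u * w1" by (simp add: v_def w1_def field_simps)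
        ultimately show ?thesis using F(2)[of "-(1/2)" 1 "u * v" u] by simp
      qed
      have "D * (LINT t:{-1..1}|lborel. weight P N (D * of_real t)) = u * w1 * I1 + 2 * (u * v * (E * I2))"
        using 1 2 3 by simp
      hence "(LINT t:{-1..1}|lborel. weight P N (D * of_real t)) = w1 / w2 * I1 + 2 * (v / w2) * (E * I2)"
      proof -
        have "X = w1 / w2 * I1 + 2 * (v / w2) * (E * I2)" if "u * w2 * X = u * w1 * I1 + 2 * (u * v * (E * I2))" for X
        proof -
          have "u * (w2 * X) = u * (w1 * I1 + 2 * (v * (E * I2)))" using that by (simp add: algebra_simps)
          hence "w2 * X = w1 * I1 + 2 * (v * (E * I2))" using u0 by simp
          thus ?thesis using w20 by (simp add: field_simps)
        qed
        moreover assume "D * (LINT t:{-1..1}|lborel. weight P N (D * of_real t)) = u * w1 * I1 + 2 * (u * v * (E * I2))"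
        ultimately show ?thesis unfolding D_def by blast
      qed
      moreover have "(\<integral>s. weight P N (D * of_real s) \<partial>lborel) = (LINT t:{-1..1}|lborel. weight P N (D * of_real t)) + T"
      proof -
        have "(\<integral>s. weight P N (D * of_real s) \<partial>lborel) = (\<integral>s. indicator {-1..1} s *\<^sub>R weight P N (D * of_real s)
            + indicator (- {-1..1}) s *\<^sub>R weight P N (D * of_real s) \<partial>lborel)"
          by (rule Bochner_Integration.integral_cong) (auto simp: indicator_def)
        also have "\<dots> = (\<integral>s. indicator {-1..1} s *\<^sub>R weight P N (D * of_real s) \<partial>lborel) + T"
          unfolding T_def by (intro Bochner_Integration.integral_add integrable_mult_indicator wi) auto
        finally show ?thesis by (simp only: set_lebesgue_integral_def)
      qed
      ultimately show ?thesis by simp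
    qed
    \<comment> \<open>In \<open>A\<close> and \<open>B\<close> the square roots agree up to sign because their squares do. The arguments of
      \<open>csqrt a1\<close>, \<open>csqrt a2\<close> and \<open>q\<close> are so small that the constant factors \<open>1 - 3 j\<close> and \<open>3 - j\<close> decide the
      sign of the real part.\<close>
    define q where "q = csqrt (c * D\<^sup>2)"
    have a10: "csqrt a1 \<noteq> 0" and a20: "csqrt a2 \<noteq> 0" using a1s(1) a2s(1) by auto
    have cnz: "c \<noteq> 0" using cD2(1) by auto
    have pos1: "Re a1 > 0" using a1s(1) by simp
    have A: "1 / csqrt (1 - 1 / (2 * c)) = q / of_real n * (w1 / w2) / csqrt a1"
    proof -
      have "csqrt (1 - 1 / (2 * c)) = (1 - 3 * j) * (of_real n * (csqrt a1 / q))"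
      proof (rule csqrt_unique)
        have j3: "(1 - 3 * j)\<^sup>2 * j = 2 * (3 - 4 * j)" using \<sigma>(1) by (auto simp: j_def complex_eq_iff power2_eq_square)
        have "((1 - 3 * j) * (of_real n * (csqrt a1 / q)))\<^sup>2 = (1 - 3 * j)\<^sup>2 * (of_real (n\<^sup>2) * a1) / (c * D\<^sup>2)"
          by (simp add: power_mult_distrib power_divide q_def)
        also have "of_real (n\<^sup>2) * a1 = (c - 1 / 2) * P * j / 2" using n by (simp add: a1_def)
        also have "(1 - 3 * j)\<^sup>2 * ((c - 1 / 2) * P * j / 2) = (c - 1 / 2) * P * ((1 - 3 * j)\<^sup>2 * j) / 2" by simp
        also have "\<dots> = (c - 1 / 2) * D\<^sup>2" unfolding j3 D2 by simp
        also have "(c - 1 / 2) * D\<^sup>2 / (c * D\<^sup>2) = (c - 1 / 2) / c" using u0 w20 by (simp add: D_def)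
        also have "\<dots> = 1 - 1 / (2 * c)" using cnz by (simp add: field_simps)
        finally show "((1 - 3 * j) * (of_real n * (csqrt a1 / q)))\<^sup>2 = 1 - 1 / (2 * c)" .
        define r where "r = csqrt a1 / q"
        have r: "0 < Re r" "3 * \<bar>Im r\<bar> < Re r"
          unfolding r_def q_def by (rule csqrt_quotient_sector[OF pos1 a1s(2) cD2])+
        have "3 * (\<sigma> * Im r) \<ge> - (3 * \<bar>Im r\<bar>)" using \<sigma>(1) by auto
        hence "Re r + 3 * (\<sigma> * Im r) > 0" using r(2) by argo
        hence "n * (Re r + 3 * (\<sigma> * Im r)) > 0" using n by simp
        moreover have "Re ((1 - 3 * j) * (of_real n * r)) = n * (Re r + 3 * (\<sigma> * Im r))"
          by (simp add: j_def algebra_simps)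
        ultimately have "0 < Re ((1 - 3 * j) * (of_real n * r))" by (simp only:)
        thus "0 < Re ((1 - 3 * j) * (of_real n * (csqrt a1 / q))) \<or>
          Re ((1 - 3 * j) * (of_real n * (csqrt a1 / q))) = 0 \<and> 0 \<le> Im ((1 - 3 * j) * (of_real n * (csqrt a1 / q)))"
          by (intro disjI1) (simp only: r_def)
      qed
      moreover have "w1 / w2 = 1 / (1 - 3 * j)" unfolding w12[symmetric] using w10 by simp
      ultimately show ?thesis using n by simp
    qed
    have B: "saddle_term P N = 2 * (q / of_real n * (v / w2) / csqrt a2) * E"
    proof -
      have vw: "v / w2 = (3 - j) / 5" using vw2 w20 by (simp add: field_simps)
      have "csqrt (- L1 P / (2 * P * L2 P)) = q / of_real n * (v / w2) / csqrt a2"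
      proof (rule csqrt_unique)
        have "(q / of_real n * (v / w2) / csqrt a2)\<^sup>2 = c * D\<^sup>2 * (v\<^sup>2 / w2\<^sup>2) / (of_real (n\<^sup>2) * a2)"
          by (simp add: power_mult_distrib power_divide q_def)
        also have "of_real (n\<^sup>2) * a2 = - 2 * L2 P * P\<^sup>2 * v\<^sup>2"
          using n by (simp add: a2_def saddle_coeff_def n_def[symmetric] power_divide)
        also have "c * D\<^sup>2 * (v\<^sup>2 / w2\<^sup>2) = c * P * v\<^sup>2"
          using w20 by (simp add: D_def power_mult_distrib u2)
        also have "c * P * v\<^sup>2 / (- 2 * L2 P * P\<^sup>2 * v\<^sup>2) = - L1 P / (2 * P * L2 P)"
        proof -
          have "v \<noteq> 0" using nv2 by auto
          thus ?thesis using P(1) by (simp add: c_def power2_eq_square)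
        qed
        finally show "(q / of_real n * (v / w2) / csqrt a2)\<^sup>2 = - L1 P / (2 * P * L2 P)" .
        define r where "r = q / csqrt a2"
        have r: "0 < Re r" "3 * \<bar>Im r\<bar> < Re r"
          unfolding r_def q_def by (rule csqrt_quotient_sector[OF cD2 a2s(2,3)])+
        have "\<sigma> * Im r \<ge> - \<bar>Im r\<bar>" using \<sigma>(1) by auto
        hence "3 * Re r + \<sigma> * Im r > 0" using r by argo
        hence "(3 * Re r + \<sigma> * Im r) / (5 * n) > 0" using n by simp
        moreover have "Re (q / of_real n * (v / w2) / csqrt a2) = (3 * Re r + \<sigma> * Im r) / (5 * n)"
        proof -
          have "q / of_real n * (v / w2) / csqrt a2 = (3 - j) * r / of_real (5 * n)"
            by (simp add: vw r_def mult_ac)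
          also have "Re \<dots> = Re ((3 - j) * r) / (5 * n)" by (simp only: Re_divide_of_real)
          also have "Re ((3 - j) * r) = 3 * Re r + \<sigma> * Im r" by (simp add: j_def algebra_simps)
          finally show ?thesis .
        qed
        ultimately show "0 < Re (q / of_real n * (v / w2) / csqrt a2) \<or>
            Re (q / of_real n * (v / w2) / csqrt a2) = 0 \<and> 0 \<le> Im (q / of_real n * (v / w2) / csqrt a2)" by simp
      qed
      thus ?thesis by (simp add: saddle_term_def E_def)
    qed
    define X where "X = q / (of_real n * of_real (sqrt pi))"
    have Z: "partition_fun (1 / (2 * c)) N = X * (w1 / w2 * (of_real (sqrt \<Lambda>) * I1) + 2 * (v / w2) * E * (of_real (sqrt \<Lambda>) * I2) + of_real (sqrt \<Lambda>) * T)"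
    proof -
      have "csqrt (of_nat N * (c * D\<^sup>2)) = of_real (sqrt (real N)) * q"
        using csqrt_of_real_mult[of "real N" "c * D\<^sup>2"] by (simp add: q_def)
      also have "sqrt (real N) = sqrt \<Lambda> / n" using n by (simp add: \<Lambda>_def real_sqrt_mult)
      finally have "csqrt (of_nat N * (c * D\<^sup>2)) / of_real (sqrt pi) = X * of_real (sqrt \<Lambda>)"
        by (simp add: X_def)
      moreover have "partition_fun (1 / (2 * c)) N = csqrt (of_nat N * (c * D\<^sup>2)) / of_real (sqrt pi)
          * (\<integral>s. weight P N (D * of_real s) \<partial>lborel)"
        using partition_fun_weight(2)[OF N] cD2(1) unfolding c_def by blast
      ultimately show ?thesis unfolding path by (simp add: algebra_simps)
    qed
    have AX: "1 / csqrt (1 - 1 / (2 * c)) = X * (w1 / w2 * (of_real (sqrt pi) / csqrt a1))"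
      unfolding A X_def by simp
    have BX: "saddle_term P N = X * (2 * (v / w2) * E * (of_real (sqrt pi) / csqrt a2))"
      unfolding B X_def by (simp add: mult_ac)
    let ?A = "1 / csqrt (1 - 1 / (2 * c))" and ?B = "saddle_term P N"
    define d1 d2 where "d1 = of_real (sqrt \<Lambda>) * I1 - of_real (sqrt pi) / csqrt a1" and "d2 = of_real (sqrt \<Lambda>) * I2 - of_real (sqrt pi) / csqrt a2"
    have sp: "sqrt pi \<ge> 1" using pi_gt3 by simp
    have na: "norm (csqrt a1 / of_real (sqrt pi)) \<le> 1" "norm (csqrt a2 / of_real (sqrt pi)) \<le> 1"
    proof -
      have "norm (csqrt a1) \<le> 1" "norm (csqrt a2) \<le> 1" using a1s(3) a2s(4) by (simp_all add: norm_csqrt)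
      thus "norm (csqrt a1 / of_real (sqrt pi)) \<le> 1" "norm (csqrt a2 / of_real (sqrt pi)) \<le> 1"
        using sp by (simp_all add: norm_divide divide_le_eq)
    qed
    have e1: "X * (w1 / w2 * d1) = ?A * (csqrt a1 / of_real (sqrt pi)) * d1"
      unfolding AX using a10 by simp
    have e2: "X * (2 * (v / w2) * E * d2) = ?B * (csqrt a2 / of_real (sqrt pi)) * d2"
      unfolding BX using a20 by simp
    have e3: "X * (of_real (sqrt \<Lambda>) * T) = ?A * (csqrt a1 / of_real (sqrt pi)) * (1 - 3 * j) * (of_real (sqrt \<Lambda>) * T)"
    proof -
      have "w1 / w2 * (1 - 3 * j) = 1" using w12 w20 by (simp add: field_simps)
      hence "X = X * (w1 / w2 * (1 - 3 * j))" by simp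
      also have "\<dots> = ?A * (csqrt a1 / of_real (sqrt pi)) * (1 - 3 * j)" unfolding AX using a10 by simp
      finally show ?thesis by simp
    qed
    have "partition_fun (1 / (2 * c)) N - ?A - ?B = X * (w1 / w2 * d1) + X * (2 * (v / w2) * E * d2) + X * (of_real (sqrt \<Lambda>) * T)"
      unfolding Z AX BX d1_def d2_def by (simp add: algebra_simps)
    also have "norm \<dots> \<le> norm ?A * 1 * (K / \<Lambda>) + norm ?B * 1 * (K / \<Lambda>) + norm ?A * 1 * 4 * (KT / \<Lambda>)"
      unfolding e1 e2 e3
    proof (intro norm_triangle_mono)
      show "norm (?A * (csqrt a1 / of_real (sqrt pi)) * d1) \<le> norm ?A * 1 * (K / \<Lambda>)"
        unfolding norm_mult[of _ d1] norm_mult[of ?A] using na(1) main1 unfolding d1_def by (intro mult_mono) auto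
      show "norm (?B * (csqrt a2 / of_real (sqrt pi)) * d2) \<le> norm ?B * 1 * (K / \<Lambda>)"
        unfolding norm_mult[of _ d2] norm_mult[of ?B] using na(2) main2 unfolding d2_def by (intro mult_mono) auto
      show "norm (?A * (csqrt a1 / of_real (sqrt pi)) * (1 - 3 * j) * (of_real (sqrt \<Lambda>) * T)) \<le> norm ?A * 1 * 4 * (KT / \<Lambda>)"
        unfolding norm_mult[of _ "of_real (sqrt \<Lambda>) * T"] norm_mult[of _ "1 - 3 * j"] norm_mult[of ?A]
        using na(1) nw mainT by (intro mult_mono) auto
    qed
    also have "\<dots> \<le> (K + 4 * KT) / \<Lambda> * (norm ?A + norm ?B)"
    proof -
      have "0 \<le> 4 * (KT / \<Lambda>) * norm ?B" using KT(1) \<Lambda> by (intro mult_nonneg_nonneg) auto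
      thus ?thesis by (simp add: algebra_simps add_divide_distrib)
    qed
    finally show ?thesis by (simp only: c_def \<Lambda>_def n_def)
  qed
  thus ?thesis using K(1) KT(1) by (intro that[of "K + 4 * KT"]) auto
qed

end

section \<open>The asymptotics of the partition function\<close>

context log_cosh_disc
begin

lemma beta_approx:
  assumes "P \<noteq> 0" "norm P \<le> \<rho> / 10000"
  shows "norm (3 * (1 / (2 * L1 P) - 1) - P) \<le> norm P / 100"
proof -
  define n c where "n = norm P" and "c = L1 P"
  have n: "n > 0" "n \<le> 1/10000" using assms \<rho> by (simp_all add: n_def)
  have PB: "P \<in> ball 0 \<rho>" using assms \<rho> by simp
  have c: "c \<noteq> 0" "2/5 \<le> norm c" using one_minus_inverse[OF PB assms] by (simp_all add: c_def)
  have "3 * (1 / (2 * c) - 1) - P = (- 3 * (c - 1 / 2 + P / 6) - P * (c - 1 / 2)) / c"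
    using c(1) by (simp add: field_simps)
  also have "norm \<dots> \<le> (3 * (n / 1000) + n * (1/10000)) / (2/5)"
  proof -
    have "norm (- 3 * (c - 1 / 2 + P / 6) - P * (c - 1 / 2)) \<le> 3 * (n / 1000) + n * (1/10000)"
    proof (rule norm_triangle_le_diff, rule add_mono)
      have "norm (- 3 * X) = 3 * norm X" for X :: complex by (simp add: norm_mult)
      thus "norm (- 3 * (c - 1 / 2 + P / 6)) \<le> 3 * (n / 1000)"
        using L1_approx[OF PB] by (simp only: c_def n_def)
      show "norm (P * (c - 1 / 2)) \<le> n * (1/10000)"
        using L1_near_half(1)[OF PB] n unfolding norm_mult by (intro mult_mono) (auto simp: c_def n_def)
    qed
    thus ?thesis unfolding norm_divide using c n by (intro frac_le) auto
  qed
  also have "\<dots> \<le> n / 100" using n by simp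
  finally show ?thesis by (simp only: c_def n_def)
qed

text \<open>The three parts of the parameter domain combined. The error is measured against the larger of
  the two terms, and where the saddle term dominates the sign of the first term does not matter.\<close>

lemma partition_fun_estimate:
  obtains K where "K \<ge> 0"
    "\<And>P N. \<lbrakk>P \<noteq> 0; norm P \<le> \<rho> / 10000; N \<ge> 1; 100 * Re P \<le> norm P\<rbrakk> \<Longrightarrow>
      norm (csqrt (1 - 1 / (2 * L1 P)) * partition_fun (1 / (2 * L1 P)) N - 1) \<le> K / (real N * (norm P)\<^sup>2)"
    "\<And>P N r. \<lbrakk>P \<noteq> 0; norm P \<le> \<rho> / 10000; N \<ge> 1; - norm P \<le> 100 * Re P;
        r = csqrt (1 - 1 / (2 * L1 P)) \<or> 10 * \<bar>Im P\<bar> \<le> 9 * Re P \<and> r = - csqrt (1 - 1 / (2 * L1 P))\<rbrakk> \<Longrightarrow>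
      norm (partition_fun (1 / (2 * L1 P)) N - 1 / r - saddle_term P N)
      \<le> K / (real N * (norm P)\<^sup>2) * max (norm (1 / r)) (norm (saddle_term P N))"
proof -
  obtain K1 where K1: "K1 \<ge> 0"
    "\<And>P N. \<lbrakk>P \<noteq> 0; norm P \<le> \<rho> / 10000; N \<ge> 1; norm P \<le> 20 * \<bar>Im P\<bar> - 21 * Re P\<rbrakk> \<Longrightarrow>
      norm (csqrt (1 - 1 / (2 * L1 P)) * partition_fun (1 / (2 * L1 P)) N - 1) \<le> K1 / (real N * (norm P)\<^sup>2)"
    using partition_fun_origin_saddle by blast
  obtain K2 where K2: "K2 \<ge> 0"
    "\<And>P N. \<lbrakk>P \<noteq> 0; norm P \<le> \<rho> / 10000; N \<ge> 1; 0 < Re P; 10 * \<bar>Im P\<bar> \<le> 9 * Re P\<rbrakk> \<Longrightarrow>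
      norm (partition_fun (1 / (2 * L1 P)) N - saddle_term P N) \<le> K2 / (real N * (norm P)\<^sup>2) * norm (saddle_term P N)"
    using partition_fun_outer_saddles by blast
  obtain K3 where K3: "K3 \<ge> 0"
    "\<And>P N. \<lbrakk>P \<noteq> 0; norm P \<le> \<rho> / 10000; N \<ge> 1; 0 < Re P; 9 * Re P \<le> 10 * \<bar>Im P\<bar>; 10 * \<bar>Im P\<bar> \<le> 12 * Re P\<rbrakk> \<Longrightarrow>
      norm (partition_fun (1 / (2 * L1 P)) N - 1 / csqrt (1 - 1 / (2 * L1 P)) - saddle_term P N)
      \<le> K3 / (real N * (norm P)\<^sup>2) * (norm (1 / csqrt (1 - 1 / (2 * L1 P))) + norm (saddle_term P N))"
    using partition_fun_all_saddles by blast
  define K where "K = K1 + K2 + 2 * K3 + 1000"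
  have KK: "K1 \<le> K" "K2 + 200 \<le> K" "2 * K3 \<le> K" "K1 + 1000 \<le> K" "0 \<le> K"
    using K1(1) K2(1) K3(1) by (simp_all add: K_def)
  show ?thesis
  proof (rule that[OF KK(5)])
    fix P N assume P: "P \<noteq> 0" "norm P \<le> \<rho> / 10000" and N: "(N::nat) \<ge> 1" and le: "100 * Re P \<le> norm P"
    have "norm P \<le> \<bar>Re P\<bar> + \<bar>Im P\<bar>" by (rule cmod_le)
    hence "norm P \<le> 20 * \<bar>Im P\<bar> - 21 * Re P"
      using le norm_ge_zero[of P] by (cases "Re P \<ge> 0") (simp_all add: abs_if split: if_splits)
    from K1(2)[OF P N this] show "norm (csqrt (1 - 1 / (2 * L1 P)) * partition_fun (1 / (2 * L1 P)) N - 1) \<le> K / (real N * (norm P)\<^sup>2)"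
      by (rule order.trans) (intro divide_right_mono KK, simp)
  next
    fix P N r
    assume P: "P \<noteq> 0" "norm P \<le> \<rho> / 10000" and N: "(N::nat) \<ge> 1" and ge: "- norm P \<le> 100 * Re P"
      and r: "r = csqrt (1 - 1 / (2 * L1 P)) \<or> 10 * \<bar>Im P\<bar> \<le> 9 * Re P \<and> r = - csqrt (1 - 1 / (2 * L1 P))"
    define n x y \<Lambda> where "n = norm P" and "x = Re P" and "y = \<bar>Im P\<bar>" and "\<Lambda> = real N * n\<^sup>2"
    have n: "n > 0" and \<Lambda>: "\<Lambda> > 0" using P N by (simp_all add: n_def \<Lambda>_def)
    have PB: "P \<in> ball 0 \<rho>" using P \<rho> by simp
    have n2: "n\<^sup>2 = x\<^sup>2 + y\<^sup>2" by (simp add: n_def cmod_power2 x_def y_def)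
    have nxy: "n \<le> \<bar>x\<bar> + y" unfolding n_def x_def y_def by (rule cmod_le)
    have y0: "y \<ge> 0" by (simp add: y_def)
    have ReP2: "Re (P\<^sup>2) = x\<^sup>2 - y\<^sup>2" by (simp add: Re_power2 x_def y_def)
    have x_ge: "- n \<le> 100 * x" using ge by (simp add: n_def x_def)
    define q Z B where "q = csqrt (1 - 1 / (2 * L1 P))" and "Z = partition_fun (1 / (2 * L1 P)) N" and "B = saddle_term P N"
    have q0: "q \<noteq> 0"
    proof -
      have "norm (L1 P - 1 / 2) > 0" using L1_near_half(2)[OF PB] n unfolding n_def
        by (smt (verit) mult_pos_pos divide_pos_pos)
      thus ?thesis unfolding q_def one_minus_inverse(2)[OF PB P] using one_minus_inverse(1)[OF PB P] by simp
    qed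
    have nr: "norm (1 / r) = norm (1 / q)" using r by (auto simp: q_def norm_divide)
    have "norm (Z - 1 / r - B) \<le> K / \<Lambda> * max (norm (1 / q)) (norm B)"
    proof (cases "10 * y \<le> 9 * x")
      case True
      have x: "x > 0" using True nxy n y0 by argo
      have "y\<^sup>2 \<le> (9/10 * x)\<^sup>2" using True y0 by (intro power_mono) auto
      hence "y\<^sup>2 \<le> 81/100 * x\<^sup>2" by (simp add: power_mult_distrib power_divide)
      hence "Re (P\<^sup>2) \<ge> n\<^sup>2 / 10" unfolding ReP2 n2 using zero_le_power2[of x] by argo
      hence A: "norm (1 / q) \<le> 200 / \<Lambda> * norm B"
        using origin_term_negligible[OF P N] by (simp only: q_def B_def \<Lambda>_def n_def)
      have B: "norm (Z - B) \<le> K2 / \<Lambda> * norm B"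
        using K2(2)[OF P N] x True unfolding Z_def B_def \<Lambda>_def n_def x_def y_def by blast
      have "norm (Z - 1 / r - B) = norm ((Z - B) - 1 / r)" by (simp add: algebra_simps)
      also have "\<dots> \<le> K2 / \<Lambda> * norm B + 200 / \<Lambda> * norm B"
        using norm_triangle_ineq4[of "Z - B" "1 / r"] A B nr by argo
      also have "\<dots> = (K2 + 200) / \<Lambda> * norm B" by (simp add: add_divide_distrib algebra_simps)
      also have "\<dots> \<le> K / \<Lambda> * max (norm (1 / q)) (norm B)"
        using KK \<Lambda> by (intro mult_mono divide_right_mono) auto
      finally show ?thesis .
    next
      case False
      hence rq: "r = q" using r by (auto simp: q_def x_def y_def)
      show ?thesis
      proof (cases "n \<le> 20 * y - 21 * x")
        case True
        have "Re (P\<^sup>2) \<le> - (3/50) * n\<^sup>2"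
        proof (cases "x \<le> 0")
          case True
          have "y \<ge> 99/100 * n" using nxy x_ge True by argo
          hence "(99/100 * n)\<^sup>2 \<le> y\<^sup>2" using n by (intro power_mono) auto
          hence "9801/10000 * n\<^sup>2 \<le> y\<^sup>2" by (simp add: power_mult_distrib power_divide)
          thus ?thesis unfolding ReP2 using n2 zero_le_power2[of n] by argo
        next
          case False
          have "x \<le> n" unfolding x_def n_def by (rule complex_Re_le_cmod)
          hence "11/10 * x \<le> y" using True by argo
          hence "(11/10 * x)\<^sup>2 \<le> y\<^sup>2" using False by (intro power_mono) auto
          hence "121/100 * x\<^sup>2 \<le> y\<^sup>2" by (simp add: power_mult_distrib power_divide)
          thus ?thesis unfolding ReP2 n2 using zero_le_power2[of x] by argo
        qed
        hence B: "norm B \<le> 1000 / \<Lambda> * norm (1 / q)"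
          using saddle_term_negligible[OF P N] by (simp only: q_def B_def \<Lambda>_def n_def)
        have "norm (q * Z - 1) \<le> K1 / \<Lambda>"
          using K1(2)[OF P N] True unfolding q_def Z_def \<Lambda>_def n_def x_def y_def by blast
        hence "norm (1 / q) * norm (q * Z - 1) \<le> norm (1 / q) * (K1 / \<Lambda>)" by (rule mult_left_mono) simp
        moreover have "1 / q * (q * Z - 1) = Z - 1 / q" using q0 by (simp add: field_simps)
        ultimately have A: "norm (Z - 1 / q) \<le> norm (1 / q) * (K1 / \<Lambda>)" by (metis norm_mult)
        have "norm (Z - 1 / r - B) \<le> norm (1 / q) * (K1 / \<Lambda>) + 1000 / \<Lambda> * norm (1 / q)"
          unfolding rq using norm_triangle_ineq4[of "Z - 1 / q" B] A B by argo
        also have "\<dots> = (K1 + 1000) / \<Lambda> * norm (1 / q)" by (simp add: add_divide_distrib algebra_simps)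
        also have "\<dots> \<le> K / \<Lambda> * max (norm (1 / q)) (norm B)"
          using KK \<Lambda> by (intro mult_mono divide_right_mono) auto
        finally show ?thesis .
      next
        case nR1: False
        have x: "x > 0"
        proof (rule ccontr)
          assume "\<not> x > 0"
          thus False using nR1 nxy x_ge n y0 by argo
        qed
        have y: "10 * y \<le> 12 * x"
        proof (rule ccontr)
          assume "\<not> 10 * y \<le> 12 * x"
          thus False using nR1 nxy x by argo
        qed
        have "norm (Z - 1 / q - B) \<le> K3 / \<Lambda> * (norm (1 / q) + norm B)"
          using K3(2)[OF P N] x y False unfolding q_def Z_def B_def \<Lambda>_def n_def x_def y_def by argo
        also have "\<dots> \<le> K3 / \<Lambda> * (2 * max (norm (1 / q)) (norm B))"
          using K3(1) \<Lambda> by (intro mult_left_mono) auto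
        also have "\<dots> = 2 * K3 / \<Lambda> * max (norm (1 / q)) (norm B)" by simp
        also have "\<dots> \<le> K / \<Lambda> * max (norm (1 / q)) (norm B)"
          using KK \<Lambda> by (intro mult_right_mono divide_right_mono) (auto simp: max_def)
        finally show ?thesis unfolding rq .
      qed
    qed
    thus "norm (partition_fun (1 / (2 * L1 P)) N - 1 / r - saddle_term P N)
      \<le> K / (real N * (norm P)\<^sup>2) * max (norm (1 / r)) (norm (saddle_term P N))"
      unfolding nr by (simp only: Z_def B_def \<Lambda>_def n_def)
  qed
qed

text \<open>The equation \<open>2 \<beta> L1 P = 1\<close>, which says that \<open>u\<^sup>2 = P\<close> for a critical point \<open>u\<close>, is solvable
  for \<open>\<beta>\<close> near \<open>1\<close>: \<open>L1\<close> is not constant, hence open.\<close>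

lemma critical_point_exists:
  assumes "0 < s" "s \<le> \<rho>"
  obtains e where "e > 0" "\<And>\<beta>. norm (\<beta> - 1) < e \<Longrightarrow> \<exists>P. norm P < s \<and> \<beta> = 1 / (2 * L1 P) \<and> L1 P \<noteq> 0"
proof -
  have sub: "ball 0 s \<subseteq> (ball 0 \<rho> :: complex set)" using assms by auto
  have hol1: "L1 holomorphic_on ball 0 s"
    using holomorphic_deriv[OF hol open_ball] sub holomorphic_on_subset by blast
  have nc: "\<not> L1 constant_on ball 0 s"
  proof
    assume "L1 constant_on ball 0 s"
    then obtain k where k: "\<And>z. z \<in> ball 0 s \<Longrightarrow> L1 z = k" unfolding constant_on_def by blast
    define z where "z = complex_of_real (s / 2)"
    have z: "z \<in> ball 0 s" "z \<noteq> 0" using assms by (simp_all add: z_def)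
    have "L1 z = L1 0" using k[OF z(1)] k[of 0] assms by simp
    hence e: "L1 z = 1 / 2" unfolding at_0(2) .
    have "norm z * (4 / 25) \<le> 0" using L1_near_half(2)[OF subsetD[OF sub z(1)]] unfolding e by simp
    thus False using z(2) by (simp add: mult_le_0_iff)
  qed
  have "open (L1 ` ball 0 s)"
    by (rule open_mapping_thm[OF hol1 _ _ _ order.refl nc]) auto
  moreover have "1 / 2 \<in> L1 ` ball 0 s" using at_0(2) assms(1) by (metis centre_in_ball image_eqI)
  ultimately obtain e0 where e0: "e0 > 0" "ball (1 / 2) e0 \<subseteq> L1 ` ball 0 s"
    using open_contains_ball by blast
  show ?thesis
  proof (rule that[of "min e0 (1/2)"])
    show "min e0 (1/2) > 0" using e0 by simp
    fix \<beta> :: complex assume \<beta>: "norm (\<beta> - 1) < min e0 (1/2)"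
    have "norm (1 :: complex) \<le> norm \<beta> + norm (\<beta> - 1)"
      by (metis diff_diff_eq2 add_diff_cancel_left' norm_triangle_ineq4)
    hence nb: "1/2 \<le> norm \<beta>" using \<beta> by simp
    hence b0: "\<beta> \<noteq> 0" by auto
    have "1 / 2 - 1 / (2 * \<beta>) = (\<beta> - 1) / (2 * \<beta>)" using b0 by (simp add: field_simps)
    hence "dist (1 / 2) (1 / (2 * \<beta>)) = norm (\<beta> - 1) / (2 * norm \<beta>)" by (simp add: dist_norm norm_divide norm_mult)
    also have "\<dots> \<le> norm (\<beta> - 1) / 1" using nb by (intro divide_left_mono) auto
    also have "\<dots> < e0" using \<beta> by simp
    finally obtain P where "P \<in> ball 0 s" "L1 P = 1 / (2 * \<beta>)" using e0(2) by (metis imageE mem_ball subsetD)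
    thus "\<exists>P. norm P < s \<and> \<beta> = 1 / (2 * L1 P) \<and> L1 P \<noteq> 0" using b0 by (intro exI[of _ P]) simp
  qed
qed

lemma exp_h_fun:
  assumes "u \<in> slit_plane" "u\<^sup>2 = P" "P \<in> ball 0 \<rho>" "\<beta> = 1 / (2 * L1 P)"
  shows "exp (- of_nat N * h_fun \<beta> u) = exp (- (of_nat N * H P P))"
proof -
  have "exp (log_cosh u) = cosh u" using is_log_cosh_log_cosh assms(1) by (simp add: is_log_cosh_def)
  also have "\<dots> = exp (L P)" using cosh_eq_exp[of u] assms(2,3) by simp
  finally have e: "exp (log_cosh u) = exp (L P)" .
  have "h_fun \<beta> u = L1 P * P - log_cosh u" by (simp add: h_fun_def assms(2,4))
  hence "exp (- h_fun \<beta> u) = exp (- H P P)" by (simp add: H_def exp_diff e)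
  hence "exp (- h_fun \<beta> u) ^ N = exp (- H P P) ^ N" by simp
  thus ?thesis by (simp add: exp_of_nat_mult[symmetric])
qed

end

theorem theorem1p3:
  fixes c :: real and u :: "complex \<Rightarrow> complex"
  assumes c_pos: "0 < c"
    and zeros: "\<And>\<beta>. 0 < norm (\<beta> - 1) \<Longrightarrow> norm (\<beta> - 1) \<le> c \<Longrightarrow>
      u \<beta> \<noteq> 0 \<and>
      {z \<in> slit_plane. norm z \<le> 10 * sqrt c \<and> deriv (h_fun \<beta>) z = 0} = {0, u \<beta>, - u \<beta>}"
  shows "\<exists>c'. 0 < c' \<and> c' \<le> c \<and>
    (\<forall>r. (\<forall>\<beta>. r \<beta> = csqrt (1 - \<beta>) \<or>
               (\<beta> \<in> \<real> \<and> Re \<beta> > 1 \<and> r \<beta> = - csqrt (1 - \<beta>))) \<longrightarrow>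
      (\<exists>E1 E2 E3 :: complex \<Rightarrow> nat \<Rightarrow> complex.
        (\<forall>\<beta>. 0 < norm (\<beta> - 1) \<and> norm (\<beta> - 1) \<le> c' \<longrightarrow>
          (Re \<beta> \<le> 1 \<longrightarrow>
            E1 \<beta> \<in> O(\<lambda>N. 1 / of_nat N) \<and>
            (\<forall>N\<ge>1. partition_fun \<beta> N = 1 / r \<beta> * (1 + E1 \<beta> N))) \<and>
          (Re \<beta> \<ge> 1 \<longrightarrow>
            E2 \<beta> \<in> O(\<lambda>N. 1 / of_nat N) \<and> E3 \<beta> \<in> O(\<lambda>N. 1 / of_nat N) \<and>
            (\<forall>N\<ge>1. partition_fun \<beta> N =
                1 / r \<beta> * (1 + E2 \<beta> N)
                + 2 * csqrt (\<beta> / (\<beta> - \<beta>\<^sup>2 + (u \<beta>)\<^sup>2)) * exp (- of_nat N * h_fun \<beta> (u \<beta>))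
                    * (1 + E3 \<beta> N)))) \<and>
        (\<forall>\<delta>>0. \<exists>K. \<forall>\<^sub>F N in sequentially. \<forall>\<beta>.
          \<delta> \<le> norm (\<beta> - 1) \<and> norm (\<beta> - 1) \<le> c' \<longrightarrow>
            (Re \<beta> \<le> 1 \<longrightarrow> norm (E1 \<beta> N) \<le> K / real N) \<and>
            (Re \<beta> \<ge> 1 \<longrightarrow> norm (E2 \<beta> N) \<le> K / real N \<and> norm (E3 \<beta> N) \<le> K / real N))))"
proof -
  obtain \<rho> M where disc: "log_cosh_disc \<rho> M"
    using log_cosh_sqrt_expansion[of "1 / 1000"] unfolding log_cosh_disc_def by (metis zero_less_divide_1_iff zero_less_numeral)
  interpret log_cosh_disc \<rho> M by (rule disc)
  obtain K where K: "K \<ge> 0"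
    "\<And>P N. \<lbrakk>P \<noteq> 0; norm P \<le> \<rho> / 10000; N \<ge> 1; 100 * Re P \<le> norm P\<rbrakk> \<Longrightarrow>
      norm (csqrt (1 - 1 / (2 * L1 P)) * partition_fun (1 / (2 * L1 P)) N - 1) \<le> K / (real N * (norm P)\<^sup>2)"
    "\<And>P N r. \<lbrakk>P \<noteq> 0; norm P \<le> \<rho> / 10000; N \<ge> 1; - norm P \<le> 100 * Re P;
        r = csqrt (1 - 1 / (2 * L1 P)) \<or> 10 * \<bar>Im P\<bar> \<le> 9 * Re P \<and> r = - csqrt (1 - 1 / (2 * L1 P))\<rbrakk> \<Longrightarrow>
      norm (partition_fun (1 / (2 * L1 P)) N - 1 / r - saddle_term P N)
      \<le> K / (real N * (norm P)\<^sup>2) * max (norm (1 / r)) (norm (saddle_term P N))"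
    using partition_fun_estimate by blast
  \<comment> \<open>\<open>norm P < c\<close> puts the square root of \<open>P\<close> into the disc in which the critical points are known.\<close>
  define s where "s = min (\<rho> / 10000) c"
  have s: "0 < s" "s \<le> \<rho>" "s \<le> \<rho> / 10000" "s \<le> c" using \<rho> c_pos by (auto simp: s_def)
  obtain e where e: "e > 0" "\<And>\<beta>. norm (\<beta> - 1) < e \<Longrightarrow> \<exists>P. norm P < s \<and> \<beta> = 1 / (2 * L1 P) \<and> L1 P \<noteq> 0"
    using critical_point_exists[OF s(1,2)] by blast
  define c' where "c' = min c (e / 2)"
  have c': "0 < c'" "c' \<le> c" "c' < e" using c_pos e(1) by (auto simp: c'_def)
  define B where "B \<beta> N = 2 * csqrt (\<beta> / (\<beta> - \<beta>\<^sup>2 + (u \<beta>)\<^sup>2)) * exp (- of_nat N * h_fun \<beta> (u \<beta>))" for \<beta> and N :: nat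
  have point: "\<exists>P. P \<noteq> 0 \<and> norm P \<le> \<rho> / 10000 \<and> \<beta> = 1 / (2 * L1 P) \<and> norm (\<beta> - 1) \<le> norm P \<and>
      norm (3 * (\<beta> - 1) - P) \<le> norm P / 100 \<and> (\<forall>N. B \<beta> N = saddle_term P N)"
    if \<beta>: "0 < norm (\<beta> - 1)" "norm (\<beta> - 1) \<le> c'" for \<beta>
  proof -
    obtain P where P: "norm P < s" "\<beta> = 1 / (2 * L1 P)" "L1 P \<noteq> 0" using e(2)[of \<beta>] \<beta> c' by auto
    have "\<beta> = 1" if "P = 0" using P(2) unfolding that at_0(2) by simp
    hence P0: "P \<noteq> 0" using \<beta>(1) by auto
    have Pn: "norm P \<le> \<rho> / 10000" and PB: "P \<in> ball 0 \<rho>" using P(1) s by auto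
    have ap: "norm (3 * (\<beta> - 1) - P) \<le> norm P / 100" unfolding P(2) by (rule beta_approx[OF P0 Pn])
    have "norm (3 * (\<beta> - 1)) \<le> norm (3 * (\<beta> - 1) - P) + norm P"
      by (metis diff_add_cancel norm_triangle_ineq)
    moreover have "norm (3 * (\<beta> - 1)) = 3 * norm (\<beta> - 1)" unfolding norm_mult by simp
    ultimately have nb: "norm (\<beta> - 1) \<le> norm P" using ap norm_ge_zero[of P] by argo
    define z where "z = csqrt P"
    have z2: "z\<^sup>2 = P" and z0: "z \<noteq> 0" using P0 by (simp_all add: z_def)
    have nz: "norm z = sqrt (norm P)" by (simp add: z_def norm_csqrt)
    have "norm P \<le> 1" using Pn \<rho> by simp
    hence nz1: "norm z \<le> 1" unfolding nz by simp
    have "z \<in> slit_plane"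
    proof -
      have "\<bar>Im z\<bar> \<le> 1" using abs_Im_le_cmod[of z] nz1 by linarith
      moreover have "1 < pi / 2" using pi_gt3 by simp
      ultimately show ?thesis by (simp add: slit_plane_def)
    qed
    moreover have "norm z \<le> 10 * sqrt c"
    proof -
      have "norm z \<le> sqrt c" unfolding nz using P(1) s(4) by simp
      thus ?thesis using c_pos real_sqrt_ge_zero[of c] by linarith
    qed
    moreover have "deriv (h_fun \<beta>) z = 0"
      using deriv_h_fun[OF \<open>z \<in> slit_plane\<close>, of \<beta>] tanh_eq[of z] PB z2 P(2,3) by simp
    ultimately have "z \<in> {z \<in> slit_plane. norm z \<le> 10 * sqrt c \<and> deriv (h_fun \<beta>) z = 0}" by simp
    also have "\<dots> = {0, u \<beta>, - u \<beta>}" using zeros[OF \<beta>(1)] \<beta>(2) c'(2) by simp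
    finally have "z = u \<beta> \<or> z = - u \<beta>" using z0 by simp
    hence u2: "(u \<beta>)\<^sup>2 = P" using z2 by auto
    have "u \<beta> \<in> {z \<in> slit_plane. norm z \<le> 10 * sqrt c \<and> deriv (h_fun \<beta>) z = 0}"
      using zeros[OF \<beta>(1)] \<beta>(2) c'(2) by simp
    hence us: "u \<beta> \<in> slit_plane" by simp
    have "B \<beta> N = saddle_term P N" for N
      unfolding B_def saddle_term_def saddle_prefactor[OF u2 P0 PB P(2,3)] exp_h_fun[OF us u2 PB P(2)] ..
    thus ?thesis using P0 Pn P(2) nb ap by blast
  qed
  have main: "(\<exists>E1 E2 E3 :: complex \<Rightarrow> nat \<Rightarrow> complex.
        (\<forall>\<beta>. 0 < norm (\<beta> - 1) \<and> norm (\<beta> - 1) \<le> c' \<longrightarrow>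
          (Re \<beta> \<le> 1 \<longrightarrow>
            E1 \<beta> \<in> O(\<lambda>N. 1 / of_nat N) \<and>
            (\<forall>N\<ge>1. partition_fun \<beta> N = 1 / r \<beta> * (1 + E1 \<beta> N))) \<and>
          (Re \<beta> \<ge> 1 \<longrightarrow>
            E2 \<beta> \<in> O(\<lambda>N. 1 / of_nat N) \<and> E3 \<beta> \<in> O(\<lambda>N. 1 / of_nat N) \<and>
            (\<forall>N\<ge>1. partition_fun \<beta> N = 1 / r \<beta> * (1 + E2 \<beta> N) + B \<beta> N * (1 + E3 \<beta> N)))) \<and>
        (\<forall>\<delta>>0. \<exists>K. \<forall>\<^sub>F N in sequentially. \<forall>\<beta>.
          \<delta> \<le> norm (\<beta> - 1) \<and> norm (\<beta> - 1) \<le> c' \<longrightarrow>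
            (Re \<beta> \<le> 1 \<longrightarrow> norm (E1 \<beta> N) \<le> K / real N) \<and>
            (Re \<beta> \<ge> 1 \<longrightarrow> norm (E2 \<beta> N) \<le> K / real N \<and> norm (E3 \<beta> N) \<le> K / real N)))"
    if r: "\<forall>\<beta>. r \<beta> = csqrt (1 - \<beta>) \<or> (\<beta> \<in> \<real> \<and> Re \<beta> > 1 \<and> r \<beta> = - csqrt (1 - \<beta>))" for r
  proof -
    let ?Z = partition_fun
    define E1 where "E1 \<beta> N = r \<beta> * ?Z \<beta> N - 1" for \<beta> N
    define R where "R \<beta> N = ?Z \<beta> N - 1 / r \<beta> - B \<beta> N" for \<beta> N
    \<comment> \<open>The whole error is attributed to the larger one of the two terms.\<close>
    define E2 where "E2 \<beta> N = (if norm (B \<beta> N) \<le> norm (1 / r \<beta>) then r \<beta> * R \<beta> N else 0)" for \<beta> N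
    define E3 where "E3 \<beta> N = (if norm (B \<beta> N) \<le> norm (1 / r \<beta>) then 0 else R \<beta> N / B \<beta> N)" for \<beta> N
    have r0: "r \<beta> \<noteq> 0" if "\<beta> \<noteq> 1" for \<beta> using r[rule_format, of \<beta>] that by auto
    have b1: "norm (E1 \<beta> N) \<le> (K / \<delta>\<^sup>2) / real N"
      if \<beta>: "0 < \<delta>" "\<delta> \<le> norm (\<beta> - 1)" "norm (\<beta> - 1) \<le> c'" "Re \<beta> \<le> 1" and N: "N \<ge> 1" for \<beta> \<delta> N
    proof -
      have \<beta>0: "0 < norm (\<beta> - 1)" using \<beta> by linarith
      obtain P where P: "P \<noteq> 0" "norm P \<le> \<rho> / 10000" "\<beta> = 1 / (2 * L1 P)" "norm (\<beta> - 1) \<le> norm P"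
        "norm (3 * (\<beta> - 1) - P) \<le> norm P / 100" using point[OF \<beta>0 \<beta>(3)] by blast
      have "Re (3 * (\<beta> - 1)) \<ge> Re P - norm P / 100" by (rule Re_ge_of_norm[OF P(5)])
      hence "100 * Re P \<le> norm P" using \<beta>(4) by simp
      from K(2)[OF P(1,2) N this] have "norm (E1 \<beta> N) \<le> K / (real N * (norm P)\<^sup>2)"
        using r[rule_format, of \<beta>] \<beta>(4) unfolding E1_def P(3)[symmetric] by auto
      also have "\<dots> \<le> K / (real N * \<delta>\<^sup>2)"
        using \<beta> P K(1) N by (intro divide_left_mono mult_left_mono power_mono mult_pos_pos) auto
      finally show ?thesis by (simp add: mult.commute)
    qed
    have b23: "norm (E2 \<beta> N) \<le> (K / \<delta>\<^sup>2) / real N \<and> norm (E3 \<beta> N) \<le> (K / \<delta>\<^sup>2) / real N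
        \<and> ?Z \<beta> N = 1 / r \<beta> * (1 + E2 \<beta> N) + B \<beta> N * (1 + E3 \<beta> N)"
      if \<beta>: "0 < \<delta>" "\<delta> \<le> norm (\<beta> - 1)" "norm (\<beta> - 1) \<le> c'" "Re \<beta> \<ge> 1" and N: "N \<ge> 1" for \<beta> \<delta> N
    proof -
      have \<beta>0: "0 < norm (\<beta> - 1)" using \<beta> by linarith
      obtain P where P: "P \<noteq> 0" "norm P \<le> \<rho> / 10000" "\<beta> = 1 / (2 * L1 P)" "norm (\<beta> - 1) \<le> norm P"
        "norm (3 * (\<beta> - 1) - P) \<le> norm P / 100" "B \<beta> N = saddle_term P N" using point[OF \<beta>0 \<beta>(3)] by blast
      have rb: "r \<beta> \<noteq> 0" using r0[of \<beta>] \<beta>0 by auto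
      have "\<bar>Re (3 * (\<beta> - 1) - P)\<bar> \<le> norm P / 100" "\<bar>Im (3 * (\<beta> - 1) - P)\<bar> \<le> norm P / 100"
        using P(5) abs_Re_le_cmod[of "3 * (\<beta> - 1) - P"] abs_Im_le_cmod[of "3 * (\<beta> - 1) - P"] by linarith+
      hence RI: "\<bar>3 * Re \<beta> - 3 - Re P\<bar> \<le> norm P / 100" "\<bar>3 * Im \<beta> - Im P\<bar> \<le> norm P / 100"
        by simp_all
      have ge: "- norm P \<le> 100 * Re P" using RI(1) \<beta>(4) by argo
      have "10 * \<bar>Im P\<bar> \<le> 9 * Re P" if "\<beta> \<in> \<real>"
      proof -
        have "Im \<beta> = 0" using that by (simp add: complex_is_Real_iff)
        moreover have "norm P > 0" using P(1) by simp
        moreover note cmod_le[of P]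
        ultimately show ?thesis using RI(2) ge by argo
      qed
      hence rr: "r \<beta> = csqrt (1 - 1 / (2 * L1 P)) \<or> 10 * \<bar>Im P\<bar> \<le> 9 * Re P \<and> r \<beta> = - csqrt (1 - 1 / (2 * L1 P))"
        using r[rule_format, of \<beta>] unfolding P(3)[symmetric] by blast
      have "norm (R \<beta> N) \<le> K / (real N * (norm P)\<^sup>2) * max (norm (1 / r \<beta>)) (norm (B \<beta> N))"
        using K(3)[OF P(1,2) N ge rr] unfolding P(3)[symmetric] R_def P(6) .
      also have "\<dots> \<le> K / (real N * \<delta>\<^sup>2) * max (norm (1 / r \<beta>)) (norm (B \<beta> N))"
        using \<beta> P K(1) N by (intro mult_right_mono divide_left_mono mult_left_mono power_mono mult_pos_pos) (auto simp: max_def)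
      also have "K / (real N * \<delta>\<^sup>2) = (K / \<delta>\<^sup>2) / real N" by (simp add: mult.commute)
      finally have R: "norm (R \<beta> N) \<le> (K / \<delta>\<^sup>2) / real N * max (norm (1 / r \<beta>)) (norm (B \<beta> N))" .
      have nn: "0 \<le> (K / \<delta>\<^sup>2) / real N" using K(1) by simp
      show ?thesis
      proof (cases "norm (B \<beta> N) \<le> norm (1 / r \<beta>)")
        case True
        have "norm (r \<beta> * R \<beta> N) \<le> norm (r \<beta>) * ((K / \<delta>\<^sup>2) / real N * norm (1 / r \<beta>))"
          unfolding norm_mult using R True by (intro mult_left_mono) (auto simp: max_def)
        also have "\<dots> = (K / \<delta>\<^sup>2) / real N" using rb by (simp add: norm_divide)
        finally show ?thesis using True nn rb by (simp add: E2_def E3_def R_def field_simps)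
      next
        case False
        have B0: "B \<beta> N \<noteq> 0" using False by auto
        have "norm (R \<beta> N / B \<beta> N) \<le> ((K / \<delta>\<^sup>2) / real N * norm (B \<beta> N)) / norm (B \<beta> N)"
          unfolding norm_divide using R False by (intro divide_right_mono) (auto simp: max_def)
        also have "\<dots> = (K / \<delta>\<^sup>2) / real N" using B0 by simp
        finally show ?thesis using False nn B0 by (simp add: E2_def E3_def R_def field_simps)
      qed
    qed
    have bigO: "F \<in> O(\<lambda>N. 1 / of_nat N)" if "\<And>N. N \<ge> 1 \<Longrightarrow> norm (F N) \<le> C / real N" for F :: "nat \<Rightarrow> complex" and C
      by (rule bigoI[of _ C], rule eventually_mono[OF eventually_ge_at_top[of 1]]) (use that in \<open>simp add: norm_divide\<close>)
    show ?thesis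
    proof (rule exI[of _ E1], rule exI[of _ E2], rule exI[of _ E3], intro conjI allI impI)
      fix \<beta> :: complex assume "0 < norm (\<beta> - 1) \<and> norm (\<beta> - 1) \<le> c'"
      hence \<beta>: "0 < norm (\<beta> - 1)" "norm (\<beta> - 1) \<le> norm (\<beta> - 1)" "norm (\<beta> - 1) \<le> c'" by auto
      show "E1 \<beta> \<in> O(\<lambda>N. 1 / of_nat N)" if "Re \<beta> \<le> 1" using b1[OF \<beta> that] by (rule bigO)
      show "?Z \<beta> N = 1 / r \<beta> * (1 + E1 \<beta> N)" if "Re \<beta> \<le> 1" "1 \<le> N" for N using r0[of \<beta>] \<beta>(1) by (auto simp: E1_def)
      show "E2 \<beta> \<in> O(\<lambda>N. 1 / of_nat N)" if "1 \<le> Re \<beta>" using b23[OF \<beta> that] by (intro bigO) blast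
      show "E3 \<beta> \<in> O(\<lambda>N. 1 / of_nat N)" if "1 \<le> Re \<beta>" using b23[OF \<beta> that] by (intro bigO) blast
      show "?Z \<beta> N = 1 / r \<beta> * (1 + E2 \<beta> N) + B \<beta> N * (1 + E3 \<beta> N)" if "1 \<le> Re \<beta>" "1 \<le> N" for N
        using b23[OF \<beta> that] by blast
    next
      fix \<delta> :: real assume \<delta>: "\<delta> > 0"
      have "\<forall>\<beta>. \<delta> \<le> norm (\<beta> - 1) \<and> norm (\<beta> - 1) \<le> c' \<longrightarrow>
            (Re \<beta> \<le> 1 \<longrightarrow> norm (E1 \<beta> N) \<le> (K / \<delta>\<^sup>2) / real N) \<and>
            (Re \<beta> \<ge> 1 \<longrightarrow> norm (E2 \<beta> N) \<le> (K / \<delta>\<^sup>2) / real N \<and> norm (E3 \<beta> N) \<le> (K / \<delta>\<^sup>2) / real N)" if "N \<ge> 1" for N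
        using b1[OF \<delta> _ _ _ that] b23[OF \<delta> _ _ _ that] by blast
      thus "\<exists>K. \<forall>\<^sub>F N in sequentially. \<forall>\<beta>. \<delta> \<le> norm (\<beta> - 1) \<and> norm (\<beta> - 1) \<le> c' \<longrightarrow>
            (Re \<beta> \<le> 1 \<longrightarrow> norm (E1 \<beta> N) \<le> K / real N) \<and>
            (Re \<beta> \<ge> 1 \<longrightarrow> norm (E2 \<beta> N) \<le> K / real N \<and> norm (E3 \<beta> N) \<le> K / real N)"
        by (intro exI[of _ "K / \<delta>\<^sup>2"] eventually_mono[OF eventually_ge_at_top[of 1]])
    qed
  qed
  show ?thesis
    using c'(1,2) main unfolding B_def by (intro exI[of _ c']) blast
qed

end
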